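(* Consider the class $\mathcal{P}_{HD}=\mathcal{P}_{HD}(R_X,R,B,s,\Phi_\Sigma)$ described in the context, with $\Phi_\Sigma\le\frac{3R_X^2}{16}$. There exists a universal constant $c_1>0$ such that if $2\le s\le c_1\min_{l\in[L]}|L_l|$ and $$\max_{g,h\in[L]}\left\{\frac{16s\log\left(1+\frac{|L_h|}{2(s-1)}\right)\min\left\{1,\frac{R^2}{B^2}\right\}\min\left\{1,\frac{1}{R_X^4}\right\}}{9(n_{g,h}+N)}\right\}\le1,\qquad\max_{i\in[L]}\left\{\frac{R^2s\log\left(1+\frac{|L_i|}{2s}\right)}{16B^2\Phi_\Sigma h_i}\right\}\le1,$$ then $$\inf_{\hat\beta\in\hat\Theta_{HD}}\sup_{P\in\mathcal{P}_{HD}}\mathbb{E}\left[\|\hat\beta-\beta^*\|_2^2\right]\ge\max\left\{\max_{h\in[L]}\left\{\frac{\min\left\{1,\frac{2^6}{3^2R_X^4}\right\}\min\{B^2,R^2\}s\log\left(1+\frac{|L_h|}{2(s-1)}\right)}{2^{17}\min_{g\in[L]}\{n_{g,h}+N\}}\right\},\ \max_{l\in[L]}\left\{\frac{R^2s}{2^{10}h_l\Phi_\Sigma}\log\left(1+\frac{|L_l|}{2s}\right)\right\}\right\}.$$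
   Context: Data model: $(X,Y)\in\mathbb{R}^p\times\mathbb{R}$ with $X\sim P_X$, $\Sigma=\mathbb{E}[XX^T]$, and $Y=X^T\beta^*+\epsilon$, where $\beta^*\in\mathbb{R}^p$, $\mathbb{E}[\epsilon|X]=0$, $\mathrm{Var}[\epsilon|X]=\sigma^2$. There are $K$ fixed missingness patterns with observed sets $O_k\subseteq[p]$, $\cup_kO_k=[p]$. The labelled data consist, independently over $k\in[K]$, of $n_k$ i.i.d. copies of $(X_{O_k},Y)$; in addition there are $N\ge0$ unlabelled i.i.d. copies of $X$, independent of the labelled data. The modalities $L_1,\dots,L_L$ form the partition of $[p]$ with the smallest number $L$ of parts such that each $O_k$ is a union of parts; $h_g=\sum_kn_k\mathbb{1}_{\{L_g\subseteq O_k\}}$ and $n_{g,h}=\sum_kn_k\mathbb{1}_{\{L_g\cup L_h\subseteq O_k\}}$. Class: for $R,B,R_X,\Phi_\Sigma>0$ and sparsity $s\in[0,p]$ (an integer), $\mathcal{P}_{HD}$ is the set of distributions of the full data on $\mathcal X=\prod_{k=1}^K(\mathbb{R}^{|O_k|+1})^{n_k}\times(\mathbb{R}^p)^N$ that arise when $Y=X^T\beta^*+\epsilon$ with $\mathbb{E}[\epsilon|X]=0$ and $\mathrm{Var}[\epsilon|X]=\sigma^2$, and the data consist, independently over $k\in[K]$, of $n_k$ i.i.d. copies of $(X_{O_k},Y)$ together with $N$ independent unlabelled i.i.d. copies of $X$, such that $\mathbb{E}[X]=0$, $\|X\|_{\psi_2}\le R_X$, $\epsilon$ is sub-Gaussian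 with parameter $\sigma$, $\Sigma$ satisfies $Re(s,\Phi_\Sigma)$, $\|\beta^*\|_0\le s$, $\|\beta^*\|_2\le B$ and $\sigma\le R$. $\hat\Theta_{HD}$ is the set of functions $\hat\beta:\mathcal X\to\mathbb{R}^p$ such that $x\mapsto\|\hat\beta(x)-\beta^*(P)\|_2$ is (Borel) measurable for every $P\in\mathcal{P}_{HD}$; $\beta^*=\beta^*(P)$ is the regression parameter of the mechanism $P$ and the expectation is over data drawn from $P$. Definitions: $\|Z\|_{\psi_2}=\inf\{c>0:\mathbb{E}e^{Z^2/c^2}\le2\}$ for scalar $Z$ and $\|X\|_{\psi_2}=\sup_{\|u\|_2=1}\|u^TX\|_{\psi_2}$ for vectors. The (mean-zero) noise $\epsilon$ is sub-Gaussian with parameter $\sigma$ if $\mathbb{E}e^{t\epsilon}\le e^{t^2\sigma^2/2}$ for all $t\in\mathbb{R}$. $\|x\|_0$ is the number of nonzero entries of $x$. For $A\in\mathbb{R}^{p\times p}$, $$\phi^2(A,s)=\inf_{S\subset[p],|S|\le s}\ \inf_{\delta\ne0:\|\delta_{S^c}\|_1\le\|\delta_S\|_1}\frac{\delta^TA\delta}{\|\delta_{M(\delta)}\|_2^2},\quad M(\delta)=S\cup\{i\in S^c:|\delta_i|\ge|\delta_{S^c}|_{(\min\{s,|S^c|\})}\},$$ where $|\delta_{S^c}|_{(j)}$ is the $j$th largest absolute value among the entries of $\delta_{S^c}$. $A$ satisfies $Re(s,\Phi)$ if $\phi^2(A,s)\ge\Phi$. *)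

theory Defs
  imports "HOL-Probability.Probability" "HOL-Library.Disjoint_Sets"
begin

text \<open>
  Since the dimension is quantified inside the statement, \<open>[p]\<close> is rendered as \<open>{..<p}\<close>, a vector
  indexed by \<open>I\<close> as a function \<open>nat \<Rightarrow> real\<close> of which only the restriction to \<open>I\<close> matters, and
  \<open>\<real>\<^sup>I\<close> as the measurable space \<open>vec_space I\<close>.
\<close>

abbreviation vec_space :: "nat set \<Rightarrow> (nat \<Rightarrow> real) measure" where
  "vec_space I \<equiv> Pi\<^sub>M I (\<lambda>_. borel)"

abbreviation inner_prod :: "nat \<Rightarrow> (nat \<Rightarrow> real) \<Rightarrow> (nat \<Rightarrow> real) \<Rightarrow> real" where
  "inner_prod p x y \<equiv> (\<Sum>i<p. x i * y i)"


subsection \<open>Modalities\<close>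

definition resolves_patterns :: "nat \<Rightarrow> nat \<Rightarrow> (nat \<Rightarrow> nat set) \<Rightarrow> nat set set \<Rightarrow> bool" where
  "resolves_patterns p K Obs \<L> \<longleftrightarrow>
     partition_on {..<p} \<L> \<and> (\<forall>k<K. \<exists>\<C>\<subseteq>\<L>. Obs k = \<Union>\<C>)"

definition modalities :: "nat \<Rightarrow> nat \<Rightarrow> (nat \<Rightarrow> nat set) \<Rightarrow> nat set set \<Rightarrow> bool" where
  "modalities p K Obs \<L> \<longleftrightarrow> is_arg_min card (resolves_patterns p K Obs) \<L>"

definition mod_count :: "nat \<Rightarrow> (nat \<Rightarrow> nat) \<Rightarrow> (nat \<Rightarrow> nat set) \<Rightarrow> nat set \<Rightarrow> nat" where
  "mod_count K n Obs g = (\<Sum>k<K. n k * of_bool (g \<subseteq> Obs k))"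

definition mod_pair_count ::
    "nat \<Rightarrow> (nat \<Rightarrow> nat) \<Rightarrow> (nat \<Rightarrow> nat set) \<Rightarrow> nat set \<Rightarrow> nat set \<Rightarrow> nat" where
  "mod_pair_count K n Obs g h = (\<Sum>k<K. n k * of_bool (g \<union> h \<subseteq> Obs k))"


subsection \<open>Tail conditions\<close>

text \<open>
  Exponential moments are taken as \<open>nn_integral\<close>s, so that a divergent one counts as \<open>\<infinity>\<close>
  (and the infimum of the empty set of admissible \<open>c\<close> is \<open>\<infinity>\<close>).
\<close>

definition psi2_norm :: "'a measure \<Rightarrow> ('a \<Rightarrow> real) \<Rightarrow> ennreal" where
  "psi2_norm M Z =
     Inf {ennreal c | c. c > 0 \<and> (\<integral>\<^sup>+ w. ennreal (exp ((Z w)\<^sup>2 / c\<^sup>2)) \<partial>M) \<le> 2}"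

definition psi2_norm_vec :: "nat \<Rightarrow> 'a measure \<Rightarrow> ('a \<Rightarrow> nat \<Rightarrow> real) \<Rightarrow> ennreal" where
  "psi2_norm_vec p M X =
     (SUP u\<in>{u. L2_set u {..<p} = 1}. psi2_norm M (\<lambda>w. inner_prod p u (X w)))"

definition subgaussian :: "'a measure \<Rightarrow> ('a \<Rightarrow> real) \<Rightarrow> real \<Rightarrow> bool" where
  "subgaussian M Z \<sigma> \<longleftrightarrow>
     (\<forall>t. (\<integral>\<^sup>+ w. ennreal (exp (t * Z w)) \<partial>M) \<le> ennreal (exp (t\<^sup>2 * \<sigma>\<^sup>2 / 2)))"


subsection \<open>Restricted eigenvalue condition\<close>

definition quad_form :: "nat \<Rightarrow> (nat \<Rightarrow> nat \<Rightarrow> real) \<Rightarrow> (nat \<Rightarrow> real) \<Rightarrow> real" where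
  "quad_form p A \<delta> = (\<Sum>i<p. \<Sum>j<p. \<delta> i * A i j * \<delta> j)"

text \<open>The \<open>j\<close>th largest absolute value (\<open>1 \<le> j \<le> card T\<close>) among the entries indexed by \<open>T\<close>.\<close>

definition abs_order_stat :: "(nat \<Rightarrow> real) \<Rightarrow> nat set \<Rightarrow> nat \<Rightarrow> real" where
  "abs_order_stat \<delta> T j = rev (sort (map (\<lambda>i. \<bar>\<delta> i\<bar>) (sorted_list_of_set T))) ! (j - 1)"

definition M_set :: "nat \<Rightarrow> nat \<Rightarrow> nat set \<Rightarrow> (nat \<Rightarrow> real) \<Rightarrow> nat set" where
  "M_set p s S \<delta> = S \<union> {i \<in> {..<p} - S.
     \<bar>\<delta> i\<bar> \<ge> abs_order_stat \<delta> ({..<p} - S) (min s (card ({..<p} - S)))}"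

text \<open>
  The cone condition forces \<open>\<delta>\<close> to be nonzero on \<open>S\<close>, so the denominator below is positive.
\<close>

definition phi_sq :: "nat \<Rightarrow> (nat \<Rightarrow> nat \<Rightarrow> real) \<Rightarrow> nat \<Rightarrow> ereal" where
  "phi_sq p A s =
     (INF S\<in>{S. S \<subseteq> {..<p} \<and> card S \<le> s}.
      INF \<delta>\<in>{\<delta>. (\<exists>i<p. \<delta> i \<noteq> 0) \<and> (\<Sum>i\<in>{..<p} - S. \<bar>\<delta> i\<bar>) \<le> (\<Sum>i\<in>S. \<bar>\<delta> i\<bar>)}.
        ereal (quad_form p A \<delta> / (L2_set \<delta> (M_set p s S \<delta>))\<^sup>2))"

definition RE_cond :: "nat \<Rightarrow> (nat \<Rightarrow> nat \<Rightarrow> real) \<Rightarrow> nat \<Rightarrow> real \<Rightarrow> bool" where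
  "RE_cond p A s \<Phi> \<longleftrightarrow> phi_sq p A s \<ge> ereal \<Phi>"


subsection \<open>The model class\<close>

text \<open>
  A mechanism consists of the joint law of \<open>(X, \<epsilon>)\<close>, the regression parameter \<open>\<beta>\<^sup>*\<close> and \<open>\<sigma>\<close>. The
  parameter has to be carried along: when some pair of modalities is never observed jointly,
  the law of the data need not determine \<open>\<beta>\<^sup>*\<close>.
\<close>

record mechanism =
  joint_law :: "((nat \<Rightarrow> real) \<times> real) measure"
  coef :: "nat \<Rightarrow> real"
  noise_sd :: real

definition sigma_X :: "nat \<Rightarrow> ((nat \<Rightarrow> real) \<times> real) measure \<Rightarrow> ((nat \<Rightarrow> real) \<times> real) measure" where
  "sigma_X p Q = vimage_algebra (space Q) fst (vec_space {..<p})"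

definition second_moment :: "((nat \<Rightarrow> real) \<times> real) measure \<Rightarrow> nat \<Rightarrow> nat \<Rightarrow> real" where
  "second_moment Q i j = (\<integral>z. fst z i * fst z j \<partial>Q)"

definition linear_model :: "nat \<Rightarrow> mechanism \<Rightarrow> bool" where
  "linear_model p P \<longleftrightarrow>
     (let Q = joint_law P; \<sigma> = noise_sd P;
          condE = real_cond_exp Q (sigma_X p Q)
      in prob_space Q
       \<and> sets Q = sets (vec_space {..<p} \<Otimes>\<^sub>M borel)
       \<and> coef P \<in> space (vec_space {..<p})
       \<and> \<sigma> \<ge> 0
       \<and> integrable Q snd \<and> integrable Q (\<lambda>z. (snd z)\<^sup>2)
       \<and> (AE z in Q. condE snd z = 0)
       \<and> (AE z in Q. condE (\<lambda>w. (snd w - condE snd w)\<^sup>2) z = \<sigma>\<^sup>2))"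

definition P_HD :: "nat \<Rightarrow> real \<Rightarrow> real \<Rightarrow> real \<Rightarrow> nat \<Rightarrow> real \<Rightarrow> mechanism set" where
  "P_HD p R\<^sub>X R B s \<Phi> = {P. linear_model p P
     \<and> (\<forall>i<p. has_bochner_integral (joint_law P) (\<lambda>z. fst z i) 0)
     \<and> psi2_norm_vec p (joint_law P) fst \<le> ennreal R\<^sub>X
     \<and> subgaussian (joint_law P) snd (noise_sd P)
     \<and> RE_cond p (second_moment (joint_law P)) s \<Phi>
     \<and> card {i. i < p \<and> coef P i \<noteq> 0} \<le> s
     \<and> L2_set (coef P) {..<p} \<le> B
     \<and> noise_sd P \<le> R}"


subsection \<open>Data and estimators\<close>

type_synonym dataset =
  "(nat \<Rightarrow> nat \<Rightarrow> (nat \<Rightarrow> real) \<times> real) \<times> (nat \<Rightarrow> nat \<Rightarrow> real)"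

definition data_space ::
    "nat \<Rightarrow> nat \<Rightarrow> (nat \<Rightarrow> nat) \<Rightarrow> nat \<Rightarrow> (nat \<Rightarrow> nat set) \<Rightarrow> dataset measure" where
  "data_space p K n N Obs =
     (\<Pi>\<^sub>M k\<in>{..<K}. \<Pi>\<^sub>M j\<in>{..<n k}. vec_space (Obs k) \<Otimes>\<^sub>M borel)
     \<Otimes>\<^sub>M (\<Pi>\<^sub>M j\<in>{..<N}. vec_space {..<p})"

definition labelled_law :: "nat \<Rightarrow> nat set \<Rightarrow> mechanism \<Rightarrow> ((nat \<Rightarrow> real) \<times> real) measure" where
  "labelled_law p I P = distr (joint_law P) (vec_space I \<Otimes>\<^sub>M borel)
     (\<lambda>(x, e). (restrict x I, inner_prod p x (coef P) + e))"

definition data_law ::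
    "nat \<Rightarrow> nat \<Rightarrow> (nat \<Rightarrow> nat) \<Rightarrow> nat \<Rightarrow> (nat \<Rightarrow> nat set) \<Rightarrow> mechanism \<Rightarrow> dataset measure" where
  "data_law p K n N Obs P =
     (\<Pi>\<^sub>M k\<in>{..<K}. \<Pi>\<^sub>M j\<in>{..<n k}. labelled_law p (Obs k) P)
     \<Otimes>\<^sub>M (\<Pi>\<^sub>M j\<in>{..<N}. distr (joint_law P) (vec_space {..<p}) fst)"

definition est_error :: "nat \<Rightarrow> mechanism \<Rightarrow> (nat \<Rightarrow> real) \<Rightarrow> real" where
  "est_error p P b = L2_set (\<lambda>i. b i - coef P i) {..<p}"

definition Theta_HD ::
    "nat \<Rightarrow> nat \<Rightarrow> (nat \<Rightarrow> nat) \<Rightarrow> nat \<Rightarrow> (nat \<Rightarrow> nat set) \<Rightarrow>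
     real \<Rightarrow> real \<Rightarrow> real \<Rightarrow> nat \<Rightarrow> real \<Rightarrow> (dataset \<Rightarrow> nat \<Rightarrow> real) set" where
  "Theta_HD p K n N Obs R\<^sub>X R B s \<Phi> =
     {bhat \<in> space (data_space p K n N Obs) \<rightarrow> space (vec_space {..<p}).
        \<forall>P \<in> P_HD p R\<^sub>X R B s \<Phi>.
          (\<lambda>x. est_error p P (bhat x)) \<in> borel_measurable (data_space p K n N Obs)}"

definition minimax_risk ::
    "nat \<Rightarrow> nat \<Rightarrow> (nat \<Rightarrow> nat) \<Rightarrow> nat \<Rightarrow> (nat \<Rightarrow> nat set) \<Rightarrow>
     real \<Rightarrow> real \<Rightarrow> real \<Rightarrow> nat \<Rightarrow> real \<Rightarrow> ennreal" where
  "minimax_risk p K n N Obs R\<^sub>X R B s \<Phi> =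
     (INF bhat \<in> Theta_HD p K n N Obs R\<^sub>X R B s \<Phi>.
      SUP P \<in> P_HD p R\<^sub>X R B s \<Phi>.
        \<integral>\<^sup>+ x. ennreal ((est_error p P (bhat x))\<^sup>2) \<partial>data_law p K n N Obs P)"

end

theory Submission
  imports Defs
begin

text \<open>
  Each rate in the maximum is a Bayes risk. Cut a modality \<open>H\<close> into \<open>s\<close> (or \<open>s - 1\<close>) blocks of about
  \<open>card H / s\<close> coordinates and let the regression vector have one active coordinate, of fixed
  size \<open>\<alpha>\<close>, in every block. Locating the active coordinate of one block while the others are held
  fixed is a test between \<open>m\<close> hypotheses. As long as any two of the data laws concerned have
  likelihood ratios with second moment at most \<open>m / 4\<close>, every test errs with average probability at
  least one half, which costs \<open>\<alpha>\<^sup>2 / 4\<close> per block and about \<open>s \<alpha>\<^sup>2 / 4\<close> in total (\<open>assouad_blocks\<close>,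
  \<open>minimax_risk_blocks\<close>). The largest admissible \<open>\<alpha>\<^sup>2\<close> is of order \<open>ln (card H / s)\<close> divided by the
  information in a sample times the number of samples that are informative at all, so everything
  depends on a construction in which few samples are informative.

  For the second rate, the covariates are independent signs scaled by \<open>sqrt \<Phi>\<close> and the noise is Gaussian
  (\<open>isotropic_lower_bound\<close>). A pattern that misses \<open>H\<close> sees the active coordinates only through
  a sum of unobserved exchangeable signs, whose law is the same under all hypotheses; hence only the
  \<open>mod_count\<close> samples that contain \<open>H\<close> help.

  For the first rate, let \<open>g \<notin> H\<close> and let \<open>S \<subseteq> H\<close> be the active set. With independent
  coordinates \<open>\<xi>\<close> put \<open>X\<^sub>i = w \<xi>\<^sub>i\<close> for \<open>i \<noteq> g\<close>, \<open>X\<^sub>g = w (\<xi>\<^sub>g + r (\<Sum>j\<in>S. \<xi>\<^sub>j))\<close> and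
  \<open>\<beta> = b e\<^sub>g - b r 1\<^sub>S\<close>. Then \<open>X \<bullet> \<beta> = w b \<xi>\<^sub>g\<close>: the contribution of \<open>S\<close> to the response cancels
  against the dependence of \<open>X\<^sub>g\<close> on \<open>S\<close>. Observations without \<open>X\<^sub>g\<close> have a law free of \<open>S\<close>, and
  observations with \<open>X\<^sub>g\<close> but without \<open>H\<close> depend on \<open>S\<close> only through exchangeable unobserved
  signs. Labelled samples therefore help only if they contain \<open>H\<close> and the modality of \<open>g\<close>, which gives
  the count \<open>mod_pair_count\<close>; the unlabelled ones help as well and add \<open>N\<close>
  (\<open>coupled_lower_bound\<close>). When the pair consists of twice the same modality, the first
  rate is dominated by the second (\<open>coupled_rate_le_isotropic_rate\<close>).

  In both constructions the coordinates that may be active are bounded, and the only densities that are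
  compared are Gaussian ones shifted by a bounded amount. This keeps the second moment of the likelihood
  ratios finite for all signal-to-noise ratios, whereas Gaussian coordinates in their place would make
  it infinite when \<open>\<alpha>\<close> is large in comparison with \<open>R\<close>.
  The constant \<open>1 / 16\<close> makes blocks so long that the logarithm of the length of a block compares with
  the logarithm in the statement.
\<close>

section \<open>Bounds on the Renyi divergence of order two\<close>

lemma ennreal_young:
  fixes x y :: ennreal
  assumes "0 < (t::real)"
  shows "2 * (x * y) \<le> ennreal t * x\<^sup>2 + ennreal (1 / t) * y\<^sup>2"
proof (cases "x = \<top> \<or> y = \<top>")
  case True
  then have "ennreal t * x\<^sup>2 + ennreal (1 / t) * y\<^sup>2 = \<top>"
    using assms by (auto simp: power2_eq_square ennreal_mult_eq_top_iff ennreal_top_mult ennreal_mult_top)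
  then show ?thesis by (simp only: top_greatest)
next
  case False
  then obtain a b where ab: "x = ennreal a" "y = ennreal b" "0 \<le> a" "0 \<le> b"
    by (metis ennreal_cases)
  have "0 \<le> (t * a - b)\<^sup>2 / t" using assms by simp
  also have "\<dots> = t * a\<^sup>2 + 1 / t * b\<^sup>2 - 2 * (a * b)"
    using assms by (simp add: power2_eq_square field_simps)
  finally have "2 * (a * b) \<le> t * a\<^sup>2 + 1 / t * b\<^sup>2" by simp
  then have "ennreal (2 * (a * b)) \<le> ennreal (t * a\<^sup>2 + 1 / t * b\<^sup>2)"
    by (rule ennreal_leI)
  then show ?thesis
    using assms ab
    by (simp add: ennreal_mult[of t] ennreal_mult[of "1 / t"] ennreal_mult[of 2] ennreal_mult[of a]
        ennreal_power del: times_divide_eq_left)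
qed

text \<open>
  Integrating Young's inequality gives a bound for every weight \<open>t\<close>; the optimal weight turns it
  into Cauchy-Schwarz. The degenerate and the infinite cases have to be separated first.
\<close>

lemma nn_integral_cauchy_schwarz:
  assumes [measurable]: "f \<in> borel_measurable M" "g \<in> borel_measurable M"
  shows "(\<integral>\<^sup>+ x. f x * g x \<partial>M)\<^sup>2 \<le> (\<integral>\<^sup>+ x. (f x)\<^sup>2 \<partial>M) * (\<integral>\<^sup>+ x. (g x)\<^sup>2 \<partial>M)"
proof -
  let ?A = "\<integral>\<^sup>+ x. (f x)\<^sup>2 \<partial>M" and ?B = "\<integral>\<^sup>+ x. (g x)\<^sup>2 \<partial>M"
  have null: "(\<integral>\<^sup>+ x. f x * g x \<partial>M) = 0" if "?A = 0 \<or> ?B = 0"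
  proof -
    from that have "AE x in M. f x * g x = 0"
      by (elim disjE) (auto simp: nn_integral_0_iff_AE)
    then show ?thesis by (simp add: nn_integral_0_iff_AE)
  qed
  consider "?A = 0 \<or> ?B = 0" | "?A \<noteq> 0" "?B \<noteq> 0" "?A = \<top> \<or> ?B = \<top>"
    | a b where "?A = ennreal a" "?B = ennreal b" "0 < a" "0 < b"
    by (metis ennreal_0 ennreal_cases order_less_le)
  then show ?thesis
  proof cases
    case 1
    then show ?thesis using null by simp
  next
    case 2
    then have "?A * ?B = \<top>" by (auto simp: ennreal_mult_eq_top_iff)
    then show ?thesis by simp
  next
    case 3
    have ineq: "2 * (\<integral>\<^sup>+ x. f x * g x \<partial>M) \<le> ennreal (t * a + b / t)" if t: "0 < t" for t
    proof -
      have "2 * (\<integral>\<^sup>+ x. f x * g x \<partial>M) = (\<integral>\<^sup>+ x. 2 * (f x * g x) \<partial>M)"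
        by (simp add: nn_integral_cmult)
      also have "\<dots> \<le> (\<integral>\<^sup>+ x. ennreal t * (f x)\<^sup>2 + ennreal (1 / t) * (g x)\<^sup>2 \<partial>M)"
        by (intro nn_integral_mono ennreal_young t)
      also have "\<dots> = ennreal t * ?A + ennreal (1 / t) * ?B"
        by (simp add: nn_integral_add nn_integral_cmult)
      also have "\<dots> = ennreal (t * a + b / t)"
        using 3 t by (simp add: ennreal_mult[symmetric] ennreal_plus[symmetric] del: ennreal_plus)
      finally show ?thesis .
    qed
    have "2 * (\<integral>\<^sup>+ x. f x * g x \<partial>M) < \<top>"
      by (rule le_less_trans[OF ineq[of 1]]) (auto simp: less_top)
    then have "(\<integral>\<^sup>+ x. f x * g x \<partial>M) \<noteq> \<top>"
      by (auto simp: ennreal_mult_top)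
    then obtain x where x: "(\<integral>\<^sup>+ x. f x * g x \<partial>M) = ennreal x" "0 \<le> x"
      by (metis ennreal_cases)
    define t where "t = sqrt (b / a)"
    have t: "0 < t" "t\<^sup>2 = b / a" using 3 by (auto simp: t_def)
    have "ennreal (2 * x) \<le> ennreal (t * a + b / t)"
      using ineq[OF t(1)] x by (simp add: ennreal_mult)
    then have "2 * x \<le> t * a + b / t"
      using 3 t by (subst (asm) ennreal_le_iff) (auto intro!: add_nonneg_nonneg)
    also have "b / t = t * a"
      using t 3 by (simp add: field_simps power2_eq_square)
    finally have "x\<^sup>2 \<le> (t * a)\<^sup>2"
      using x by (intro power_mono) (simp_all add: mult.commute)
    also have "\<dots> = a * b"
      using 3 by (simp add: power_mult_distrib t(2)) (simp add: power2_eq_square)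
    finally show ?thesis
      using 3 x by (simp add: ennreal_power ennreal_mult[symmetric] ennreal_leI)
  qed
qed

text \<open>
  If \<open>P\<close> has density \<open>h\<close> with respect to \<open>Q\<close>, the inequality for all \<open>f\<close> says that
  \<open>h\<^sup>2\<close> has \<open>Q\<close>-integral at most \<open>exp c\<close>: the Renyi divergence of order two is at most \<open>c\<close>, and the
  chi-squared divergence at most \<open>exp c - 1\<close>. The functional form passes to images and products
  without any density being constructed, and the bounds \<open>c\<close> add up over independent samples.
\<close>

definition renyi2_le :: "'a measure \<Rightarrow> 'a measure \<Rightarrow> real \<Rightarrow> bool" where
  "renyi2_le P Q c \<longleftrightarrow> sets P = sets Q \<and>
     (\<forall>f\<in>borel_measurable Q. (\<integral>\<^sup>+ x. f x \<partial>P)\<^sup>2 \<le> ennreal (exp c) * (\<integral>\<^sup>+ x. (f x)\<^sup>2 \<partial>Q))"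

lemma renyi2_leI:
  assumes "sets P = sets Q"
    and "\<And>f. f \<in> borel_measurable Q \<Longrightarrow>
           (\<integral>\<^sup>+ x. f x \<partial>P)\<^sup>2 \<le> ennreal (exp c) * (\<integral>\<^sup>+ x. (f x)\<^sup>2 \<partial>Q)"
  shows "renyi2_le P Q c"
  using assms by (auto simp: renyi2_le_def)

lemma renyi2_leD:
  assumes "renyi2_le P Q c" "f \<in> borel_measurable Q"
  shows "(\<integral>\<^sup>+ x. f x \<partial>P)\<^sup>2 \<le> ennreal (exp c) * (\<integral>\<^sup>+ x. (f x)\<^sup>2 \<partial>Q)"
  using assms by (auto simp: renyi2_le_def)

lemma renyi2_le_sets: "renyi2_le P Q c \<Longrightarrow> sets P = sets Q"
  by (simp add: renyi2_le_def)

lemma renyi2_le_refl: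
  assumes "prob_space P"
  shows "renyi2_le P P 0"
proof (rule renyi2_leI)
  interpret prob_space P by fact
  fix f :: "'a \<Rightarrow> ennreal" assume [measurable]: "f \<in> borel_measurable P"
  show "(\<integral>\<^sup>+ x. f x \<partial>P)\<^sup>2 \<le> ennreal (exp 0) * (\<integral>\<^sup>+ x. (f x)\<^sup>2 \<partial>P)"
    using nn_integral_cauchy_schwarz[of f P "\<lambda>_. 1"] by (simp add: emeasure_space_1)
qed simp

lemma renyi2_le_distr:
  assumes PQ: "renyi2_le P Q c" and T[measurable]: "T \<in> Q \<rightarrow>\<^sub>M N"
  shows "renyi2_le (distr P N T) (distr Q N T) c"
proof (rule renyi2_leI)
  have T': "T \<in> P \<rightarrow>\<^sub>M N"
    using T renyi2_le_sets[OF PQ] by (simp cong: measurable_cong_sets)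
  fix f :: "'b \<Rightarrow> ennreal" assume "f \<in> borel_measurable (distr Q N T)"
  then have [measurable]: "f \<in> borel_measurable N" by simp
  have "(\<integral>\<^sup>+ x. f (T x) \<partial>P)\<^sup>2 \<le> ennreal (exp c) * (\<integral>\<^sup>+ x. (f (T x))\<^sup>2 \<partial>Q)"
    by (intro renyi2_leD[OF PQ]) measurable
  then show "(\<integral>\<^sup>+ x. f x \<partial>distr P N T)\<^sup>2 \<le> ennreal (exp c) * (\<integral>\<^sup>+ x. (f x)\<^sup>2 \<partial>distr Q N T)"
    using T' by (simp add: nn_integral_distr)
qed simp

text \<open>
  Apply the hypothesis on the first factor to the inner integral as a function of the first
  coordinate, and the hypothesis on the second factor inside.
\<close>

lemma renyi2_le_pair:
  assumes PQ1: "renyi2_le P1 Q1 c1" and PQ2: "renyi2_le P2 Q2 c2"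
    and sf: "sigma_finite_measure P2" "sigma_finite_measure Q2"
  shows "renyi2_le (P1 \<Otimes>\<^sub>M P2) (Q1 \<Otimes>\<^sub>M Q2) (c1 + c2)"
proof (rule renyi2_leI)
  interpret P2: sigma_finite_measure P2 by fact
  interpret Q2: sigma_finite_measure Q2 by fact
  have eq[measurable_cong]: "sets P1 = sets Q1" "sets P2 = sets Q2"
    using PQ1 PQ2 by (auto dest: renyi2_le_sets)
  show sets: "sets (P1 \<Otimes>\<^sub>M P2) = sets (Q1 \<Otimes>\<^sub>M Q2)"
    by (intro sets_pair_measure_cong eq)
  have space: "space P1 = space Q1" using eq(1) by (rule sets_eq_imp_space_eq)
  fix f :: "'a \<times> 'b \<Rightarrow> ennreal" assume f: "f \<in> borel_measurable (Q1 \<Otimes>\<^sub>M Q2)"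
  then have [measurable]: "f \<in> borel_measurable (Q1 \<Otimes>\<^sub>M Q2)" .
  have f': "f \<in> borel_measurable (P1 \<Otimes>\<^sub>M P2)"
    using f sets by (simp cong: measurable_cong_sets)
  have slice: "(\<lambda>y. f (x, y)) \<in> borel_measurable Q2" if "x \<in> space Q1" for x
    using that by measurable
  define g where "g x = (\<integral>\<^sup>+ y. f (x, y) \<partial>P2)" for x
  have g[measurable]: "g \<in> borel_measurable Q1"
    unfolding g_def by measurable
  have "(\<integral>\<^sup>+ z. f z \<partial>(P1 \<Otimes>\<^sub>M P2))\<^sup>2 = (\<integral>\<^sup>+ x. g x \<partial>P1)\<^sup>2"
    by (simp add: P2.nn_integral_fst[OF f', symmetric] g_def)
  also have "\<dots> \<le> ennreal (exp c1) * (\<integral>\<^sup>+ x. (g x)\<^sup>2 \<partial>Q1)"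
    by (rule renyi2_leD[OF PQ1 g])
  also have "(\<integral>\<^sup>+ x. (g x)\<^sup>2 \<partial>Q1) \<le>
      (\<integral>\<^sup>+ x. ennreal (exp c2) * (\<integral>\<^sup>+ y. (f (x, y))\<^sup>2 \<partial>Q2) \<partial>Q1)"
    unfolding g_def by (intro nn_integral_mono renyi2_leD[OF PQ2] slice)
  also have "\<dots> = ennreal (exp c2) * (\<integral>\<^sup>+ x. \<integral>\<^sup>+ y. (f (x, y))\<^sup>2 \<partial>Q2 \<partial>Q1)"
    by (intro nn_integral_cmult) measurable
  also have "(\<integral>\<^sup>+ x. \<integral>\<^sup>+ y. (f (x, y))\<^sup>2 \<partial>Q2 \<partial>Q1) = (\<integral>\<^sup>+ z. (f z)\<^sup>2 \<partial>(Q1 \<Otimes>\<^sub>M Q2))"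
    by (subst Q2.nn_integral_fst[symmetric]) auto
  finally show "(\<integral>\<^sup>+ z. f z \<partial>(P1 \<Otimes>\<^sub>M P2))\<^sup>2 \<le>
      ennreal (exp (c1 + c2)) * (\<integral>\<^sup>+ z. (f z)\<^sup>2 \<partial>(Q1 \<Otimes>\<^sub>M Q2))"
    by (simp add: exp_add ennreal_mult mult.assoc mult_left_mono)
qed

lemma renyi2_le_PiM:
  assumes fin: "finite I"
    and PQ: "\<And>i. i \<in> I \<Longrightarrow> renyi2_le (P i) (Q i) (c i)"
    and prob: "\<And>i. i \<in> I \<Longrightarrow> prob_space (P i)" "\<And>i. i \<in> I \<Longrightarrow> prob_space (Q i)"
  shows "renyi2_le (PiM I P) (PiM I Q) (\<Sum>i\<in>I. c i)"
proof -
  \<comment> \<open>Product integrals over the index type need all factors to be sigma-finite, also those outside \<open>I\<close>.\<close>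
  let ?ext = "\<lambda>M i. if i \<in> I then M i else count_space {undefined}"
  have "renyi2_le (PiM J (?ext P)) (PiM J (?ext Q)) (\<Sum>i\<in>J. c i)" if "finite J" "J \<subseteq> I" for J
    using that
  proof (induction J rule: finite_induct)
    case empty
    show ?case
      using renyi2_le_refl[OF prob_space_PiM[of "{}" "?ext P"]] by (simp add: PiM_empty)
  next
    case (insert i J)
    interpret P: product_sigma_finite "?ext P"
      using prob by (auto simp: product_sigma_finite_def prob_space_imp_sigma_finite
          intro: sigma_finite_measure_count_space_finite)
    interpret Q: product_sigma_finite "?ext Q"
      using prob by (auto simp: product_sigma_finite_def prob_space_imp_sigma_finite
          intro: sigma_finite_measure_count_space_finite)
    have iI: "i \<in> I" using insert.prems by simp
    have eq: "sets (?ext P j) = sets (?ext Q j)" for j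
      using PQ by (auto dest: renyi2_le_sets)
    have sets_eq: "sets (PiM A (?ext P)) = sets (PiM A (?ext Q))" for A
      by (intro sets_PiM_cong eq refl)
    have pair: "renyi2_le (PiM J (?ext P) \<Otimes>\<^sub>M ?ext P i) (PiM J (?ext Q) \<Otimes>\<^sub>M ?ext Q i) ((\<Sum>j\<in>J. c j) + c i)"
      using insert PQ[OF iI] iI by (intro renyi2_le_pair P.sigma_finite_measures Q.sigma_finite_measures) auto
    show ?case
    proof (rule renyi2_leI)
      fix f :: "('a \<Rightarrow> 'b) \<Rightarrow> ennreal" assume f: "f \<in> borel_measurable (PiM (insert i J) (?ext Q))"
      then have f': "f \<in> borel_measurable (PiM (insert i J) (?ext P))"
        using sets_eq by (simp cong: measurable_cong_sets)
      define h where "h = (\<lambda>(x, y). f (x(i := y)))"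
      have h: "h \<in> borel_measurable (PiM J (?ext Q) \<Otimes>\<^sub>M ?ext Q i)"
        unfolding h_def using f by measurable
      have h2: "(\<lambda>z. (h z)\<^sup>2) \<in> borel_measurable (PiM J (?ext Q) \<Otimes>\<^sub>M ?ext Q i)"
        using h by measurable
      have h': "h \<in> borel_measurable (PiM J (?ext P) \<Otimes>\<^sub>M ?ext P i)"
        unfolding h_def using f' by measurable
      have "(\<integral>\<^sup>+ x. f x \<partial>PiM (insert i J) (?ext P)) = (\<integral>\<^sup>+ z. h z \<partial>(PiM J (?ext P) \<Otimes>\<^sub>M ?ext P i))"
        using insert f' unfolding P.nn_integral_fst[OF h', symmetric]
        by (subst P.product_nn_integral_insert) (simp_all add: h_def)
      moreover have "(\<integral>\<^sup>+ x. (f x)\<^sup>2 \<partial>PiM (insert i J) (?ext Q)) = (\<integral>\<^sup>+ z. (h z)\<^sup>2 \<partial>(PiM J (?ext Q) \<Otimes>\<^sub>M ?ext Q i))"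
        using insert f unfolding Q.nn_integral_fst[OF h2, symmetric]
        by (subst Q.product_nn_integral_insert) (simp_all add: h_def)
      ultimately show "(\<integral>\<^sup>+ x. f x \<partial>PiM (insert i J) (?ext P))\<^sup>2 \<le>
          ennreal (exp (\<Sum>j\<in>insert i J. c j)) * (\<integral>\<^sup>+ x. (f x)\<^sup>2 \<partial>PiM (insert i J) (?ext Q))"
        using renyi2_leD[OF pair h] insert by (simp add: add.commute)
    qed (rule sets_eq)
  qed
  from this[OF fin order_refl] show ?thesis
    by (simp cong: PiM_cong)
qed

text \<open>
  This is how divergences enter a testing problem: events that are rare under \<open>Q\<close> stay rare under \<open>P\<close>.
\<close>

lemma renyi2_le_event:
  assumes PQ: "renyi2_le P Q c" and A: "A \<in> sets Q"
    and prob: "prob_space P" "prob_space Q"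
  shows "(measure P A)\<^sup>2 \<le> exp c * measure Q A"
proof -
  interpret P: prob_space P by fact
  interpret Q: prob_space Q by fact
  have A': "A \<in> sets P" using A renyi2_le_sets[OF PQ] by simp
  have "(\<integral>\<^sup>+ x. indicator A x \<partial>P)\<^sup>2 \<le> ennreal (exp c) * (\<integral>\<^sup>+ x. (indicator A x)\<^sup>2 \<partial>Q)"
    using A by (intro renyi2_leD[OF PQ]) auto
  also have "(\<integral>\<^sup>+ x. (indicator A x)\<^sup>2 \<partial>Q) = (\<integral>\<^sup>+ x. indicator A x \<partial>Q)"
    by (intro nn_integral_cong) (auto simp: indicator_def)
  finally have "ennreal ((measure P A)\<^sup>2) \<le> ennreal (exp c * measure Q A)"
    using A A' by (simp add: P.emeasure_eq_measure Q.emeasure_eq_measure ennreal_mult ennreal_power)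
  then show ?thesis by (subst (asm) ennreal_le_iff) auto
qed

section \<open>Gaussian and Rademacher coordinates\<close>

definition gauss :: "real \<Rightarrow> real measure" where
  "gauss \<sigma> = density lborel (\<lambda>x. ennreal (normal_density 0 \<sigma> x))"

lemma sets_gauss[simp, measurable_cong]: "sets (gauss \<sigma>) = sets borel"
  by (simp add: gauss_def)

lemma space_gauss[simp]: "space (gauss \<sigma>) = UNIV"
  by (simp add: gauss_def)

lemma prob_space_gauss: "0 < \<sigma> \<Longrightarrow> prob_space (gauss \<sigma>)"
  by (simp add: gauss_def prob_space_normal_density)

lemma nn_integral_gauss:
  assumes [measurable]: "f \<in> borel_measurable borel"
  shows "(\<integral>\<^sup>+ x. f x \<partial>gauss \<sigma>) = (\<integral>\<^sup>+ x. ennreal (normal_density 0 \<sigma> x) * f x \<partial>lborel)"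
  unfolding gauss_def by (subst nn_integral_density) auto

lemma nn_integral_normal_density:
  "0 < \<sigma> \<Longrightarrow> (\<integral>\<^sup>+ x. ennreal (normal_density \<mu> \<sigma> x) \<partial>lborel) = 1"
  by (subst nn_integral_eq_integral) auto

lemma gauss_mgf:
  assumes s: "0 < \<sigma>"
  shows "(\<integral>\<^sup>+ x. ennreal (exp (t * x)) \<partial>gauss \<sigma>) = ennreal (exp (t\<^sup>2 * \<sigma>\<^sup>2 / 2))"
proof -
  have "normal_density 0 \<sigma> x * exp (t * x) = exp (t\<^sup>2 * \<sigma>\<^sup>2 / 2) * normal_density (t * \<sigma>\<^sup>2) \<sigma> x" for x
  proof -
    have "- (x - 0)\<^sup>2 / (2 * \<sigma>\<^sup>2) + t * x = t\<^sup>2 * \<sigma>\<^sup>2 / 2 + - (x - t * \<sigma>\<^sup>2)\<^sup>2 / (2 * \<sigma>\<^sup>2)"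
      using s by (simp add: field_simps power2_eq_square)
    then have "exp (- (x - 0)\<^sup>2 / (2 * \<sigma>\<^sup>2)) * exp (t * x)
        = exp (t\<^sup>2 * \<sigma>\<^sup>2 / 2) * exp (- (x - t * \<sigma>\<^sup>2)\<^sup>2 / (2 * \<sigma>\<^sup>2))"
      by (simp only: exp_add[symmetric])
    then show ?thesis by (simp add: normal_density_def)
  qed
  then have "(\<integral>\<^sup>+ x. ennreal (exp (t * x)) \<partial>gauss \<sigma>)
      = (\<integral>\<^sup>+ x. ennreal (exp (t\<^sup>2 * \<sigma>\<^sup>2 / 2)) * ennreal (normal_density (t * \<sigma>\<^sup>2) \<sigma> x) \<partial>lborel)"
    by (subst nn_integral_gauss) (auto simp: ennreal_mult[symmetric])
  also have "\<dots> = ennreal (exp (t\<^sup>2 * \<sigma>\<^sup>2 / 2))"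
    using s by (subst nn_integral_cmult) (auto simp: nn_integral_normal_density)
  finally show ?thesis .
qed

text \<open>
  Translating by \<open>d\<close> multiplies the density by a likelihood ratio \<open>h\<close> that is log-linear, so the
  second moment of \<open>h\<close> is a value of the moment generating function, namely
  \<open>exp (d\<^sup>2 / \<sigma>\<^sup>2)\<close>.
\<close>

lemma gauss_shift:
  assumes s: "0 < \<sigma>" and [measurable]: "f \<in> borel_measurable borel"
  shows "(\<integral>\<^sup>+ z. f (z + d) \<partial>gauss \<sigma>)\<^sup>2 \<le> ennreal (exp (d\<^sup>2 / \<sigma>\<^sup>2)) * (\<integral>\<^sup>+ z. (f z)\<^sup>2 \<partial>gauss \<sigma>)"
proof -
  define h where "h z = exp ((2 * d * z - d\<^sup>2) / (2 * \<sigma>\<^sup>2))" for z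
  have [measurable]: "h \<in> borel_measurable borel" unfolding h_def by measurable
  have tilt: "normal_density 0 \<sigma> (z - d) = normal_density 0 \<sigma> z * h z" for z
  proof -
    have "- (z - d - 0)\<^sup>2 / (2 * \<sigma>\<^sup>2) = - (z - 0)\<^sup>2 / (2 * \<sigma>\<^sup>2) + (2 * d * z - d\<^sup>2) / (2 * \<sigma>\<^sup>2)"
      using s by (simp add: field_simps power2_eq_square)
    then have "exp (- (z - d - 0)\<^sup>2 / (2 * \<sigma>\<^sup>2)) = exp (- (z - 0)\<^sup>2 / (2 * \<sigma>\<^sup>2)) * h z"
      unfolding h_def by (simp only: exp_add[symmetric])
    then show ?thesis by (simp add: normal_density_def)
  qed
  have "(\<integral>\<^sup>+ z. f (z + d) \<partial>gauss \<sigma>) = (\<integral>\<^sup>+ z. ennreal (normal_density 0 \<sigma> z) * f (z + d) \<partial>lborel)"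
    by (intro nn_integral_gauss) measurable
  also have "\<dots> = (\<integral>\<^sup>+ z. ennreal (normal_density 0 \<sigma> (z - d)) * f z \<partial>lborel)"
    using nn_integral_real_affine[of "\<lambda>z. ennreal (normal_density 0 \<sigma> (z - d)) * f z" 1 d]
    by (simp add: add.commute)
  also have "\<dots> = (\<integral>\<^sup>+ z. f z * ennreal (h z) \<partial>gauss \<sigma>)"
  proof (subst nn_integral_gauss, measurable, intro nn_integral_cong)
    fix z
    have "ennreal (normal_density 0 \<sigma> (z - d)) = ennreal (normal_density 0 \<sigma> z) * ennreal (h z)"
      by (simp add: tilt ennreal_mult h_def)
    then show "ennreal (normal_density 0 \<sigma> (z - d)) * f z = ennreal (normal_density 0 \<sigma> z) * (f z * ennreal (h z))"
      by (simp add: mult_ac)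
  qed
  finally have "(\<integral>\<^sup>+ z. f (z + d) \<partial>gauss \<sigma>)\<^sup>2 = (\<integral>\<^sup>+ z. f z * ennreal (h z) \<partial>gauss \<sigma>)\<^sup>2"
    by simp
  also have "\<dots> \<le> (\<integral>\<^sup>+ z. (f z)\<^sup>2 \<partial>gauss \<sigma>) * (\<integral>\<^sup>+ z. (ennreal (h z))\<^sup>2 \<partial>gauss \<sigma>)"
    by (intro nn_integral_cauchy_schwarz) measurable
  also have "(\<integral>\<^sup>+ z. (ennreal (h z))\<^sup>2 \<partial>gauss \<sigma>)
      = (\<integral>\<^sup>+ z. ennreal (exp (- (d\<^sup>2 / \<sigma>\<^sup>2))) * ennreal (exp (2 * d / \<sigma>\<^sup>2 * z)) \<partial>gauss \<sigma>)"
  proof (intro nn_integral_cong)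
    fix z
    have "(h z)\<^sup>2 = exp (- (d\<^sup>2 / \<sigma>\<^sup>2)) * exp (2 * d / \<sigma>\<^sup>2 * z)"
      using s by (simp add: h_def exp_double[symmetric] exp_add[symmetric]) (simp add: field_simps)
    then show "(ennreal (h z))\<^sup>2 = ennreal (exp (- (d\<^sup>2 / \<sigma>\<^sup>2))) * ennreal (exp (2 * d / \<sigma>\<^sup>2 * z))"
      by (simp add: ennreal_power h_def ennreal_mult)
  qed
  also have "\<dots> = ennreal (exp (- (d\<^sup>2 / \<sigma>\<^sup>2))) * ennreal (exp ((2 * d / \<sigma>\<^sup>2)\<^sup>2 * \<sigma>\<^sup>2 / 2))"
    by (subst nn_integral_cmult, measurable) (simp only: gauss_mgf[OF s])
  also have "\<dots> = ennreal (exp (- (d\<^sup>2 / \<sigma>\<^sup>2) + (2 * d / \<sigma>\<^sup>2)\<^sup>2 * \<sigma>\<^sup>2 / 2))"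
    by (subst ennreal_mult[symmetric]) (simp_all only: exp_add exp_ge_zero)
  also have "- (d\<^sup>2 / \<sigma>\<^sup>2) + (2 * d / \<sigma>\<^sup>2)\<^sup>2 * \<sigma>\<^sup>2 / 2 = d\<^sup>2 / \<sigma>\<^sup>2"
    using s by (simp add: field_simps power2_eq_square)
  finally show ?thesis by (simp add: mult.commute)
qed

lemma gauss_moments:
  assumes s: "0 < \<sigma>"
  shows "has_bochner_integral (gauss \<sigma>) (\<lambda>x. x) 0"
    and "has_bochner_integral (gauss \<sigma>) (\<lambda>x. x\<^sup>2) (\<sigma>\<^sup>2)"
proof -
  show "has_bochner_integral (gauss \<sigma>) (\<lambda>x. x) 0"
    unfolding gauss_def using normal_moment_nz_1[of \<sigma> 0] s
    by (intro has_bochner_integral_density) auto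
  have "has_bochner_integral lborel (\<lambda>x. normal_density 0 \<sigma> x * (x - 0) ^ (2 * 1)) (fact (2 * 1) / ((2 / \<sigma>\<^sup>2) ^ 1 * fact 1))"
    by (rule normal_moment_even[OF s])
  then show "has_bochner_integral (gauss \<sigma>) (\<lambda>x. x\<^sup>2) (\<sigma>\<^sup>2)"
    unfolding gauss_def using s
    by (intro has_bochner_integral_density) (auto simp: numeral_2_eq_2[symmetric])
qed

definition rademacher :: "real measure" where
  "rademacher = distr (measure_pmf (pmf_of_set {-1, 1})) borel (\<lambda>x. x)"

lemma sets_rademacher[simp, measurable_cong]: "sets rademacher = sets borel"
  by (simp add: rademacher_def)

lemma prob_space_rademacher: "prob_space rademacher"
  unfolding rademacher_def by (intro prob_space.prob_space_distr measure_pmf.prob_space_axioms) auto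

lemma AE_rademacher: "AE x in rademacher. \<bar>x\<bar> \<le> 1"
  unfolding rademacher_def by (subst AE_distr_iff) (auto simp: AE_measure_pmf_iff)

lemma rademacher_moments:
  "has_bochner_integral rademacher (\<lambda>x. x) 0"
  "has_bochner_integral rademacher (\<lambda>x. x\<^sup>2) 1"
  unfolding rademacher_def
  by (auto simp: has_bochner_integral_iff integral_distr integrable_distr_eq integral_pmf_of_set
      intro!: integrable_measure_pmf_finite)

text \<open>
  Hoeffding's lemma covers positive arguments; symmetry of the distribution gives the others.
\<close>

lemma rademacher_mgf:
  "(\<integral>\<^sup>+ x. ennreal (exp (t * x)) \<partial>rademacher) \<le> ennreal (exp (t\<^sup>2 / 2))"
proof -
  have pos: "(\<integral>\<^sup>+ x. ennreal (exp (t * x)) \<partial>rademacher) \<le> ennreal (exp (t\<^sup>2 / 2))" if "t > 0" for t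
  proof -
    interpret prob_space rademacher by (rule prob_space_rademacher)
    interpret interval_bounded_random_variable rademacher "\<lambda>x. x" "-1" 1
      by unfold_locales (use AE_rademacher in \<open>auto elim!: eventually_mono\<close>)
    show ?thesis
      using Hoeffdings_lemma_nn_integral_0[OF that] rademacher_moments(1)
      by (auto simp: has_bochner_integral_iff)
  qed
  have sym: "(\<integral>\<^sup>+ x. ennreal (exp (t * x)) \<partial>rademacher) = (\<integral>\<^sup>+ x. ennreal (exp (- t * x)) \<partial>rademacher)" for t
    unfolding rademacher_def by (simp add: nn_integral_distr nn_integral_pmf_of_set add.commute)
  show ?thesis
  proof (cases t "0 :: real" rule: linorder_cases)
    case equal
    then show ?thesis using prob_space.emeasure_space_1[OF prob_space_rademacher] by simp
  next
    case less
    then show ?thesis using pos[of "- t"] by (subst sym) simp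
  qed (rule pos)
qed

text \<open>
  What the two kinds of coordinates have in common that places a design assembled from them in the class.
\<close>

definition standard_subgaussian :: "real measure \<Rightarrow> bool" where
  "standard_subgaussian \<nu> \<longleftrightarrow> prob_space \<nu> \<and> sets \<nu> = sets borel
     \<and> has_bochner_integral \<nu> (\<lambda>x. x) 0 \<and> has_bochner_integral \<nu> (\<lambda>x. x\<^sup>2) 1
     \<and> (\<forall>t. (\<integral>\<^sup>+ x. ennreal (exp (t * x)) \<partial>\<nu>) \<le> ennreal (exp (t\<^sup>2 / 2)))"

lemma standard_subgaussian_gauss: "standard_subgaussian (gauss 1)"
  using gauss_moments[of 1] by (simp add: standard_subgaussian_def prob_space_gauss gauss_mgf)

lemma standard_subgaussian_rademacher: "standard_subgaussian rademacher"
  by (simp add: standard_subgaussian_def prob_space_rademacher rademacher_mgf rademacher_moments)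

text \<open>
  The Gaussian identity \<open>exp (y\<^sup>2 / c\<^sup>2) = E exp (sqrt 2 y G / c)\<close> linearises the square: exchanging the
  integrals leaves the moment generating function of \<open>Z\<close>, and then at most the Gaussian moment
  \<open>E exp (3 G\<^sup>2 / 8) = 2\<close>. The threshold \<open>3 / 8\<close> is exactly what makes this moment two.
\<close>

lemma subgaussian_psi2_norm:
  assumes [measurable]: "Z \<in> borel_measurable M" and prob: "prob_space M"
    and mgf: "\<And>t. (\<integral>\<^sup>+ w. ennreal (exp (t * Z w)) \<partial>M) \<le> ennreal (exp (t\<^sup>2 * V / 2))"
    and c: "0 < c" "8 * V \<le> 3 * c\<^sup>2"
  shows "psi2_norm M Z \<le> ennreal c"
proof -
  interpret prob_space M by fact
  interpret G: prob_space "gauss 1" by (rule prob_space_gauss) simp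
  interpret pair_sigma_finite "gauss 1" M ..
  have "(\<integral>\<^sup>+ w. ennreal (exp ((Z w)\<^sup>2 / c\<^sup>2)) \<partial>M)
      = (\<integral>\<^sup>+ w. (\<integral>\<^sup>+ z. ennreal (exp (sqrt 2 * Z w / c * z)) \<partial>gauss 1) \<partial>M)"
    by (subst gauss_mgf) (simp_all add: power_divide power_mult_distrib)
  also have "\<dots> = (\<integral>\<^sup>+ z. (\<integral>\<^sup>+ w. ennreal (exp (sqrt 2 * z / c * Z w)) \<partial>M) \<partial>gauss 1)"
    by (subst Fubini') (auto simp: mult_ac)
  also have "\<dots> \<le> (\<integral>\<^sup>+ z. ennreal (exp (3 / 8 * z\<^sup>2)) \<partial>gauss 1)"
  proof (intro nn_integral_mono)
    fix z
    have "(sqrt 2 * z / c)\<^sup>2 * V / 2 = z\<^sup>2 * (V / c\<^sup>2)"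
      by (simp add: power_divide power_mult_distrib)
    also have "\<dots> \<le> z\<^sup>2 * (3 / 8)"
      using c by (intro mult_left_mono) (auto simp: field_simps)
    finally have "(sqrt 2 * z / c)\<^sup>2 * V / 2 \<le> 3 / 8 * z\<^sup>2" by simp
    then show "(\<integral>\<^sup>+ w. ennreal (exp (sqrt 2 * z / c * Z w)) \<partial>M) \<le> ennreal (exp (3 / 8 * z\<^sup>2))"
      by (intro order.trans[OF mgf] ennreal_leI) simp
  qed
  also have "\<dots> = (\<integral>\<^sup>+ z. ennreal 2 * ennreal (normal_density 0 2 z) \<partial>lborel)"
  proof (subst nn_integral_gauss, simp, intro nn_integral_cong)
    fix z :: real
    have "exp (3 / 8 * z\<^sup>2) * exp (- z\<^sup>2 / 2) = exp (- z\<^sup>2 / 8)"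
      unfolding exp_add[symmetric] by simp
    then have "normal_density 0 1 z * exp (3 / 8 * z\<^sup>2) = 2 * normal_density 0 2 z"
      using real_sqrt_mult[of 4 2] by (simp add: normal_density_def real_sqrt_mult field_simps)
    then show "ennreal (normal_density 0 1 z) * ennreal (exp (3 / 8 * z\<^sup>2))
        = ennreal 2 * ennreal (normal_density 0 2 z)"
      by (simp only: ennreal_mult[symmetric] normal_density_nonneg exp_ge_zero zero_le_numeral)
  qed
  also have "\<dots> = 2"
    by (subst nn_integral_cmult) (auto simp: nn_integral_normal_density)
  finally show ?thesis
    unfolding psi2_norm_def using c(1) by (intro Inf_lower) auto
qed

lemma independent_linear_mgf:
  assumes fin: "finite I" and M: "\<And>i. standard_subgaussian (M i)"
  shows "(\<integral>\<^sup>+ x. ennreal (exp (t * (\<Sum>i\<in>I. a i * x i))) \<partial>PiM I M)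
         \<le> ennreal (exp (t\<^sup>2 * (\<Sum>i\<in>I. (a i)\<^sup>2) / 2))"
proof -
  interpret product_sigma_finite M
    using M by (auto simp: product_sigma_finite_def standard_subgaussian_def prob_space_imp_sigma_finite)
  have [measurable_cong]: "sets (M i) = sets borel" for i
    using M by (simp add: standard_subgaussian_def)
  have "(\<integral>\<^sup>+ x. ennreal (exp (t * (\<Sum>i\<in>I. a i * x i))) \<partial>PiM I M)
      = (\<integral>\<^sup>+ x. (\<Prod>i\<in>I. ennreal (exp (t * a i * x i))) \<partial>PiM I M)"
    by (simp add: sum_distrib_left exp_sum[OF fin] prod_ennreal mult_ac)
  also have "\<dots> = (\<Prod>i\<in>I. \<integral>\<^sup>+ y. ennreal (exp (t * a i * y)) \<partial>M i)"
    by (rule product_nn_integral_prod[OF fin]) measurable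
  also have "\<dots> \<le> (\<Prod>i\<in>I. ennreal (exp ((t * a i)\<^sup>2 / 2)))"
    using M by (intro prod_mono_ennreal) (auto simp: standard_subgaussian_def)
  also have "\<dots> = ennreal (exp (t\<^sup>2 * (\<Sum>i\<in>I. (a i)\<^sup>2) / 2))"
    by (simp add: prod_ennreal exp_sum[OF fin, symmetric] sum_distrib_left sum_divide_distrib power_mult_distrib)
  finally show ?thesis .
qed

text \<open>
  Both moments are integrals of products of one-dimensional functions, equal to one in all but at most
  two coordinates.
\<close>

lemma independent_moments:
  assumes fin: "finite I" and M: "\<And>i. standard_subgaussian (M i)" and ij: "i \<in> I" "j \<in> I"
  shows "has_bochner_integral (PiM I M) (\<lambda>x. x i) 0"
    and "has_bochner_integral (PiM I M) (\<lambda>x. x i * x j) (if i = j then 1 else 0)"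
proof -
  interpret product_sigma_finite M
    using M by (auto simp: product_sigma_finite_def standard_subgaussian_def prob_space_imp_sigma_finite)
  have M1: "integrable (M k) (\<lambda>_. 1::real)" "integral\<^sup>L (M k) (\<lambda>_. 1::real) = 1"
    "integrable (M k) (\<lambda>x. x)" "integral\<^sup>L (M k) (\<lambda>x. x) = 0"
    "integrable (M k) (\<lambda>x. x * x)" "integral\<^sup>L (M k) (\<lambda>x. x * x) = 1" for k
    using M[of k] by (auto simp: standard_subgaussian_def has_bochner_integral_iff power2_eq_square
        prob_space.prob_space prob_space_def finite_measure.integrable_const)
  define f where "f k y = (if k = i then y else 1) * (if k = j then y else (1::real))" for k y
  define g where "g k y = (if k = i then y else (1::real))" for k and y :: real
  have f: "integrable (M k) (f k)" "integral\<^sup>L (M k) (f k) = (if k = i \<or> k = j then (if i = j then 1 else 0) else 1)" for k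
    using M1[of k] by (cases "k = i"; cases "k = j"; simp add: f_def[abs_def])+
  have g: "integrable (M k) (g k)" "integral\<^sup>L (M k) (g k) = (if k = i then 0 else 1)" for k
    using M1[of k] by (cases "k = i"; simp add: g_def[abs_def])+
  have fp: "(\<Prod>k\<in>I. f k (x k)) = x i * x j" for x
    using fin ij by (simp add: f_def prod.distrib)
  have gp: "(\<Prod>k\<in>I. g k (x k)) = x i" for x
    using fin ij by (simp add: g_def)
  have "(\<Prod>k\<in>I. integral\<^sup>L (M k) (f k)) = (if i = j then 1 else 0)"
    using fin ij by (auto simp: f(2) intro!: prod_zero bexI[of _ i])
  then show "has_bochner_integral (PiM I M) (\<lambda>x. x i * x j) (if i = j then 1 else 0)"
    using product_integrable_prod[OF fin f(1)] product_integral_prod[OF fin f(1)]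
    by (simp add: has_bochner_integral_iff fp)
  have "(\<Prod>k\<in>I. integral\<^sup>L (M k) (g k)) = 0"
    using fin ij by (auto simp: g(2) intro!: prod_zero bexI[of _ i])
  then show "has_bochner_integral (PiM I M) (\<lambda>x. x i) 0"
    using product_integrable_prod[OF fin g(1)] product_integral_prod[OF fin g(1)]
    by (simp add: has_bochner_integral_iff gp)
qed

lemma independent_linear_second_moment:
  assumes fin: "finite I" and M: "\<And>i. standard_subgaussian (M i)"
  shows "has_bochner_integral (PiM I M)
           (\<lambda>x. (\<Sum>i\<in>I. a i * x i) * (\<Sum>i\<in>I. b i * x i)) (\<Sum>i\<in>I. a i * b i)"
proof -
  have "has_bochner_integral (PiM I M)
      (\<lambda>x. \<Sum>i\<in>I. \<Sum>j\<in>I. (a i * b j) * (x i * x j)) (\<Sum>i\<in>I. \<Sum>j\<in>I. (a i * b j) * (if i = j then 1 else 0))"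
    by (intro has_bochner_integral_sum has_bochner_integral_mult_right independent_moments assms)
  then show ?thesis
    using fin by (simp add: sum_product mult_ac if_distrib cong: if_cong)
qed

section \<open>A blockwise testing bound\<close>

lemma ennreal_sum_le: "ennreal (\<Sum>i\<in>A. f i) \<le> (\<Sum>i\<in>A. ennreal (f i))"
proof (induction A rule: infinite_finite_induct)
  case (insert i A)
  have "ennreal (a + b) \<le> ennreal a + ennreal b" for a b :: real
    by (cases "0 \<le> a"; cases "0 \<le> b") (auto simp: ennreal_neg add_nonpos_nonpos intro!: ennreal_leI)
  then have "ennreal (f i + (\<Sum>i\<in>A. f i)) \<le> ennreal (f i) + ennreal (\<Sum>i\<in>A. f i)" .
  also have "\<dots> \<le> ennreal (f i) + (\<Sum>i\<in>A. ennreal (f i))"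
    by (intro add_left_mono insert)
  finally show ?case using insert by simp
qed auto

text \<open>
  For a fixed block \<open>t\<close> and a fixed choice in the other blocks, the separation of the losses makes the
  events \<open>A j\<close> that the loss for \<open>j\<close> is below \<open>\<eta>\<close> disjoint. Their probabilities under the reference law
  \<open>D w\<close> add up to at most one, and by the divergence bound they are on average at most one half
  under their own laws. So the average loss in a block is at least \<open>\<eta> / 2\<close>, and some
  \<open>w\<close> does at least as badly as the average over all choices.
\<close>

lemma assouad_blocks:
  fixes D :: "('t \<Rightarrow> 'j) \<Rightarrow> 'x measure" and loss :: "'t \<Rightarrow> 'j \<Rightarrow> 'x \<Rightarrow> real" and c \<eta> :: real
  assumes fin: "finite T" "finite J"
    and prob: "\<And>w. w \<in> T \<rightarrow>\<^sub>E J \<Longrightarrow> prob_space (D w)"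
    and sets: "\<And>w. w \<in> T \<rightarrow>\<^sub>E J \<Longrightarrow> sets (D w) = sets S"
    and close: "\<And>w t j. w \<in> T \<rightarrow>\<^sub>E J \<Longrightarrow> t \<in> T \<Longrightarrow> j \<in> J \<Longrightarrow> renyi2_le (D (w(t := j))) (D w) c"
    and meas: "\<And>t j. t \<in> T \<Longrightarrow> j \<in> J \<Longrightarrow> loss t j \<in> borel_measurable S"
    and nonneg: "\<And>t j x. t \<in> T \<Longrightarrow> j \<in> J \<Longrightarrow> 0 \<le> loss t j x"
    and sep: "\<And>t j j' x. t \<in> T \<Longrightarrow> j \<in> J \<Longrightarrow> j' \<in> J \<Longrightarrow> j \<noteq> j' \<Longrightarrow> 2 * \<eta> \<le> loss t j x + loss t j' x"
    and many: "4 * exp c \<le> card J" and eta: "0 \<le> \<eta>"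
  shows "\<exists>w\<in>T \<rightarrow>\<^sub>E J. ennreal (card T * \<eta> / 2) \<le> (\<integral>\<^sup>+ x. ennreal (\<Sum>t\<in>T. loss t (w t) x) \<partial>D w)"
proof -
  define m where "m = card J"
  have m: "0 < m" using many by (auto simp: m_def intro: Nat.gr0I)
  then have "J \<noteq> {}" by (auto simp: m_def)
  define W where "W = T \<rightarrow>\<^sub>E J"
  have W: "finite W" "W \<noteq> {}"
    using fin \<open>J \<noteq> {}\<close> by (auto simp: W_def finite_PiE PiE_eq_empty_iff)
  have upd: "w(t := j) \<in> W" if "w \<in> W" "t \<in> T" "j \<in> J" for w t j
    using that by (auto simp: W_def PiE_def extensional_def)
  have app: "w t \<in> J" if "w \<in> W" "t \<in> T" for w t
    using that by (auto simp: W_def)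
  define G where "G t w = (\<integral>\<^sup>+ x. ennreal (loss t (w t) x) \<partial>D w)" for t w

  have block: "ennreal (m * \<eta> / 2) \<le> (\<Sum>j\<in>J. G t (w(t := j)))" if w: "w \<in> W" and t: "t \<in> T" for w t
  proof -
    define A where "A j = {x \<in> space S. loss t j x < \<eta>}" for j
    have A[measurable]: "A j \<in> sets S" if "j \<in> J" for j
      unfolding A_def using meas[OF t that] by measurable
    interpret Q: prob_space "D w" using prob w by (simp add: W_def)
    have disj: "disjoint_family_on A J"
    proof -
      have False if "j \<in> J" "j' \<in> J" "j \<noteq> j'" "x \<in> A j" "x \<in> A j'" for j j' x
        using sep[OF t that(1-3), of x] that(4,5) by (simp add: A_def)
      then show ?thesis by (auto simp: disjoint_family_on_def)
    qed
    have le1: "(\<Sum>j\<in>J. measure (D w) (A j)) \<le> 1"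
      using w fin(2) disj A sets by (subst Q.finite_measure_finite_Union[symmetric])
        (auto simp: W_def)
    have single: "ennreal (\<eta> * (3 / 4 - exp c * measure (D w) (A j))) \<le> G t (w(t := j))" if j: "j \<in> J" for j
    proof -
      let ?P = "D (w(t := j))"
      interpret P: prob_space ?P using prob upd[OF w t j] by (simp add: W_def)
      have setsP: "sets ?P = sets S" and setsQ: "sets (D w) = sets S"
        using sets upd[OF w t j] w by (auto simp: W_def)
      have AP[measurable]: "A j \<in> sets ?P" using A[OF j] setsP by simp
      \<comment> \<open>With \<open>x \<le> 1 / 4 + x\<^sup>2\<close>, this becomes linear in both probabilities.\<close>
      have "(measure ?P (A j))\<^sup>2 \<le> exp c * measure (D w) (A j)"
        using w t j A setsQ
        by (intro renyi2_le_event close P.prob_space_axioms Q.prob_space_axioms) (auto simp: W_def)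
      moreover have "0 \<le> (measure ?P (A j) - 1 / 2)\<^sup>2" by simp
      ultimately have "3 / 4 - exp c * measure (D w) (A j) \<le> 1 - measure ?P (A j)"
        by (simp add: power2_eq_square algebra_simps)
      also have "\<dots> = measure ?P (space ?P - A j)"
        using AP by (simp add: P.prob_compl)
      finally have "ennreal (\<eta> * (3 / 4 - exp c * measure (D w) (A j)))
          \<le> ennreal (\<eta> * measure ?P (space ?P - A j))"
        using eta by (intro ennreal_leI mult_left_mono)
      also have "\<dots> = (\<integral>\<^sup>+ x. ennreal \<eta> * indicator (space ?P - A j) x \<partial>?P)"
        using eta by (simp add: nn_integral_cmult_indicator P.emeasure_eq_measure ennreal_mult)
      also have "\<dots> \<le> (\<integral>\<^sup>+ x. ennreal (loss t j x) \<partial>?P)"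
      proof (intro nn_integral_mono)
        fix x assume "x \<in> space ?P"
        then show "ennreal \<eta> * indicator (space ?P - A j) x \<le> ennreal (loss t j x)"
          using sets_eq_imp_space_eq[OF setsP]
          by (auto simp: A_def indicator_def intro!: ennreal_leI)
      qed
      finally show ?thesis by (simp add: G_def)
    qed
    \<comment> \<open>The losses \<open>1 / 4\<close> and \<open>exp c / m \<le> 1 / 4\<close> leave an error probability of \<open>1 / 2\<close>.\<close>
    have "m * \<eta> / 2 \<le> \<eta> * (3 / 4 * m - exp c * 1)"
      using many eta mult_left_mono[OF many eta] by (simp add: m_def algebra_simps)
    also have "\<dots> \<le> \<eta> * (3 / 4 * m - exp c * (\<Sum>j\<in>J. measure (D w) (A j)))"
      using eta le1 by (intro mult_left_mono diff_left_mono) auto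
    also have "\<dots> = (\<Sum>j\<in>J. \<eta> * (3 / 4 - exp c * measure (D w) (A j)))"
      by (simp add: sum_distrib_left[symmetric] sum_subtractf m_def)
    also have "ennreal \<dots> \<le> (\<Sum>j\<in>J. ennreal (\<eta> * (3 / 4 - exp c * measure (D w) (A j))))"
      by (rule ennreal_sum_le)
    also have "\<dots> \<le> (\<Sum>j\<in>J. G t (w(t := j)))"
      by (intro sum_mono single)
    finally show ?thesis using ennreal_leI by blast
  qed

  \<comment> \<open>Exchanging \<open>j\<close> with the value of \<open>w\<close> at \<open>t\<close> is an involution of the pairs \<open>(w, j)\<close>.\<close>
  have swap: "(\<Sum>w\<in>W. \<Sum>j\<in>J. G t (w(t := j))) = of_nat m * (\<Sum>w\<in>W. G t w)" if t: "t \<in> T" for t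
  proof -
    have "(\<Sum>w\<in>W. \<Sum>j\<in>J. G t (w(t := j))) = (\<Sum>(w, j)\<in>W \<times> J. G t (w(t := j)))"
      by (simp add: sum.cartesian_product)
    also have "\<dots> = (\<Sum>(w, j)\<in>W \<times> J. G t w)"
      by (rule sum.reindex_bij_witness[where i = "\<lambda>(w, j). (w(t := j), w t)" and j = "\<lambda>(w, j). (w(t := j), w t)"])
        (auto simp: upd app t)
    also have "\<dots> = of_nat m * (\<Sum>w\<in>W. G t w)"
      by (simp add: sum.cartesian_product[symmetric] m_def sum_distrib_left)
    finally show ?thesis .
  qed
  have avg: "of_nat (card W) * ennreal (\<eta> / 2) \<le> (\<Sum>w\<in>W. G t w)" if t: "t \<in> T" for t
  proof -
    have "of_nat m * (of_nat (card W) * ennreal (\<eta> / 2)) = (\<Sum>w\<in>W. ennreal (m * \<eta> / 2))"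
      using eta by (simp add: ennreal_of_nat_eq_real_of_nat ennreal_mult[symmetric] mult_ac)
    also have "\<dots> \<le> of_nat m * (\<Sum>w\<in>W. G t w)"
      unfolding swap[OF t, symmetric] by (intro sum_mono block t)
    finally show ?thesis
      using m by (subst (asm) ennreal_mult_le_mult_iff) auto
  qed
  define H where "H w = (\<Sum>t\<in>T. G t w)" for w
  define M where "M = Max (H ` W)"
  have "of_nat (card W) * (of_nat (card T) * ennreal (\<eta> / 2)) = (\<Sum>t\<in>T. of_nat (card W) * ennreal (\<eta> / 2))"
    by (simp add: mult_ac)
  also have "\<dots> \<le> (\<Sum>t\<in>T. \<Sum>w\<in>W. G t w)"
    by (intro sum_mono avg)
  also have "\<dots> = (\<Sum>w\<in>W. H w)"
    unfolding H_def by (rule sum.swap)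
  also have "\<dots> \<le> of_nat (card W) * M"
    using W by (intro sum_bounded_above) (auto simp: M_def)
  finally have "of_nat (card T) * ennreal (\<eta> / 2) \<le> M"
    using W by (subst (asm) ennreal_mult_le_mult_iff) auto
  moreover have "M \<in> H ` W" unfolding M_def using W by (intro Max_in) auto
  ultimately obtain w where w: "w \<in> W" "of_nat (card T) * ennreal (\<eta> / 2) \<le> H w" by auto
  have "ennreal (card T * \<eta> / 2) = of_nat (card T) * ennreal (\<eta> / 2)"
    using eta by (simp add: ennreal_of_nat_eq_real_of_nat ennreal_mult[symmetric])
  also have "\<dots> \<le> H w" by (rule w(2))
  also have "H w = (\<integral>\<^sup>+ x. (\<Sum>t\<in>T. ennreal (loss t (w t) x)) \<partial>D w)"
    unfolding H_def G_def using w(1) meas app sets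
    by (subst nn_integral_sum) (auto simp: W_def cong: measurable_cong_sets)
  also have "\<dots> = (\<integral>\<^sup>+ x. ennreal (\<Sum>t\<in>T. loss t (w t) x) \<partial>D w)"
    using nonneg app[OF w(1)] by (intro nn_integral_cong) simp
  finally show ?thesis using w(1) by (auto simp: W_def)
qed

section \<open>Designs with independent Gaussian noise\<close>

lemma distr_pair_fst:
  assumes "prob_space N"
  shows "distr (M \<Otimes>\<^sub>M N) M fst = M"
proof (rule measure_eqI)
  interpret N: prob_space N by fact
  fix A assume "A \<in> sets (distr (M \<Otimes>\<^sub>M N) M fst)"
  then have A: "A \<in> sets M" by simp
  have "fst -` A \<inter> space (M \<Otimes>\<^sub>M N) = A \<times> space N"
    using sets.sets_into_space[OF A] by (auto simp: space_pair_measure)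
  then show "emeasure (distr (M \<Otimes>\<^sub>M N) M fst) A = emeasure M A"
    using A by (simp add: emeasure_distr N.emeasure_pair_measure_Times N.emeasure_space_1)
qed simp

lemma distr_pair_snd:
  assumes "prob_space M" "sigma_finite_measure N"
  shows "distr (M \<Otimes>\<^sub>M N) N snd = N"
proof (rule measure_eqI)
  interpret M: prob_space M by fact
  interpret N: sigma_finite_measure N by fact
  fix A assume "A \<in> sets (distr (M \<Otimes>\<^sub>M N) N snd)"
  then have A: "A \<in> sets N" by simp
  have "snd -` A \<inter> space (M \<Otimes>\<^sub>M N) = space M \<times> A"
    using sets.sets_into_space[OF A] by (auto simp: space_pair_measure)
  then show "emeasure (distr (M \<Otimes>\<^sub>M N) N snd) A = emeasure N A"
    using A by (simp add: emeasure_distr N.emeasure_pair_measure_Times M.emeasure_space_1)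
qed simp

lemma sets_sigma_X:
  assumes "fst \<in> Q \<rightarrow>\<^sub>M vec_space {..<p}"
  shows "sets (sigma_X p Q) = {fst -` C \<inter> space Q | C. C \<in> sets (vec_space {..<p})}"
  unfolding sigma_X_def using measurable_space[OF assms] by (intro sets_vimage_algebra2) auto

lemma subalgebra_sigma_X:
  assumes "fst \<in> Q \<rightarrow>\<^sub>M vec_space {..<p}"
  shows "subalgebra Q (sigma_X p Q)"
  using measurable_sets[OF assms]
  unfolding subalgebra_def sets_sigma_X[OF assms] by (auto simp: sigma_X_def)

lemma real_cond_exp_independent:
  fixes f :: "real \<Rightarrow> real"
  assumes X: "prob_space \<mu>" "sets \<mu> = sets (vec_space {..<p})"
    and N: "prob_space \<nu>" "sets \<nu> = sets borel"
    and f: "has_bochner_integral \<nu> f a"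
  defines "Q \<equiv> \<mu> \<Otimes>\<^sub>M \<nu>"
  shows "AE z in Q. real_cond_exp Q (sigma_X p Q) (\<lambda>z. f (snd z)) z = a"
proof -
  interpret X: prob_space \<mu> by fact
  interpret N: prob_space \<nu> by fact
  interpret XN: pair_prob_space \<mu> \<nu> ..

  have [measurable]: "f \<in> borel_measurable \<nu>" using f by (auto simp: has_bochner_integral_iff)
  have intf: "integrable Q (\<lambda>z. f (snd z))"
  proof -
    have "integrable (distr Q \<nu> snd) f"
      unfolding Q_def using f distr_pair_snd[OF X(1) N.sigma_finite_measure_axioms]
      by (simp add: has_bochner_integral_iff)
    then show ?thesis by (subst (asm) integrable_distr_eq) (auto simp: Q_def)
  qed
  have fst_meas: "fst \<in> Q \<rightarrow>\<^sub>M vec_space {..<p}"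
    using X(2) by (simp add: Q_def cong: measurable_cong_sets)
  interpret Q: prob_space Q unfolding Q_def by unfold_locales
  interpret finite_measure_subalgebra Q "sigma_X p Q"
    by unfold_locales (rule subalgebra_sigma_X[OF fst_meas])
  show ?thesis
  proof (rule real_cond_exp_charact)
    fix A assume "A \<in> sets (sigma_X p Q)"
    then obtain C where C: "C \<in> sets \<mu>" "A = fst -` C \<inter> space Q"
      using X(2) by (auto simp: sets_sigma_X[OF fst_meas])
    have factor: "(\<integral>z\<in>A. g (snd z) \<partial>Q) = measure \<mu> C * b" if g: "has_bochner_integral \<nu> g b" and
      ig: "integrable Q (\<lambda>z. g (snd z))" for g :: "real \<Rightarrow> real" and b
    proof -
      have A: "A \<in> sets Q" using C by (auto simp: Q_def)
      have "(\<integral>z\<in>A. g (snd z) \<partial>Q) = (\<integral>z. indicator C (fst z) * g (snd z) \<partial>Q)"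
        unfolding set_lebesgue_integral_def C
        by (intro Bochner_Integration.integral_cong) (auto simp: indicator_def)
      also have "\<dots> = (\<integral>x. (\<integral>y. indicator C x * g y \<partial>\<nu>) \<partial>\<mu>)"
      proof -
        have "integrable Q (\<lambda>z. indicator A z *\<^sub>R g (snd z))"
          by (intro integrable_mult_indicator A ig)
        then have "integrable Q (\<lambda>z. indicator C (fst z) * g (snd z))"
          by (subst Bochner_Integration.integrable_cong[OF refl]) (auto simp: C indicator_def)
        then show ?thesis
          unfolding Q_def by (subst XN.integral_fst'[symmetric]) auto
      qed
      also have "\<dots> = measure \<mu> C * b"
        using g C by (simp add: has_bochner_integral_iff)
      finally show ?thesis .
    qed
    have "has_bochner_integral \<nu> (\<lambda>_. a) a"
      using N.prob_space by (simp add: has_bochner_integral_iff)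
    then show "(\<integral>z\<in>A. f (snd z) \<partial>Q) = (\<integral>z\<in>A. a \<partial>Q)"
      using factor[OF f intf] factor[of "\<lambda>_. a" a] by simp
  qed (use intf in auto)
qed

text \<open>
  The restricted eigenvalue dominates the smallest eigenvalue because the norm over
  \<open>M_set\<close> is at most the full norm; that norm is positive because the cone condition prevents
  \<open>\<delta>\<close> from vanishing on \<open>S\<close>.
\<close>

lemma RE_cond_eigenvalue:
  assumes "0 \<le> \<Phi>" and eig: "\<And>\<delta>. \<Phi> * (\<Sum>i<p. (\<delta> i)\<^sup>2) \<le> quad_form p A \<delta>"
  shows "RE_cond p A s \<Phi>"
  unfolding RE_cond_def phi_sq_def
proof (intro INF_greatest, clarify)
  fix S \<delta> i
  assume S: "S \<subseteq> {..<p}" and i: "i < p" "\<delta> i \<noteq> (0::real)"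
    and cone: "(\<Sum>i\<in>{..<p} - S. \<bar>\<delta> i\<bar>) \<le> (\<Sum>i\<in>S. \<bar>\<delta> i\<bar>)"
  let ?M = "M_set p s S \<delta>"
  have M: "?M \<subseteq> {..<p}" "S \<subseteq> ?M" using S by (auto simp: M_set_def)
  then have finM: "finite ?M" using finite_subset by blast
  have "\<exists>j\<in>S. \<delta> j \<noteq> 0"
  proof (rule ccontr)
    assume "\<not> ?thesis"
    then have z: "\<forall>j\<in>S. \<delta> j = 0" by auto
    then have "(\<Sum>i\<in>{..<p} - S. \<bar>\<delta> i\<bar>) \<le> 0" using cone by simp
    moreover have "\<bar>\<delta> i\<bar> \<le> (\<Sum>i\<in>{..<p} - S. \<bar>\<delta> i\<bar>)"
      using i z by (intro member_le_sum) auto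
    ultimately show False using i by simp
  qed
  then obtain j where j: "j \<in> ?M" "\<delta> j \<noteq> 0" using M by auto
  have sq: "(L2_set \<delta> ?M)\<^sup>2 = (\<Sum>i\<in>?M. (\<delta> i)\<^sup>2)"
    by (simp add: L2_set_def sum_nonneg)
  have "(\<delta> j)\<^sup>2 \<le> (\<Sum>i\<in>?M. (\<delta> i)\<^sup>2)"
    using j finM by (intro member_le_sum) auto
  then have pos: "0 < (\<Sum>i\<in>?M. (\<delta> i)\<^sup>2)"
    using j by (smt (verit) zero_less_power2)
  have "\<Phi> * (\<Sum>i\<in>?M. (\<delta> i)\<^sup>2) \<le> \<Phi> * (\<Sum>i<p. (\<delta> i)\<^sup>2)"
    using M assms(1) by (intro mult_left_mono sum_mono2) auto
  also have "\<dots> \<le> quad_form p A \<delta>" by (rule eig)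
  finally show "ereal \<Phi> \<le> ereal (quad_form p A \<delta> / (L2_set \<delta> ?M)\<^sup>2)"
    using pos by (simp add: sq pos_le_divide_eq)
qed

text \<open>
  With noise independent of the covariates, the conditional moments are constants and all conditions of
  the class concern the two marginals separately. So it suffices to control the second
  moments of the design from below and its moment generating function from above.
\<close>

lemma independent_gaussian_noise_in_P_HD:
  assumes X: "prob_space \<mu>" "sets \<mu> = sets (vec_space {..<p})"
    and mean: "\<And>i. i < p \<Longrightarrow> has_bochner_integral \<mu> (\<lambda>x. x i) 0"
    and m2: "\<And>i j. i < p \<Longrightarrow> j < p \<Longrightarrow> integrable \<mu> (\<lambda>x. x i * x j)"
    and mgf: "\<And>u t. (\<integral>\<^sup>+ x. ennreal (exp (t * inner_prod p u x)) \<partial>\<mu>)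
                \<le> ennreal (exp (t\<^sup>2 * (V * (\<Sum>i<p. (u i)\<^sup>2)) / 2))"
    and eig: "\<And>u. \<Phi> * (\<Sum>i<p. (u i)\<^sup>2) \<le> (\<integral>x. (inner_prod p u x)\<^sup>2 \<partial>\<mu>)"
    and pos: "0 < R" "0 < R\<^sub>X" "0 \<le> \<Phi>" and V: "8 * V \<le> 3 * R\<^sub>X\<^sup>2"
    and \<beta>: "\<beta> \<in> space (vec_space {..<p})" "card {i. i < p \<and> \<beta> i \<noteq> 0} \<le> s" "L2_set \<beta> {..<p} \<le> B"
  shows "\<lparr>joint_law = \<mu> \<Otimes>\<^sub>M gauss R, coef = \<beta>, noise_sd = R\<rparr> \<in> P_HD p R\<^sub>X R B s \<Phi>"
proof -
  define Q where "Q = \<mu> \<Otimes>\<^sub>M gauss R"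
  interpret X: prob_space \<mu> by fact
  interpret N: prob_space "gauss R" using pos by (intro prob_space_gauss)
  interpret XN: pair_prob_space \<mu> "gauss R" ..
  have [measurable_cong]: "sets \<mu> = sets (vec_space {..<p})" by (rule X(2))
  interpret Q: prob_space Q unfolding Q_def by unfold_locales
  have fstQ: "distr Q \<mu> fst = \<mu>" and sndQ: "distr Q (gauss R) snd = gauss R"
    unfolding Q_def by (auto intro!: distr_pair_fst distr_pair_snd X N.prob_space_axioms N.sigma_finite_measure_axioms)
  have mfst[measurable]: "fst \<in> Q \<rightarrow>\<^sub>M \<mu>" and msnd[measurable]: "snd \<in> Q \<rightarrow>\<^sub>M gauss R"
    by (auto simp: Q_def)
  have bi_fst: "has_bochner_integral Q (\<lambda>z. f (fst z)) a" if "has_bochner_integral \<mu> f a" for f :: "_ \<Rightarrow> real" and a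
  proof -
    have [measurable]: "f \<in> borel_measurable \<mu>" using that by (auto simp: has_bochner_integral_iff)
    show ?thesis
      using that by (subst (asm) fstQ[symmetric]) (simp add: has_bochner_integral_iff integrable_distr_eq integral_distr)
  qed
  have bi_snd: "has_bochner_integral Q (\<lambda>z. f (snd z)) a" if "has_bochner_integral (gauss R) f a" for f :: "_ \<Rightarrow> real" and a
  proof -
    have [measurable]: "f \<in> borel_measurable (gauss R)" using that by (auto simp: has_bochner_integral_iff)
    show ?thesis
      using that by (subst (asm) sndQ[symmetric]) (simp add: has_bochner_integral_iff integrable_distr_eq integral_distr)
  qed
  have nn_fst: "(\<integral>\<^sup>+ z. f (fst z) \<partial>Q) = (\<integral>\<^sup>+ x. f x \<partial>\<mu>)" if "f \<in> borel_measurable \<mu>" for f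
    using that nn_integral_distr[OF mfst, of f] by (simp add: fstQ)
  have nn_snd: "(\<integral>\<^sup>+ z. f (snd z) \<partial>Q) = (\<integral>\<^sup>+ x. f x \<partial>gauss R)" if "f \<in> borel_measurable (gauss R)" for f
    using that nn_integral_distr[OF msnd, of f] by (simp add: sndQ)
  have c0: "AE z in Q. real_cond_exp Q (sigma_X p Q) snd z = 0"
    using real_cond_exp_independent[OF X N.prob_space_axioms sets_gauss gauss_moments(1)[OF pos(1)]]
    unfolding Q_def .
  have c2: "AE z in Q. real_cond_exp Q (sigma_X p Q) (\<lambda>z. (snd z)\<^sup>2) z = R\<^sup>2"
    using real_cond_exp_independent[OF X N.prob_space_axioms sets_gauss gauss_moments(2)[OF pos(1)]]
    unfolding Q_def .
  interpret S: finite_measure_subalgebra Q "sigma_X p Q"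
    using mfst X(2) by unfold_locales (simp add: subalgebra_sigma_X cong: measurable_cong_sets)
  have [measurable]: "snd \<in> borel_measurable Q" by (auto simp: Q_def)
  have "AE z in Q. real_cond_exp Q (sigma_X p Q) (\<lambda>w. (snd w - real_cond_exp Q (sigma_X p Q) snd w)\<^sup>2) z
      = real_cond_exp Q (sigma_X p Q) (\<lambda>z. (snd z)\<^sup>2) z"
    using c0 by (intro S.real_cond_exp_cong) auto
  with c2 have cv: "AE z in Q. real_cond_exp Q (sigma_X p Q) (\<lambda>w. (snd w - real_cond_exp Q (sigma_X p Q) snd w)\<^sup>2) z = R\<^sup>2"
    by eventually_elim simp
  have setsQ: "sets Q = sets (vec_space {..<p} \<Otimes>\<^sub>M borel)"
    unfolding Q_def by (intro sets_pair_measure_cong X(2) sets_gauss)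
  have lin: "linear_model p \<lparr>joint_law = Q, coef = \<beta>, noise_sd = R\<rparr>"
    unfolding linear_model_def Let_def mechanism.select_convs
    using c0 cv \<beta>(1) pos bi_snd[OF gauss_moments(1)[OF pos(1)]] bi_snd[OF gauss_moments(2)[OF pos(1)]]
      Q.prob_space_axioms setsQ
    by (simp add: has_bochner_integral_iff)
  have inner_meas: "inner_prod p u \<in> borel_measurable \<mu>" for u by measurable
  have psi: "psi2_norm_vec p Q fst \<le> ennreal R\<^sub>X"
    unfolding psi2_norm_vec_def
  proof (intro SUP_least, clarify)
    fix u :: "nat \<Rightarrow> real" assume u: "L2_set u {..<p} = 1"
    then have u1: "(\<Sum>i<p. (u i)\<^sup>2) = 1" by (simp add: L2_set_def)
    show "psi2_norm Q (\<lambda>w. inner_prod p u (fst w)) \<le> ennreal R\<^sub>X"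
    proof (rule subgaussian_psi2_norm)
      show "(\<lambda>w. inner_prod p u (fst w)) \<in> borel_measurable Q"
        by (rule measurable_compose[OF mfst inner_meas])
      fix t
      have "(\<integral>\<^sup>+ w. ennreal (exp (t * inner_prod p u (fst w))) \<partial>Q) = (\<integral>\<^sup>+ x. ennreal (exp (t * inner_prod p u x)) \<partial>\<mu>)"
        by (rule nn_fst) measurable
      also have "\<dots> \<le> ennreal (exp (t\<^sup>2 * V / 2))"
        using mgf[of t u] by (simp add: u1)
      finally show "(\<integral>\<^sup>+ w. ennreal (exp (t * inner_prod p u (fst w))) \<partial>Q) \<le> ennreal (exp (t\<^sup>2 * V / 2))" .
    qed (use pos V Q.prob_space_axioms in auto)
  qed
  have sg: "subgaussian Q snd R"
    unfolding subgaussian_def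
  proof
    fix t
    have "(\<integral>\<^sup>+ w. ennreal (exp (t * snd w)) \<partial>Q) = (\<integral>\<^sup>+ y. ennreal (exp (t * y)) \<partial>gauss R)"
      by (rule nn_snd) measurable
    then show "(\<integral>\<^sup>+ w. ennreal (exp (t * snd w)) \<partial>Q) \<le> ennreal (exp (t\<^sup>2 * R\<^sup>2 / 2))"
      by (simp add: gauss_mgf[OF pos(1)])
  qed
  have re: "RE_cond p (second_moment Q) s \<Phi>"
  proof (rule RE_cond_eigenvalue[OF pos(3)])
    fix \<delta> :: "nat \<Rightarrow> real"
    have sm: "second_moment Q i j = (\<integral>x. x i * x j \<partial>\<mu>)" if "i < p" "j < p" for i j
      using bi_fst[of "\<lambda>x. x i * x j" "\<integral>x. x i * x j \<partial>\<mu>"] m2[OF that]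
      by (simp add: second_moment_def has_bochner_integral_iff)
    have "\<Phi> * (\<Sum>i<p. (\<delta> i)\<^sup>2) \<le> (\<integral>x. (inner_prod p \<delta> x)\<^sup>2 \<partial>\<mu>)" by (rule eig)
    also have "(\<lambda>x. (inner_prod p \<delta> x)\<^sup>2) = (\<lambda>x. \<Sum>i<p. \<Sum>j<p. (\<delta> i * \<delta> j) * (x i * x j))"
      by (simp only: power2_eq_square sum_product mult_ac)
    also have "(\<integral>x. (\<Sum>i<p. \<Sum>j<p. (\<delta> i * \<delta> j) * (x i * x j)) \<partial>\<mu>) = quad_form p (second_moment Q) \<delta>"
    proof -
      have "has_bochner_integral \<mu> (\<lambda>x. \<Sum>i<p. \<Sum>j<p. (\<delta> i * \<delta> j) * (x i * x j))
          (\<Sum>i<p. \<Sum>j<p. (\<delta> i * \<delta> j) * (\<integral>x. x i * x j \<partial>\<mu>))"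
        by (intro has_bochner_integral_sum has_bochner_integral_mult_right has_bochner_integral_integrable m2) auto
      then have "(\<integral>x. (\<Sum>i<p. \<Sum>j<p. (\<delta> i * \<delta> j) * (x i * x j)) \<partial>\<mu>)
          = (\<Sum>i<p. \<Sum>j<p. (\<delta> i * \<delta> j) * (\<integral>x. x i * x j \<partial>\<mu>))"
        by (simp only: has_bochner_integral_iff)
      also have "\<dots> = quad_form p (second_moment Q) \<delta>"
        unfolding quad_form_def by (intro sum.cong) (auto simp: sm)
      finally show ?thesis .
    qed
    finally show "\<Phi> * (\<Sum>i<p. (\<delta> i)\<^sup>2) \<le> quad_form p (second_moment Q) \<delta>" .
  qed
  show ?thesis
    unfolding P_HD_def Q_def[symmetric]
    using lin psi sg re \<beta> bi_fst[OF mean] by simp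
qed

section \<open>A design with one coupled coordinate\<close>

text \<open>
  The coordinate \<open>g\<close> is Gaussian, since it has to absorb shifts, and the others are signs, since
  the size of a shift has to be bounded. The index \<open>g = p\<close> lies outside the range of coordinates
  and yields the design of independent signs.
\<close>

definition coord_law :: "nat \<Rightarrow> nat \<Rightarrow> real measure" where
  "coord_law g i = (if i = g then gauss 1 else rademacher)"

lemma sets_coord_law[simp, measurable_cong]: "sets (coord_law g i) = sets borel"
  by (simp add: coord_law_def)

lemma standard_subgaussian_coord_law: "standard_subgaussian (coord_law g i)"
  by (simp add: coord_law_def standard_subgaussian_gauss standard_subgaussian_rademacher)

lemma prob_space_coord_law: "prob_space (coord_law g i)"
  using standard_subgaussian_coord_law by (simp add: standard_subgaussian_def)

abbreviation noise_coords :: "nat \<Rightarrow> nat \<Rightarrow> (nat \<Rightarrow> real) measure" where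
  "noise_coords p g \<equiv> PiM {..<p} (coord_law g)"

lemma sets_noise_coords[measurable_cong]: "sets (noise_coords p g) = sets (vec_space {..<p})"
  by (intro sets_PiM_cong) auto

lemma prob_space_noise_coords: "prob_space (noise_coords p g)"
  by (intro prob_space_PiM prob_space_coord_law)

definition design :: "nat \<Rightarrow> real \<Rightarrow> real \<Rightarrow> nat \<Rightarrow> nat set \<Rightarrow> (nat \<Rightarrow> real) \<Rightarrow> nat \<Rightarrow> real" where
  "design p w r g S x = (\<lambda>i\<in>{..<p}. w * (x i + (if i = g then r * (\<Sum>j\<in>S. x j) else 0)))"

lemma design_measurable:
  assumes "S \<subseteq> {..<p}"
  shows "design p w r g S \<in> vec_space {..<p} \<rightarrow>\<^sub>M vec_space {..<p}"
proof -
  have [measurable]: "(\<lambda>x. x j) \<in> borel_measurable (vec_space {..<p})" if "j < p" for j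
    using that by (intro measurable_component_singleton) simp
  have "(\<lambda>x. \<Sum>j\<in>S. x j) \<in> borel_measurable (vec_space {..<p})"
    using assms by (intro borel_measurable_sum) auto
  then have "(\<lambda>x. if i = g then r * (\<Sum>j\<in>S. x j) else 0) \<in> borel_measurable (vec_space {..<p})" for i
    by (cases "i = g") auto
  then show ?thesis
    unfolding design_def by (intro measurable_restrict) auto
qed

text \<open>
  Moves the coupling from the design to the coefficients, so that linear functionals of \<open>X\<close> become
  linear functionals of the independent coordinates.
\<close>

lemma inner_prod_design:
  assumes "S \<subseteq> {..<p}" "g < p \<or> r = 0"
  shows "inner_prod p u (design p w r g S x)
       = (\<Sum>i<p. w * (u i + (if i \<in> S then r * u g else 0)) * x i)"
proof -
  have S: "(\<Sum>i<p. (if i \<in> S then r * u g else 0) * x i) = r * u g * (\<Sum>j\<in>S. x j)"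
  proof -
    have "(\<Sum>i<p. (if i \<in> S then r * u g else 0) * x i) = (\<Sum>i<p. if i \<in> S then r * u g * x i else 0)"
      by (intro sum.cong) auto
    also have "\<dots> = (\<Sum>i\<in>{..<p} \<inter> S. r * u g * x i)"
      by (rule sum.inter_restrict[symmetric]) simp
    finally show ?thesis using assms(1) by (simp add: Int_absorb1 sum_distrib_left)
  qed
  have g: "(\<Sum>i<p. u i * (if i = g then r * (\<Sum>j\<in>S. x j) else 0)) = r * u g * (\<Sum>j\<in>S. x j)"
    using assms(2) by (auto simp: if_distrib cong: if_cong)
  have "inner_prod p u (design p w r g S x)
      = w * ((\<Sum>i<p. u i * x i) + (\<Sum>i<p. u i * (if i = g then r * (\<Sum>j\<in>S. x j) else 0)))"
    unfolding sum.distrib[symmetric] sum_distrib_left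
    by (intro sum.cong) (auto simp: design_def algebra_simps sum_distrib_left)
  also have "\<dots> = w * ((\<Sum>i<p. u i * x i) + (\<Sum>i<p. (if i \<in> S then r * u g else 0) * x i))"
    by (simp only: g S)
  also have "\<dots> = (\<Sum>i<p. w * (u i + (if i \<in> S then r * u g else 0)) * x i)"
    unfolding sum.distrib[symmetric] sum_distrib_left
    by (intro sum.cong) (auto simp: algebra_simps)
  finally show ?thesis .
qed

definition mech :: "nat \<Rightarrow> real \<Rightarrow> real \<Rightarrow> nat \<Rightarrow> nat set \<Rightarrow> (nat \<Rightarrow> real) \<Rightarrow> real \<Rightarrow> mechanism" where
  "mech p w r g S \<beta> R =
     \<lparr>joint_law = distr (noise_coords p g) (vec_space {..<p}) (design p w r g S) \<Otimes>\<^sub>M gauss R,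
      coef = \<beta>, noise_sd = R\<rparr>"

text \<open>
  The quadratic form in \<open>lower\<close> and \<open>upper\<close> is the second moment of the projection of the design on
  \<open>u\<close>, and also its variance proxy.
\<close>

lemma mech_in_P_HD:
  assumes S: "S \<subseteq> {..<p}" "g < p \<or> r = 0"
    and lower: "\<And>u. \<Phi> * (\<Sum>i<p. (u i)\<^sup>2) \<le> w\<^sup>2 * (\<Sum>i<p. (u i + (if i \<in> S then r * u g else 0))\<^sup>2)"
    and upper: "\<And>u. w\<^sup>2 * (\<Sum>i<p. (u i + (if i \<in> S then r * u g else 0))\<^sup>2) \<le> V * (\<Sum>i<p. (u i)\<^sup>2)"
    and pos: "0 < R" "0 < R\<^sub>X" "0 \<le> \<Phi>" and V: "8 * V \<le> 3 * R\<^sub>X\<^sup>2"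
    and \<beta>: "\<beta> \<in> space (vec_space {..<p})" "card {i. i < p \<and> \<beta> i \<noteq> 0} \<le> s" "L2_set \<beta> {..<p} \<le> B"
  shows "mech p w r g S \<beta> R \<in> P_HD p R\<^sub>X R B s \<Phi>"
  unfolding mech_def
proof (rule independent_gaussian_noise_in_P_HD[where V = V])
  let ?c = "\<lambda>u i. w * (u i + (if i \<in> S then r * u g else 0))"
  let ?D = "design p w r g S"
  let ?\<mu> = "distr (noise_coords p g) (vec_space {..<p}) ?D"
  have D: "?D \<in> noise_coords p g \<rightarrow>\<^sub>M vec_space {..<p}"
    using design_measurable[OF S(1)] by (simp cong: measurable_cong_sets add: sets_noise_coords)
  have pick: "x i = inner_prod p (\<lambda>k. if k = i then 1 else 0) x" if "i < p" for x :: "nat \<Rightarrow> real" and i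
    using that by (simp add: if_distrib[of "\<lambda>a. a * _"] cong: if_cong)
  have lin: "inner_prod p u (?D x) = (\<Sum>i<p. ?c u i * x i)" for u x
    by (rule inner_prod_design[OF S])
  have sq: "(\<Sum>i<p. (?c u i)\<^sup>2) = w\<^sup>2 * (\<Sum>i<p. (u i + (if i \<in> S then r * u g else 0))\<^sup>2)" for u
    by (simp add: power_mult_distrib sum_distrib_left)
  have inner_meas[measurable]: "inner_prod p u \<in> borel_measurable (vec_space {..<p})" for u
    by measurable
  show "prob_space ?\<mu>"
    by (intro prob_space.prob_space_distr prob_space_noise_coords D)
  show "has_bochner_integral ?\<mu> (\<lambda>x. x i) 0" if "i < p" for i
  proof (rule has_bochner_integral_distr[OF _ D])
    have "has_bochner_integral (noise_coords p g) (\<lambda>x. \<Sum>k<p. ?c (\<lambda>k. if k = i then 1 else 0) k * x k)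
        (\<Sum>k<p. ?c (\<lambda>k. if k = i then 1 else 0) k * 0)"
      by (intro has_bochner_integral_sum has_bochner_integral_mult_right independent_moments
          standard_subgaussian_coord_law) auto
    then show "has_bochner_integral (noise_coords p g) (\<lambda>x. ?D x i) 0"
      by (subst pick[OF that], subst lin) simp
  qed (use that in \<open>intro measurable_component_singleton; simp\<close>)
  have m2: "has_bochner_integral ?\<mu> (\<lambda>x. inner_prod p u x * inner_prod p v x) (\<Sum>i<p. ?c u i * ?c v i)" for u v
  proof (rule has_bochner_integral_distr[OF _ D])
    show "has_bochner_integral (noise_coords p g) (\<lambda>x. inner_prod p u (?D x) * inner_prod p v (?D x)) (\<Sum>i<p. ?c u i * ?c v i)"
      unfolding lin by (intro independent_linear_second_moment standard_subgaussian_coord_law) auto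
  qed measurable
  show "integrable ?\<mu> (\<lambda>x. x i * x j)" if "i < p" "j < p" for i j
    using m2[of "\<lambda>k. if k = i then 1 else 0" "\<lambda>k. if k = j then 1 else 0"]
    by (simp only: pick[OF that(1), symmetric] pick[OF that(2), symmetric] has_bochner_integral_iff)
  show "\<Phi> * (\<Sum>i<p. (u i)\<^sup>2) \<le> (\<integral>x. (inner_prod p u x)\<^sup>2 \<partial>?\<mu>)" for u
  proof -
    have "(\<integral>x. (inner_prod p u x)\<^sup>2 \<partial>?\<mu>) = (\<Sum>i<p. (?c u i)\<^sup>2)"
      using m2[of u u] unfolding power2_eq_square by (simp only: has_bochner_integral_iff)
    then show ?thesis using lower[of u] by (simp only: sq)
  qed
  fix u :: "nat \<Rightarrow> real" and t :: real
  have "(\<integral>\<^sup>+ x. ennreal (exp (t * inner_prod p u x)) \<partial>?\<mu>)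
      = (\<integral>\<^sup>+ x. ennreal (exp (t * (\<Sum>i<p. ?c u i * x i))) \<partial>noise_coords p g)"
    by (subst nn_integral_distr[OF D]) (measurable, simp only: lin)
  also have "\<dots> \<le> ennreal (exp (t\<^sup>2 * (\<Sum>i<p. (?c u i)\<^sup>2) / 2))"
    by (intro independent_linear_mgf standard_subgaussian_coord_law) auto
  also have "\<dots> \<le> ennreal (exp (t\<^sup>2 * (V * (\<Sum>i<p. (u i)\<^sup>2)) / 2))"
    unfolding sq using upper[of u] by (intro ennreal_leI) (simp add: mult_left_mono)
  finally show "(\<integral>\<^sup>+ x. ennreal (exp (t * inner_prod p u x)) \<partial>?\<mu>)
      \<le> ennreal (exp (t\<^sup>2 * (V * (\<Sum>i<p. (u i)\<^sup>2)) / 2))" .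
qed (use pos V \<beta> in simp_all)

lemma labelled_law_measurable:
  assumes "I \<subseteq> {..<p}"
  shows "(\<lambda>(x, e). (restrict x I, inner_prod p x \<beta> + e)) \<in> vec_space {..<p} \<Otimes>\<^sub>M borel \<rightarrow>\<^sub>M vec_space I \<Otimes>\<^sub>M borel"
proof -

  have [measurable]: "(\<lambda>x. restrict x I) \<in> vec_space {..<p} \<rightarrow>\<^sub>M vec_space I"
    by (rule measurable_restrict_subset[OF assms])
  show ?thesis by measurable
qed

lemma sets_labelled_law[simp]: "sets (labelled_law p I P) = sets (vec_space I \<Otimes>\<^sub>M borel)"
  by (simp add: labelled_law_def)

text \<open>
  Every kind of observation is an image of a labelled sample of all coordinates, so a divergence bound for
  the latter covers all of them.
\<close>

lemma labelled_law_restrict: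
  assumes I: "I \<subseteq> {..<p}" and P: "sets (joint_law P) = sets (vec_space {..<p} \<Otimes>\<^sub>M borel)"
  shows "labelled_law p I P
       = distr (labelled_law p {..<p} P) (vec_space I \<Otimes>\<^sub>M borel) (\<lambda>(x, y). (restrict x I, y))"
proof -
  have [measurable]: "(\<lambda>x. restrict x I) \<in> vec_space {..<p} \<rightarrow>\<^sub>M vec_space I"
    by (rule measurable_restrict_subset[OF I])
  have "(\<lambda>(x, e). (restrict x {..<p}, inner_prod p x (coef P) + e))
      \<in> joint_law P \<rightarrow>\<^sub>M vec_space {..<p} \<Otimes>\<^sub>M borel"
    using labelled_law_measurable[OF order_refl, of p "coef P"] P by (simp cong: measurable_cong_sets)
  then show ?thesis
    unfolding labelled_law_def
    using I by (subst distr_distr) (measurable, auto intro!: distr_cong simp: fun_eq_iff)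
qed

lemma unlabelled_law_restrict:
  assumes P: "sets (joint_law P) = sets (vec_space {..<p} \<Otimes>\<^sub>M borel)"
  shows "distr (joint_law P) (vec_space {..<p}) fst = distr (labelled_law p {..<p} P) (vec_space {..<p}) fst"
proof -
  have "(\<lambda>(x, e). (restrict x {..<p}, inner_prod p x (coef P) + e))
      \<in> joint_law P \<rightarrow>\<^sub>M vec_space {..<p} \<Otimes>\<^sub>M borel"
    using labelled_law_measurable[OF order_refl, of p "coef P"] P by (simp cong: measurable_cong_sets)
  then show ?thesis
    unfolding labelled_law_def
    using sets_eq_imp_space_eq[OF P]
    by (subst distr_distr) (auto intro!: distr_cong simp: space_pair_measure space_PiM PiE_iff
        extensional_def restrict_def fun_eq_iff)
qed

lemma nn_integral_labelled_law_mech: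
  assumes S: "S \<subseteq> {..<p}" and I: "I \<subseteq> {..<p}" and R: "0 < R"
    and f: "f \<in> borel_measurable (vec_space I \<Otimes>\<^sub>M borel)"
  shows "(\<integral>\<^sup>+ z. f z \<partial>labelled_law p I (mech p w r g S \<beta> R))
       = (\<integral>\<^sup>+ x. \<integral>\<^sup>+ e. f (restrict (design p w r g S x) I, inner_prod p (design p w r g S x) \<beta> + e)
            \<partial>gauss R \<partial>noise_coords p g)"
proof -
  interpret N: prob_space "gauss R" using R by (intro prob_space_gauss)
  let ?D = "design p w r g S"
  let ?T = "\<lambda>(x, e). (restrict x I, inner_prod p x \<beta> + e)"
  have D: "?D \<in> noise_coords p g \<rightarrow>\<^sub>M vec_space {..<p}"
    using design_measurable[OF S] by (simp cong: measurable_cong_sets add: sets_noise_coords)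
  have T: "?T \<in> vec_space {..<p} \<Otimes>\<^sub>M borel \<rightarrow>\<^sub>M vec_space I \<Otimes>\<^sub>M borel"
    by (rule labelled_law_measurable[OF I])
  have fT: "(\<lambda>z. f (?T z)) \<in> borel_measurable (distr (noise_coords p g) (vec_space {..<p}) ?D \<Otimes>\<^sub>M gauss R)"
    using measurable_compose[OF T f] by (simp cong: measurable_cong_sets)
  have T': "?T \<in> distr (noise_coords p g) (vec_space {..<p}) ?D \<Otimes>\<^sub>M gauss R \<rightarrow>\<^sub>M vec_space I \<Otimes>\<^sub>M borel"
    using T by (simp cong: measurable_cong_sets)
  have "(\<integral>\<^sup>+ z. f z \<partial>labelled_law p I (mech p w r g S \<beta> R))
      = (\<integral>\<^sup>+ z. f (?T z) \<partial>(distr (noise_coords p g) (vec_space {..<p}) ?D \<Otimes>\<^sub>M gauss R))"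
    unfolding labelled_law_def mech_def mechanism.select_convs
    by (rule nn_integral_distr[OF T']) (use f in simp)
  also have "\<dots> = (\<integral>\<^sup>+ x. \<integral>\<^sup>+ e. f (?T (x, e)) \<partial>gauss R \<partial>distr (noise_coords p g) (vec_space {..<p}) ?D)"
    by (rule N.nn_integral_fst[OF fT, symmetric])
  also have "\<dots> = (\<integral>\<^sup>+ x. \<integral>\<^sup>+ e. f (?T (?D x, e)) \<partial>gauss R \<partial>noise_coords p g)"
    using N.borel_measurable_nn_integral_fst[OF fT] by (subst nn_integral_distr[OF D]) auto
  finally show ?thesis by simp
qed

text \<open>
  A bound that holds conditionally on a common ingredient \<open>x\<close> survives averaging over \<open>x\<close>.
\<close>

lemma nn_integral_square_le_mixture:
  assumes "prob_space M" and [measurable]: "a \<in> borel_measurable M" "b \<in> borel_measurable M"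
    and le: "AE x in M. (a x)\<^sup>2 \<le> C * b x"
  shows "(\<integral>\<^sup>+ x. a x \<partial>M)\<^sup>2 \<le> C * (\<integral>\<^sup>+ x. b x \<partial>M)"
proof -
  have "(\<integral>\<^sup>+ x. a x \<partial>M)\<^sup>2 \<le> (\<integral>\<^sup>+ x. (a x)\<^sup>2 \<partial>M)"
    using renyi2_leD[OF renyi2_le_refl[OF assms(1)], of a] by simp
  also have "\<dots> \<le> (\<integral>\<^sup>+ x. C * b x \<partial>M)"
    using le by (rule nn_integral_mono_AE)
  also have "\<dots> = C * (\<integral>\<^sup>+ x. b x \<partial>M)"
    by (rule nn_integral_cmult) measurable
  finally show ?thesis .
qed

lemma AE_coord_law_bounded:
  assumes "finite J"
  shows "AE x in PiM J (coord_law g). \<forall>i\<in>J - {g}. \<bar>x i\<bar> \<le> 1"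
proof (intro AE_finite_allI)
  fix i assume i: "i \<in> J - {g}"
  have "AE y in coord_law g i. \<bar>y\<bar> \<le> 1"
  proof -
    have "coord_law g i = rademacher" using i by (simp add: coord_law_def)
    then show ?thesis using AE_rademacher by (simp only:)
  qed
  then show "AE x in PiM J (coord_law g). \<bar>x i\<bar> \<le> 1"
    using i by (intro AE_PiM_component prob_space_coord_law) auto
qed (use assms in auto)

section \<open>Divergences between labelled samples\<close>

lemma labelled_kernel_measurable:
  assumes S: "S \<subseteq> {..<p}" and I: "I \<subseteq> {..<p}"
    and f: "f \<in> borel_measurable (vec_space I \<Otimes>\<^sub>M borel)"
  shows "(\<lambda>(x, e). f (restrict (design p w r g S x) I, inner_prod p (design p w r g S x) \<beta> + e))
           \<in> borel_measurable (noise_coords p g \<Otimes>\<^sub>M gauss R)"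
proof -
  have D[measurable]: "design p w r g S \<in> noise_coords p g \<rightarrow>\<^sub>M vec_space {..<p}"
    using design_measurable[OF S] by (simp cong: measurable_cong_sets add: sets_noise_coords)
  have "(\<lambda>(x, e). (design p w r g S x, e)) \<in> noise_coords p g \<Otimes>\<^sub>M gauss R \<rightarrow>\<^sub>M vec_space {..<p} \<Otimes>\<^sub>M borel"
    by measurable
  from measurable_compose[OF measurable_compose[OF this labelled_law_measurable[OF I, of \<beta>]] f]
  show ?thesis by (simp add: split_beta')
qed

text \<open>
  Conditionally on the covariates, the two responses are Gaussian with equal variance, and
  \<open>d\<close> bounds the distance of their means. The Gaussian coordinate \<open>g\<close> is exempt from the bound on
  the coordinates.
\<close>

lemma renyi2_le_regression:
  assumes S: "S \<subseteq> {..<p}" and R: "0 < R"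
    and d: "\<And>x. (\<forall>i\<in>{..<p} - {g}. \<bar>x i\<bar> \<le> 1) \<Longrightarrow>
      \<bar>inner_prod p (design p w r g S x) \<beta> - inner_prod p (design p w r g S x) \<beta>'\<bar> \<le> d"
  shows "renyi2_le (labelled_law p {..<p} (mech p w r g S \<beta> R)) (labelled_law p {..<p} (mech p w r g S \<beta>' R)) (d\<^sup>2 / R\<^sup>2)"
proof (rule renyi2_leI)
  interpret N: prob_space "gauss R" using R by (intro prob_space_gauss)
  let ?D = "design p w r g S"
  fix f :: "(nat \<Rightarrow> real) \<times> real \<Rightarrow> ennreal"
  assume "f \<in> borel_measurable (labelled_law p {..<p} (mech p w r g S \<beta>' R))"
  then have f: "f \<in> borel_measurable (vec_space {..<p} \<Otimes>\<^sub>M borel)"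
    by (simp cong: measurable_cong_sets)
  then have f2: "(\<lambda>z. (f z)\<^sup>2) \<in> borel_measurable (vec_space {..<p} \<Otimes>\<^sub>M borel)"
    by measurable
  define F where "F \<gamma> x e = f (restrict (?D x) {..<p}, inner_prod p (?D x) \<gamma> + e)" for \<gamma> x e
  have mF: "(\<lambda>(x, e). F \<gamma> x e) \<in> borel_measurable (noise_coords p g \<Otimes>\<^sub>M gauss R)" for \<gamma>
    unfolding F_def by (rule labelled_kernel_measurable[OF S order_refl f])
  have mF2: "(\<lambda>(x, e). (F \<gamma> x e)\<^sup>2) \<in> borel_measurable (noise_coords p g \<Otimes>\<^sub>M gauss R)" for \<gamma>
    unfolding F_def by (rule labelled_kernel_measurable[OF S order_refl f2])
  have "(\<integral>\<^sup>+ x. \<integral>\<^sup>+ e. F \<beta> x e \<partial>gauss R \<partial>noise_coords p g)\<^sup>2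
      \<le> ennreal (exp (d\<^sup>2 / R\<^sup>2)) * (\<integral>\<^sup>+ x. \<integral>\<^sup>+ e. (F \<beta>' x e)\<^sup>2 \<partial>gauss R \<partial>noise_coords p g)"
  proof (rule nn_integral_square_le_mixture[OF prob_space_noise_coords])
    show "(\<lambda>x. \<integral>\<^sup>+ e. F \<beta> x e \<partial>gauss R) \<in> borel_measurable (noise_coords p g)"
      using N.borel_measurable_nn_integral_fst[OF mF] by simp
    show "(\<lambda>x. \<integral>\<^sup>+ e. (F \<beta>' x e)\<^sup>2 \<partial>gauss R) \<in> borel_measurable (noise_coords p g)"
      using N.borel_measurable_nn_integral_fst[OF mF2] by simp
    show "AE x in noise_coords p g. (\<integral>\<^sup>+ e. F \<beta> x e \<partial>gauss R)\<^sup>2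
        \<le> ennreal (exp (d\<^sup>2 / R\<^sup>2)) * (\<integral>\<^sup>+ e. (F \<beta>' x e)\<^sup>2 \<partial>gauss R)"
      using AE_coord_law_bounded[OF finite_lessThan] AE_space
    proof eventually_elim
      case (elim x)
      define \<delta> where "\<delta> = inner_prod p (?D x) \<beta> - inner_prod p (?D x) \<beta>'"
      have shift: "F \<beta> x e = F \<beta>' x (e + \<delta>)" for e
        by (simp add: F_def \<delta>_def algebra_simps)
      have [measurable]: "F \<beta>' x \<in> borel_measurable borel"
        using measurable_Pair2[OF mF[of \<beta>'] elim(2)] by (simp cong: measurable_cong_sets)
      have "\<delta>\<^sup>2 / R\<^sup>2 \<le> d\<^sup>2 / R\<^sup>2"
        using d[OF elim(1)] by (intro divide_right_mono abs_le_square_iff[THEN iffD1]) (auto simp: \<delta>_def)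
      have "(\<integral>\<^sup>+ e. F \<beta> x e \<partial>gauss R)\<^sup>2 \<le> ennreal (exp (\<delta>\<^sup>2 / R\<^sup>2)) * (\<integral>\<^sup>+ e. (F \<beta>' x e)\<^sup>2 \<partial>gauss R)"
        unfolding shift by (rule gauss_shift[OF R]) measurable
      also have "\<dots> \<le> ennreal (exp (d\<^sup>2 / R\<^sup>2)) * (\<integral>\<^sup>+ e. (F \<beta>' x e)\<^sup>2 \<partial>gauss R)"
        using \<open>\<delta>\<^sup>2 / R\<^sup>2 \<le> d\<^sup>2 / R\<^sup>2\<close> by (intro mult_right_mono ennreal_leI) auto
      finally show ?case .
    qed
  qed
  then show "(\<integral>\<^sup>+ z. f z \<partial>labelled_law p {..<p} (mech p w r g S \<beta> R))\<^sup>2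
      \<le> ennreal (exp (d\<^sup>2 / R\<^sup>2)) * (\<integral>\<^sup>+ z. (f z)\<^sup>2 \<partial>labelled_law p {..<p} (mech p w r g S \<beta>' R))"
    by (simp add: nn_integral_labelled_law_mech[OF S order_refl R f] nn_integral_labelled_law_mech[OF S order_refl R f2] F_def)
qed simp

lemma design_shift:
  assumes "g \<notin> S" "g \<notin> S'" "g < p"
  shows "design p w r g S (x(g := z))
       = design p w r g S' (x(g := z + r * ((\<Sum>j\<in>S. x j) - (\<Sum>j\<in>S'. x j))))"
proof -
  have "(\<Sum>j\<in>T. (x(g := y)) j) = (\<Sum>j\<in>T. x j)" if "g \<notin> T" for T and y :: real
    using that by (intro sum.cong) auto
  then show ?thesis using assms by (auto simp: design_def fun_eq_iff restrict_def algebra_simps)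
qed

text \<open>
  Condition on all coordinates other than \<open>g\<close>. Passing from \<open>S\<close> to \<open>S'\<close> shifts the coordinate \<open>g\<close> by
  a bounded \<open>\<Delta>\<close>. As the response depends on that coordinate with slope \<open>a\<close>, it has to be
  brought back by shifting the noise by \<open>- a \<Delta>\<close>. The costs of the two Gaussian shifts,
  \<open>\<Delta>\<^sup>2\<close> and \<open>a\<^sup>2 \<Delta>\<^sup>2 / R\<^sup>2\<close>, add up.
\<close>

lemma renyi2_le_coupled_coordinate:
  assumes S: "S \<subseteq> {..<p}" "g \<notin> S" and S': "S' \<subseteq> {..<p}" "g \<notin> S'" and g: "g < p" and R: "0 < R"
    and y: "\<And>x. inner_prod p (design p w r g S x) \<beta> = a * x g"
    and y': "\<And>x. inner_prod p (design p w r g S' x) \<beta>' = a * x g"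
    and d: "\<And>x. (\<forall>i\<in>{..<p} - {g}. \<bar>x i\<bar> \<le> 1) \<Longrightarrow> \<bar>r * ((\<Sum>j\<in>S. x j) - (\<Sum>j\<in>S'. x j))\<bar> \<le> d"
  shows "renyi2_le (labelled_law p {..<p} (mech p w r g S \<beta> R)) (labelled_law p {..<p} (mech p w r g S' \<beta>' R))
           (d\<^sup>2 * (1 + a\<^sup>2 / R\<^sup>2))"
proof (rule renyi2_leI)
  interpret N: prob_space "gauss R" using R by (intro prob_space_gauss)
  interpret Z: prob_space "gauss 1" by (intro prob_space_gauss) simp
  interpret product_sigma_finite "coord_law g"
    by (simp add: product_sigma_finite_def prob_space_coord_law prob_space_imp_sigma_finite)
  let ?J = "{..<p} - {g}" and ?C = "d\<^sup>2 * (1 + a\<^sup>2 / R\<^sup>2)"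
  have insJ: "insert g ?J = {..<p}" "insert g {..<p} = {..<p}" using g by auto
  have cg: "coord_law g g = gauss 1" by (simp add: coord_law_def)
  fix f :: "(nat \<Rightarrow> real) \<times> real \<Rightarrow> ennreal"
  assume "f \<in> borel_measurable (labelled_law p {..<p} (mech p w r g S' \<beta>' R))"
  then have f: "f \<in> borel_measurable (vec_space {..<p} \<Otimes>\<^sub>M borel)"
    by (simp cong: measurable_cong_sets)
  then have f2: "(\<lambda>z. (f z)\<^sup>2) \<in> borel_measurable (vec_space {..<p} \<Otimes>\<^sub>M borel)"
    by measurable
  define F where "F x e = f (restrict (design p w r g S x) {..<p}, inner_prod p (design p w r g S x) \<beta> + e)" for x e
  define F' where "F' x e = f (restrict (design p w r g S' x) {..<p}, inner_prod p (design p w r g S' x) \<beta>' + e)" for x e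
  have mF: "(\<lambda>(x, e). F x e) \<in> borel_measurable (noise_coords p g \<Otimes>\<^sub>M gauss R)"
    unfolding F_def by (rule labelled_kernel_measurable[OF S(1) order_refl f])
  have mF': "(\<lambda>(x, e). F' x e) \<in> borel_measurable (noise_coords p g \<Otimes>\<^sub>M gauss R)"
    unfolding F'_def by (rule labelled_kernel_measurable[OF S'(1) order_refl f])
  have mF2: "(\<lambda>(x, e). (F' x e)\<^sup>2) \<in> borel_measurable (noise_coords p g \<Otimes>\<^sub>M gauss R)"
    unfolding F'_def by (rule labelled_kernel_measurable[OF S'(1) order_refl f2])
  have m1: "(\<lambda>x. \<integral>\<^sup>+ e. F x e \<partial>gauss R) \<in> borel_measurable (noise_coords p g)"
    using N.borel_measurable_nn_integral_fst[OF mF] by simp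
  have m2: "(\<lambda>x. \<integral>\<^sup>+ e. (F' x e)\<^sup>2 \<partial>gauss R) \<in> borel_measurable (noise_coords p g)"
    using N.borel_measurable_nn_integral_fst[OF mF2] by simp
  have split: "(\<integral>\<^sup>+ x. h x \<partial>noise_coords p g) = (\<integral>\<^sup>+ x. \<integral>\<^sup>+ z. h (x(g := z)) \<partial>gauss 1 \<partial>PiM ?J (coord_law g))"
    if "h \<in> borel_measurable (noise_coords p g)" for h
    using product_nn_integral_insert[of ?J g h] that by (simp add: insJ cg)
  have inner: "(\<lambda>x. \<integral>\<^sup>+ z. h (x(g := z)) \<partial>gauss 1) \<in> borel_measurable (PiM ?J (coord_law g))"
    if h: "h \<in> borel_measurable (noise_coords p g)" for h
  proof -
    have "(\<lambda>(x, z). x(g := z)) \<in> PiM ?J (coord_law g) \<Otimes>\<^sub>M gauss 1 \<rightarrow>\<^sub>M noise_coords p g"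
      using measurable_add_dim[of g ?J "coord_law g"] by (simp add: insJ cg)
    from measurable_compose[OF this h]
    have "(\<lambda>(x, z). h (x(g := z))) \<in> borel_measurable (PiM ?J (coord_law g) \<Otimes>\<^sub>M gauss 1)"
      by (simp add: split_beta')
    from Z.borel_measurable_nn_integral_fst[OF this] show ?thesis by simp
  qed
  have "(\<integral>\<^sup>+ x. \<integral>\<^sup>+ z. \<integral>\<^sup>+ e. F (x(g := z)) e \<partial>gauss R \<partial>gauss 1 \<partial>PiM ?J (coord_law g))\<^sup>2
      \<le> ennreal (exp ?C) * (\<integral>\<^sup>+ x. \<integral>\<^sup>+ z. \<integral>\<^sup>+ e. (F' (x(g := z)) e)\<^sup>2 \<partial>gauss R \<partial>gauss 1 \<partial>PiM ?J (coord_law g))"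
  proof (rule nn_integral_square_le_mixture[OF _ inner[OF m1] inner[OF m2]])
    show "prob_space (PiM ?J (coord_law g))" by (intro prob_space_PiM prob_space_coord_law)
    show "AE x in PiM ?J (coord_law g). (\<integral>\<^sup>+ z. \<integral>\<^sup>+ e. F (x(g := z)) e \<partial>gauss R \<partial>gauss 1)\<^sup>2
        \<le> ennreal (exp ?C) * (\<integral>\<^sup>+ z. \<integral>\<^sup>+ e. (F' (x(g := z)) e)\<^sup>2 \<partial>gauss R \<partial>gauss 1)"
      using AE_coord_law_bounded[of ?J g, OF finite_Diff[OF finite_lessThan]] AE_space
    proof eventually_elim
      case (elim x)
      define \<Delta> where "\<Delta> = r * ((\<Sum>j\<in>S. x j) - (\<Sum>j\<in>S'. x j))"
      define h where "h z e = F' (x(g := z)) e" for z e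
      have upd: "(\<lambda>z. x(g := z)) \<in> gauss 1 \<rightarrow>\<^sub>M noise_coords p g"
        using measurable_component_update[OF elim(2), of g] by (simp add: insJ cg)
      have "(\<lambda>(z, e). (x(g := z), e)) \<in> borel \<Otimes>\<^sub>M borel \<rightarrow>\<^sub>M noise_coords p g \<Otimes>\<^sub>M gauss R"
        using upd by (simp cong: measurable_cong_sets)
      from measurable_compose[OF this mF']
      have mh[measurable]: "(\<lambda>(z, e). h z e) \<in> borel_measurable (borel \<Otimes>\<^sub>M borel)"
        by (simp add: h_def split_beta')
      have shift: "F (x(g := z)) e = h (z + \<Delta>) (e + - (a * \<Delta>))" for z e
      proof -
        have "F (x(g := z)) e = f (restrict (design p w r g S (x(g := z))) {..<p}, a * z + e)"
          by (simp add: F_def y)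
        also have "\<dots> = f (restrict (design p w r g S' (x(g := z + \<Delta>))) {..<p}, a * z + e)"
          by (simp only: design_shift[OF S(2) S'(2) g] \<Delta>_def)
        also have "\<dots> = h (z + \<Delta>) (e + - (a * \<Delta>))"
          unfolding h_def F'_def y' by (simp add: algebra_simps)
        finally show ?thesis .
      qed
      define H where "H z = (\<integral>\<^sup>+ e. h z (e + - (a * \<Delta>)) \<partial>gauss R)" for z
      have "(\<lambda>(z, e). h z (e + - (a * \<Delta>))) \<in> borel_measurable (borel \<Otimes>\<^sub>M gauss R)"
        by measurable
      from N.borel_measurable_nn_integral_fst[OF this]
      have mH: "H \<in> borel_measurable borel" by (simp add: H_def[abs_def])
      have "(\<lambda>(z, e). (h z e)\<^sup>2) \<in> borel_measurable (borel \<Otimes>\<^sub>M gauss R)"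
        by measurable
      from N.borel_measurable_nn_integral_fst[OF this]
      have mh2: "(\<lambda>z. \<integral>\<^sup>+ e. (h z e)\<^sup>2 \<partial>gauss R) \<in> borel_measurable (gauss 1)"
        by (simp cong: measurable_cong_sets)
      have "(\<integral>\<^sup>+ z. (H z)\<^sup>2 \<partial>gauss 1)
          \<le> (\<integral>\<^sup>+ z. ennreal (exp ((- (a * \<Delta>))\<^sup>2 / R\<^sup>2)) * (\<integral>\<^sup>+ e. (h z e)\<^sup>2 \<partial>gauss R) \<partial>gauss 1)"
        unfolding H_def by (intro nn_integral_mono gauss_shift[OF R]) measurable
      also have "\<dots> = ennreal (exp ((- (a * \<Delta>))\<^sup>2 / R\<^sup>2)) * (\<integral>\<^sup>+ z. \<integral>\<^sup>+ e. (h z e)\<^sup>2 \<partial>gauss R \<partial>gauss 1)"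
        by (rule nn_integral_cmult[OF mh2])
      finally have noise: "(\<integral>\<^sup>+ z. (H z)\<^sup>2 \<partial>gauss 1)
          \<le> ennreal (exp ((- (a * \<Delta>))\<^sup>2 / R\<^sup>2)) * (\<integral>\<^sup>+ z. \<integral>\<^sup>+ e. (h z e)\<^sup>2 \<partial>gauss R \<partial>gauss 1)" .
      have "(\<integral>\<^sup>+ z. \<integral>\<^sup>+ e. F (x(g := z)) e \<partial>gauss R \<partial>gauss 1)\<^sup>2 = (\<integral>\<^sup>+ z. H (z + \<Delta>) \<partial>gauss 1)\<^sup>2"
        by (simp only: shift H_def)
      also have "\<dots> \<le> ennreal (exp (\<Delta>\<^sup>2 / 1\<^sup>2)) * (\<integral>\<^sup>+ z. (H z)\<^sup>2 \<partial>gauss 1)"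
        by (rule gauss_shift[OF _ mH]) simp
      also have "\<dots> \<le> ennreal (exp (\<Delta>\<^sup>2 / 1\<^sup>2)) * (ennreal (exp ((- (a * \<Delta>))\<^sup>2 / R\<^sup>2)) * (\<integral>\<^sup>+ z. \<integral>\<^sup>+ e. (h z e)\<^sup>2 \<partial>gauss R \<partial>gauss 1))"
        by (intro mult_left_mono noise) simp
      also have "\<dots> = ennreal (exp (\<Delta>\<^sup>2 * (1 + a\<^sup>2 / R\<^sup>2))) * (\<integral>\<^sup>+ z. \<integral>\<^sup>+ e. (h z e)\<^sup>2 \<partial>gauss R \<partial>gauss 1)"
      proof -
        have "\<Delta>\<^sup>2 * (1 + a\<^sup>2 / R\<^sup>2) = \<Delta>\<^sup>2 / 1\<^sup>2 + (- (a * \<Delta>))\<^sup>2 / R\<^sup>2"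
          by (simp add: algebra_simps power_mult_distrib)
        then show ?thesis by (simp only: exp_add ennreal_mult exp_ge_zero mult.assoc)
      qed
      also have "\<dots> \<le> ennreal (exp ?C) * (\<integral>\<^sup>+ z. \<integral>\<^sup>+ e. (h z e)\<^sup>2 \<partial>gauss R \<partial>gauss 1)"
      proof -
        have "\<Delta>\<^sup>2 \<le> d\<^sup>2"
          using d[of x] elim(1) by (intro abs_le_square_iff[THEN iffD1]) (auto simp: \<Delta>_def)
        then show ?thesis by (intro mult_right_mono ennreal_leI iffD2[OF exp_le_cancel_iff]) auto
      qed
      finally show ?case by (simp only: h_def)
    qed
  qed
  then show "(\<integral>\<^sup>+ z. f z \<partial>labelled_law p {..<p} (mech p w r g S \<beta> R))\<^sup>2
      \<le> ennreal (exp ?C) * (\<integral>\<^sup>+ z. (f z)\<^sup>2 \<partial>labelled_law p {..<p} (mech p w r g S' \<beta>' R))"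
    unfolding nn_integral_labelled_law_mech[OF S(1) order_refl R f]
      nn_integral_labelled_law_mech[OF S'(1) order_refl R f2]
    using split[OF m1] split[OF m2] by (simp add: F_def F'_def)
qed simp

text \<open>
  Exchanging two unobserved coordinates with the same distribution preserves the joint law of the
  coordinates, and it transports one mechanism to the other without changing the observation.
\<close>

lemma labelled_law_swap:
  assumes S: "S \<subseteq> {..<p}" "S' \<subseteq> {..<p}" "g < p \<or> r = 0" and I: "I \<subseteq> {..<p}" and R: "0 < R"
    and ij: "i < p" "j < p" "i \<noteq> g" "j \<noteq> g" "i \<notin> I" "j \<notin> I"
    and S': "S' = Transposition.transpose i j ` S"
    and \<beta>': "\<And>k. k < p \<or> k = g \<Longrightarrow> \<beta>' k = \<beta> (Transposition.transpose i j k)"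
  shows "labelled_law p I (mech p w r g S \<beta> R) = labelled_law p I (mech p w r g S' \<beta>' R)"
proof (rule measure_eqI)
  define \<pi> where "\<pi> = Transposition.transpose i j"
  have \<pi>\<pi>[simp]: "\<pi> (\<pi> k) = k" for k by (simp add: \<pi>_def)
  have \<pi>g[simp]: "\<pi> g = g" using ij by (simp add: \<pi>_def transpose_eq_iff)
  have \<pi>I: "\<pi> k = k" if "k \<in> I" for k
    using that ij by (auto simp: \<pi>_def Transposition.transpose_def)
  have \<pi>p[simp]: "\<pi> k < p \<longleftrightarrow> k < p" for k
    using ij by (auto simp: \<pi>_def Transposition.transpose_def)
  have inS': "k \<in> S' \<longleftrightarrow> \<pi> k \<in> S" for k
    unfolding S' \<pi>_def[symmetric] by (metis \<pi>\<pi> image_iff)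
  define sw where "sw x = (\<lambda>k\<in>{..<p}. x (\<pi> k))" for x :: "nat \<Rightarrow> real"
  have inj: "inj_on \<pi> A" for A by (metis \<pi>\<pi> inj_onI)
  have cl: "coord_law g (\<pi> k) = coord_law g k" for k
    by (metis \<pi>\<pi> \<pi>g coord_law_def)
  have sw_inv: "distr (noise_coords p g) (noise_coords p g) sw = noise_coords p g"
    using distr_PiM_reindex[of "{..<p}" "coord_law g" \<pi> "{..<p}"] inj
    by (simp add: cl prob_space_coord_law sw_def[abs_def])
  have sw_meas: "sw \<in> noise_coords p g \<rightarrow>\<^sub>M noise_coords p g"
    unfolding sw_def by (intro measurable_restrict) (auto simp: cl intro!: measurable_component_singleton cong: measurable_cong_sets)
  fix A assume "A \<in> sets (labelled_law p I (mech p w r g S \<beta> R))"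
  then have A: "A \<in> sets (vec_space I \<Otimes>\<^sub>M borel)" by simp
  define f :: "(nat \<Rightarrow> real) \<times> real \<Rightarrow> ennreal" where "f = indicator A"
  have f: "f \<in> borel_measurable (vec_space I \<Otimes>\<^sub>M borel)" using A by (simp add: f_def)
  define K where "K T \<gamma> x = (\<integral>\<^sup>+ e. f (restrict (design p w r g T x) I, inner_prod p (design p w r g T x) \<gamma> + e) \<partial>gauss R)" for T \<gamma> x
  interpret N: prob_space "gauss R" using R by (intro prob_space_gauss)
  have mK: "K S' \<beta>' \<in> borel_measurable (noise_coords p g)"
    using N.borel_measurable_nn_integral_fst[OF labelled_kernel_measurable[OF S(2) I f]]
    by (simp add: K_def[abs_def])
  have K: "K S' \<beta>' (sw x) = K S \<beta> x" for x
  proof -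
    have "(\<Sum>k\<in>S'. sw x k) = (\<Sum>k\<in>S'. x (\<pi> k))"
      using S(2) by (intro sum.cong) (auto simp: sw_def)
    also have "\<dots> = (\<Sum>k\<in>S. x k)"
      by (rule sum.reindex_bij_witness[of _ \<pi> \<pi>]) (auto simp: inS')
    finally have "restrict (design p w r g S' (sw x)) I = restrict (design p w r g S x) I"
      using I by (auto simp: fun_eq_iff restrict_def design_def sw_def \<pi>I)
    moreover have "inner_prod p \<beta>' (design p w r g S' (sw x)) = inner_prod p \<beta> (design p w r g S x)"
      unfolding inner_prod_design[OF S(2,3)] inner_prod_design[OF S(1,3)]
      by (rule sum.reindex_bij_witness[of _ \<pi> \<pi>]) (auto simp: \<beta>'[folded \<pi>_def] inS' sw_def)
    ultimately show ?thesis by (simp only: K_def mult.commute)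
  qed
  have "emeasure (labelled_law p I (mech p w r g S \<beta> R)) A = (\<integral>\<^sup>+ x. K S \<beta> x \<partial>noise_coords p g)"
    using nn_integral_labelled_law_mech[OF S(1) I R f, of w r g \<beta>] A by (simp add: f_def K_def)
  also have "\<dots> = (\<integral>\<^sup>+ x. K S' \<beta>' (sw x) \<partial>noise_coords p g)" by (simp only: K)
  also have "\<dots> = (\<integral>\<^sup>+ x. K S' \<beta>' x \<partial>distr (noise_coords p g) (noise_coords p g) sw)"
    using mK by (subst nn_integral_distr[OF sw_meas]) auto
  also have "\<dots> = emeasure (labelled_law p I (mech p w r g S' \<beta>' R)) A"
    using nn_integral_labelled_law_mech[OF S(2) I R f, of w r g \<beta>'] A by (simp add: f_def K_def sw_inv)
  finally show "emeasure (labelled_law p I (mech p w r g S \<beta> R)) A = emeasure (labelled_law p I (mech p w r g S' \<beta>' R)) A" .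
qed simp

text \<open>
  The active set influences the design only at coordinate \<open>g\<close>, so if the response is the same
  function of the independent coordinates, the observation is, too.
\<close>

lemma labelled_law_unobserved_coupling:
  assumes S: "S \<subseteq> {..<p}" "S' \<subseteq> {..<p}" and I: "I \<subseteq> {..<p}" "g \<notin> I" and R: "0 < R"
    and y: "\<And>x. inner_prod p (design p w r g S x) \<beta> = inner_prod p (design p w r g S' x) \<beta>'"
  shows "labelled_law p I (mech p w r g S \<beta> R) = labelled_law p I (mech p w r g S' \<beta>' R)"
proof (rule measure_eqI)
  fix A assume "A \<in> sets (labelled_law p I (mech p w r g S \<beta> R))"
  then have A: "A \<in> sets (vec_space I \<Otimes>\<^sub>M borel)" by simp
  then have f: "(indicator A :: _ \<Rightarrow> ennreal) \<in> borel_measurable (vec_space I \<Otimes>\<^sub>M borel)" by simp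
  have "restrict (design p w r g S x) I = restrict (design p w r g S' x) I" for x
    using I by (auto simp: fun_eq_iff restrict_def design_def)
  then show "emeasure (labelled_law p I (mech p w r g S \<beta> R)) A = emeasure (labelled_law p I (mech p w r g S' \<beta>' R)) A"
    using nn_integral_labelled_law_mech[OF S(1) I(1) R f, of w r g \<beta>]
      nn_integral_labelled_law_mech[OF S(2) I(1) R f, of w r g \<beta>'] A by (simp add: y)
qed simp

section \<open>Data laws and estimators\<close>

definition proper_law :: "nat \<Rightarrow> mechanism \<Rightarrow> bool" where
  "proper_law p P \<longleftrightarrow> prob_space (joint_law P) \<and> sets (joint_law P) = sets (vec_space {..<p} \<Otimes>\<^sub>M borel)"

lemma proper_law_P_HD: "P \<in> P_HD p R\<^sub>X R B s \<Phi> \<Longrightarrow> proper_law p P"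
  by (auto simp: P_HD_def linear_model_def Let_def proper_law_def)

lemma prob_space_unlabelled_law:
  assumes "proper_law p P"
  shows "prob_space (distr (joint_law P) (vec_space {..<p}) fst)"
  using assms unfolding proper_law_def
  by (intro prob_space.prob_space_distr) (auto cong: measurable_cong_sets)

lemma prob_space_labelled_law:
  assumes "proper_law p P" "I \<subseteq> {..<p}"
  shows "prob_space (labelled_law p I P)"
  unfolding labelled_law_def
  using labelled_law_measurable[OF assms(2), of "coef P"] assms(1) unfolding proper_law_def
  by (intro prob_space.prob_space_distr) (auto cong: measurable_cong_sets)

lemma sets_data_law: "sets (data_law p K n N Obs P) = sets (data_space p K n N Obs)"
  unfolding data_law_def data_space_def
  by (intro sets_pair_measure_cong sets_PiM_cong) auto

lemma prob_space_data_law: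
  assumes P: "proper_law p P" and Obs: "\<And>k. k < K \<Longrightarrow> Obs k \<subseteq> {..<p}"
  shows "prob_space (data_law p K n N Obs P)"
proof -
  interpret L: prob_space "\<Pi>\<^sub>M k\<in>{..<K}. \<Pi>\<^sub>M j\<in>{..<n k}. labelled_law p (Obs k) P"
    using Obs by (intro prob_space_PiM prob_space_labelled_law P) auto
  interpret U: prob_space "\<Pi>\<^sub>M j\<in>{..<N}. distr (joint_law P) (vec_space {..<p}) fst"
    by (intro prob_space_PiM prob_space_unlabelled_law P)
  interpret pair_prob_space "\<Pi>\<^sub>M k\<in>{..<K}. \<Pi>\<^sub>M j\<in>{..<n k}. labelled_law p (Obs k) P"
    "\<Pi>\<^sub>M j\<in>{..<N}. distr (joint_law P) (vec_space {..<p}) fst" ..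
  show ?thesis unfolding data_law_def by unfold_locales
qed

lemma renyi2_le_partial_observation:
  assumes P: "proper_law p P" "proper_law p P'"
    and full: "renyi2_le (labelled_law p {..<p} P) (labelled_law p {..<p} P') c"
  shows "I \<subseteq> {..<p} \<Longrightarrow> renyi2_le (labelled_law p I P) (labelled_law p I P') c"
    and "renyi2_le (distr (joint_law P) (vec_space {..<p}) fst) (distr (joint_law P') (vec_space {..<p}) fst) c"
proof -
  have sets: "sets (joint_law P) = sets (vec_space {..<p} \<Otimes>\<^sub>M borel)"
    "sets (joint_law P') = sets (vec_space {..<p} \<Otimes>\<^sub>M borel)"
    using P by (simp_all add: proper_law_def)
  show "renyi2_le (labelled_law p I P) (labelled_law p I P') c" if I: "I \<subseteq> {..<p}"
  proof -
    have [measurable]: "(\<lambda>x. restrict x I) \<in> vec_space {..<p} \<rightarrow>\<^sub>M vec_space I"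
      by (rule measurable_restrict_subset[OF I])
    have "(\<lambda>(x, y). (restrict x I, y)) \<in> vec_space {..<p} \<Otimes>\<^sub>M borel \<rightarrow>\<^sub>M vec_space I \<Otimes>\<^sub>M borel"
      by measurable
    then have "(\<lambda>(x, y). (restrict x I, y)) \<in> labelled_law p {..<p} P' \<rightarrow>\<^sub>M vec_space I \<Otimes>\<^sub>M borel"
      by (simp cong: measurable_cong_sets)
    from renyi2_le_distr[OF full this] show ?thesis
      by (simp only: labelled_law_restrict[OF I sets(1), symmetric] labelled_law_restrict[OF I sets(2), symmetric])
  qed
  have "fst \<in> labelled_law p {..<p} P' \<rightarrow>\<^sub>M vec_space {..<p}"
    by (simp cong: measurable_cong_sets)
  from renyi2_le_distr[OF full this]
  show "renyi2_le (distr (joint_law P) (vec_space {..<p}) fst) (distr (joint_law P') (vec_space {..<p}) fst) c"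
    by (simp only: unlabelled_law_restrict[OF sets(1)] unlabelled_law_restrict[OF sets(2)])
qed

lemma renyi2_le_data_law:
  assumes P: "proper_law p P" "proper_law p P'" and Obs: "\<And>k. k < K \<Longrightarrow> Obs k \<subseteq> {..<p}"
    and lab: "\<And>k. k < K \<Longrightarrow> renyi2_le (labelled_law p (Obs k) P) (labelled_law p (Obs k) P') (c k)"
    and unlab: "renyi2_le (distr (joint_law P) (vec_space {..<p}) fst) (distr (joint_law P') (vec_space {..<p}) fst) c'"
  shows "renyi2_le (data_law p K n N Obs P) (data_law p K n N Obs P') ((\<Sum>k<K. real (n k) * c k) + real N * c')"
proof -
  have "renyi2_le (\<Pi>\<^sub>M j\<in>{..<n k}. labelled_law p (Obs k) P) (\<Pi>\<^sub>M j\<in>{..<n k}. labelled_law p (Obs k) P')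
      (\<Sum>j<n k. c k)" if "k < K" for k
    using that by (intro renyi2_le_PiM lab prob_space_labelled_law P Obs) auto
  then have "renyi2_le (\<Pi>\<^sub>M k\<in>{..<K}. \<Pi>\<^sub>M j\<in>{..<n k}. labelled_law p (Obs k) P)
      (\<Pi>\<^sub>M k\<in>{..<K}. \<Pi>\<^sub>M j\<in>{..<n k}. labelled_law p (Obs k) P') (\<Sum>k<K. \<Sum>j<n k. c k)"
    by (rule renyi2_le_PiM[OF finite_lessThan]) (auto intro!: prob_space_PiM prob_space_labelled_law P Obs)
  moreover have "renyi2_le (\<Pi>\<^sub>M j\<in>{..<N}. distr (joint_law P) (vec_space {..<p}) fst)
      (\<Pi>\<^sub>M j\<in>{..<N}. distr (joint_law P') (vec_space {..<p}) fst) (\<Sum>j<N. c')"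
    by (intro renyi2_le_PiM unlab prob_space_unlabelled_law P) auto
  ultimately have "renyi2_le (data_law p K n N Obs P) (data_law p K n N Obs P') ((\<Sum>k<K. \<Sum>j<n k. c k) + (\<Sum>j<N. c'))"
    unfolding data_law_def
    by (intro renyi2_le_pair prob_space_imp_sigma_finite prob_space_PiM prob_space_unlabelled_law P)
  then show ?thesis by simp
qed

lemma est_error_sq: "(est_error p P b)\<^sup>2 = (\<Sum>i<p. (b i - coef P i)\<^sup>2)"
  by (simp add: est_error_def L2_set_def sum_nonneg)

lemma isotropic_mech_in_P_HD:
  assumes pos: "0 < R" "0 < R\<^sub>X" "0 < \<Phi>" and \<Phi>: "\<Phi> \<le> 3 * R\<^sub>X\<^sup>2 / 16"
    and \<beta>: "\<beta> \<in> space (vec_space {..<p})" "card {i. i < p \<and> \<beta> i \<noteq> 0} \<le> s" "L2_set \<beta> {..<p} \<le> B"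
  shows "mech p (sqrt \<Phi>) 0 p {} \<beta> R \<in> P_HD p R\<^sub>X R B s \<Phi>"
proof (rule mech_in_P_HD[where V = \<Phi>])
  show "8 * \<Phi> \<le> 3 * R\<^sub>X\<^sup>2" using \<Phi> pos zero_le_power2[of "R\<^sub>X"] by linarith
qed (use assms in simp_all)

text \<open>
  Estimators are only required to have measurable errors. The class contains the isotropic design with
  regression vectors \<open>0\<close> and \<open>B e\<^sub>i\<close>, and the difference of the two squared errors is
  affine in coordinate \<open>i\<close> of the estimator with nonzero slope.
\<close>

lemma estimator_coordinate_measurable:
  assumes pos: "0 < R" "0 < R\<^sub>X" "0 < \<Phi>" "0 < B" "1 \<le> s" and \<Phi>: "\<Phi> \<le> 3 * R\<^sub>X\<^sup>2 / 16"
    and b: "bhat \<in> Theta_HD p K n N Obs R\<^sub>X R B s \<Phi>" and i: "i < p"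
  shows "(\<lambda>x. bhat x i) \<in> borel_measurable (data_space p K n N Obs)"
proof -
  define \<beta> where "\<beta> c = (\<lambda>k\<in>{..<p}. if k = i then c else (0::real))" for c
  have meas: "(\<lambda>x. (est_error p (mech p (sqrt \<Phi>) 0 p {} (\<beta> c) R) (bhat x))\<^sup>2) \<in> borel_measurable (data_space p K n N Obs)"
    if c: "0 \<le> c" "c \<le> B" for c
  proof -
    have "mech p (sqrt \<Phi>) 0 p {} (\<beta> c) R \<in> P_HD p R\<^sub>X R B s \<Phi>"
    proof (rule isotropic_mech_in_P_HD)
      have "{k. k < p \<and> \<beta> c k \<noteq> 0} \<subseteq> {i}" by (auto simp: \<beta>_def split: if_splits)
      then have "card {k. k < p \<and> \<beta> c k \<noteq> 0} \<le> card {i}" by (intro card_mono) auto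
      then show "card {k. k < p \<and> \<beta> c k \<noteq> 0} \<le> s" using pos by simp
      have "(\<Sum>k<p. (\<beta> c k)\<^sup>2) = (\<Sum>k<p. if k = i then c\<^sup>2 else 0)"
        by (intro sum.cong) (auto simp: \<beta>_def)
      then show "L2_set (\<beta> c) {..<p} \<le> B" using i c by (simp add: L2_set_def)
    qed (use pos \<Phi> in \<open>auto simp: \<beta>_def space_PiM\<close>)
    with b have "(\<lambda>x. est_error p (mech p (sqrt \<Phi>) 0 p {} (\<beta> c) R) (bhat x)) \<in> borel_measurable (data_space p K n N Obs)"
      by (auto simp: Theta_HD_def)
    then show ?thesis by measurable
  qed
  have polar: "bhat x i = ((est_error p (mech p (sqrt \<Phi>) 0 p {} (\<beta> 0) R) (bhat x))\<^sup>2
      - (est_error p (mech p (sqrt \<Phi>) 0 p {} (\<beta> B) R) (bhat x))\<^sup>2 + B\<^sup>2) / (2 * B)" for x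
  proof -
    have "(\<Sum>k<p. (bhat x k - \<beta> 0 k)\<^sup>2) - (\<Sum>k<p. (bhat x k - \<beta> B k)\<^sup>2)
        = (\<Sum>k<p. if k = i then 2 * B * bhat x i - B\<^sup>2 else 0)"
      unfolding sum_subtractf[symmetric]
      by (intro sum.cong) (auto simp: \<beta>_def power2_eq_square algebra_simps)
    then show ?thesis
      using i pos by (simp add: est_error_sq mech_def field_simps)
  qed
  have [measurable]: "(\<lambda>x. (est_error p (mech p (sqrt \<Phi>) 0 p {} (\<beta> 0) R) (bhat x))\<^sup>2) \<in> borel_measurable (data_space p K n N Obs)"
    "(\<lambda>x. (est_error p (mech p (sqrt \<Phi>) 0 p {} (\<beta> B) R) (bhat x))\<^sup>2) \<in> borel_measurable (data_space p K n N Obs)"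
    using pos by (auto intro!: meas)
  show ?thesis unfolding polar by measurable
qed

text \<open>
  The squared error splits over the disjoint blocks. Within a block, two vectors with one entry \<open>\<alpha>\<close>
  each differ in two coordinates, and each contributes at least \<open>\<alpha>\<^sup>2 / 2\<close> to the sum of the two
  losses; so \<open>assouad_blocks\<close> applies with \<open>\<eta> = \<alpha>\<^sup>2 / 2\<close>.
\<close>

lemma minimax_risk_blocks:
  fixes pos :: "'t \<Rightarrow> 'j \<Rightarrow> nat"
  assumes fin: "finite T" "finite J"
    and pos: "inj_on (\<lambda>(t, j). pos t j) (T \<times> J)" "\<And>t j. t \<in> T \<Longrightarrow> j \<in> J \<Longrightarrow> pos t j < p"
    and Obs: "\<And>k. k < K \<Longrightarrow> Obs k \<subseteq> {..<p}"
    and P: "\<And>w. w \<in> T \<rightarrow>\<^sub>E J \<Longrightarrow> P w \<in> P_HD p R\<^sub>X R B s \<Phi>"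
    and coef: "\<And>w t j. w \<in> T \<rightarrow>\<^sub>E J \<Longrightarrow> t \<in> T \<Longrightarrow> j \<in> J \<Longrightarrow> coef (P w) (pos t j) = (if j = w t then \<alpha> else 0)"
    and close: "\<And>w t j. w \<in> T \<rightarrow>\<^sub>E J \<Longrightarrow> t \<in> T \<Longrightarrow> j \<in> J \<Longrightarrow>
        renyi2_le (data_law p K n N Obs (P (w(t := j)))) (data_law p K n N Obs (P w)) c"
    and many: "4 * exp c \<le> real (card J)"
    and meas: "\<And>bhat i. bhat \<in> Theta_HD p K n N Obs R\<^sub>X R B s \<Phi> \<Longrightarrow> i < p \<Longrightarrow>
        (\<lambda>x. bhat x i) \<in> borel_measurable (data_space p K n N Obs)"
  shows "ennreal (real (card T) * \<alpha>\<^sup>2 / 4) \<le> minimax_risk p K n N Obs R\<^sub>X R B s \<Phi>"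
  unfolding minimax_risk_def
proof (rule INF_greatest)
  fix bhat assume b: "bhat \<in> Theta_HD p K n N Obs R\<^sub>X R B s \<Phi>"
  define loss where "loss t j x = (\<Sum>i\<in>J. (bhat x (pos t i) - (if i = j then \<alpha> else 0))\<^sup>2)" for t j x
  have sep: "2 * (\<alpha>\<^sup>2 / 2) \<le> loss t j x + loss t j' x" if j: "j \<in> J" "j' \<in> J" "j \<noteq> j'" for t j j' x
  proof -
    have half: "\<alpha>\<^sup>2 / 2 \<le> y\<^sup>2 + (y - \<alpha>)\<^sup>2" for y
    proof -
      have "0 \<le> (2 * y - \<alpha>)\<^sup>2 / 2" by simp
      then show ?thesis by (simp add: power2_eq_square algebra_simps)
    qed
    have "loss t j x + loss t j' x = (\<Sum>i\<in>J. (bhat x (pos t i) - (if i = j then \<alpha> else 0))\<^sup>2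
        + (bhat x (pos t i) - (if i = j' then \<alpha> else 0))\<^sup>2)"
      by (simp add: loss_def sum.distrib)
    also have "\<dots> \<ge> (\<Sum>i\<in>{j, j'}. (bhat x (pos t i) - (if i = j then \<alpha> else 0))\<^sup>2
        + (bhat x (pos t i) - (if i = j' then \<alpha> else 0))\<^sup>2)"
      using j fin by (intro sum_mono2) auto
    finally show ?thesis
      using half[of "bhat x (pos t j)"] half[of "bhat x (pos t j')"] j by simp
  qed
  have "\<exists>w\<in>T \<rightarrow>\<^sub>E J. ennreal (card T * (\<alpha>\<^sup>2 / 2) / 2)
      \<le> (\<integral>\<^sup>+ x. ennreal (\<Sum>t\<in>T. loss t (w t) x) \<partial>data_law p K n N Obs (P w))"
  proof (rule assouad_blocks[OF fin, where S = "data_space p K n N Obs" and c = c])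
    show "prob_space (data_law p K n N Obs (P w))" if "w \<in> T \<rightarrow>\<^sub>E J" for w
      using proper_law_P_HD[OF P[OF that]] Obs by (rule prob_space_data_law)
    show "loss t j \<in> borel_measurable (data_space p K n N Obs)" if "t \<in> T" "j \<in> J" for t j
      unfolding loss_def using meas[OF b pos(2)] that
      by (intro borel_measurable_sum borel_measurable_power borel_measurable_diff) auto
  qed (use close many sep in \<open>auto simp: sets_data_law loss_def intro!: sum_nonneg\<close>)
  then obtain w where w: "w \<in> T \<rightarrow>\<^sub>E J"
    "ennreal (card T * \<alpha>\<^sup>2 / 4) \<le> (\<integral>\<^sup>+ x. ennreal (\<Sum>t\<in>T. loss t (w t) x) \<partial>data_law p K n N Obs (P w))"
    by auto
  have "(\<Sum>t\<in>T. loss t (w t) x) \<le> (est_error p (P w) (bhat x))\<^sup>2" for x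
  proof -
    have "(\<Sum>t\<in>T. loss t (w t) x) = (\<Sum>(t, j)\<in>T \<times> J. (bhat x (pos t j) - coef (P w) (pos t j))\<^sup>2)"
      unfolding loss_def sum.cartesian_product
      using coef[OF w(1)] by (intro sum.cong) auto
    also have "\<dots> = (\<Sum>i\<in>(\<lambda>(t, j). pos t j) ` (T \<times> J). (bhat x i - coef (P w) i)\<^sup>2)"
      by (subst sum.reindex[OF pos(1)]) (simp add: split_beta')
    also have "\<dots> \<le> (\<Sum>i<p. (bhat x i - coef (P w) i)\<^sup>2)"
      using pos(2) by (intro sum_mono2) auto
    finally show ?thesis by (simp add: est_error_sq)
  qed
  then have "(\<integral>\<^sup>+ x. ennreal (\<Sum>t\<in>T. loss t (w t) x) \<partial>data_law p K n N Obs (P w))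
      \<le> (\<integral>\<^sup>+ x. ennreal ((est_error p (P w) (bhat x))\<^sup>2) \<partial>data_law p K n N Obs (P w))"
    by (intro nn_integral_mono ennreal_leI)
  with w(2) show "ennreal (real (card T) * \<alpha>\<^sup>2 / 4)
      \<le> (SUP P\<in>P_HD p R\<^sub>X R B s \<Phi>. \<integral>\<^sup>+ x. ennreal ((est_error p P (bhat x))\<^sup>2) \<partial>data_law p K n N Obs P)"
    by (intro SUP_upper2[OF P[OF w(1)]]) auto
qed

section \<open>The sparse hypotheses\<close>

lemma injective_blocks_in_set:
  assumes "finite H" "s * m \<le> card H"
  obtains pos where "inj_on (\<lambda>(t, j). pos t j) ({..<s} \<times> {..<m})"
    "\<And>t j. t < s \<Longrightarrow> j < m \<Longrightarrow> pos t j \<in> (H :: 'a set)"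
proof -
  have "card ({..<s} \<times> {..<m}) \<le> card H" using assms by (simp add: card_cartesian_product)
  then obtain f where f: "f ` ({..<s} \<times> {..<m}) \<subseteq> H" "inj_on f ({..<s} \<times> {..<m})"
    using assms card_le_inj[of "{..<s} \<times> {..<m}" H] by auto
  then show ?thesis
    by (intro that[of "\<lambda>t j. f (t, j)"]) auto
qed

lemma mem_transpose_image_iff:
  "i \<in> Transposition.transpose a b ` S \<longleftrightarrow> Transposition.transpose a b i \<in> S"
  by (auto intro: rev_image_eqI)

text \<open>
  The active set of the hypothesis \<open>w\<close>: block \<open>t\<close> consists of the coordinates \<open>pos t j\<close>, and
  \<open>w t\<close> tells which of them is active.
\<close>

definition selected :: "('t \<Rightarrow> 'j \<Rightarrow> nat) \<Rightarrow> 't set \<Rightarrow> ('t \<Rightarrow> 'j) \<Rightarrow> nat set" where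
  "selected pos T w = (\<lambda>t. pos t (w t)) ` T"

context
  fixes pos :: "'t \<Rightarrow> 'j \<Rightarrow> nat" and T :: "'t set" and J :: "'j set" and w :: "'t \<Rightarrow> 'j"
  assumes fin: "finite T" and inj: "inj_on (\<lambda>(t, j). pos t j) (T \<times> J)" and w: "w \<in> T \<rightarrow>\<^sub>E J"
begin

lemma pos_eq_iff: "t \<in> T \<Longrightarrow> t' \<in> T \<Longrightarrow> j \<in> J \<Longrightarrow> j' \<in> J \<Longrightarrow> pos t j = pos t' j' \<longleftrightarrow> t = t' \<and> j = j'"
  using inj_on_eq_iff[OF inj, of "(t, j)" "(t', j')"] by auto

lemma sum_selected: "(\<Sum>i\<in>selected pos T w. x i) = (\<Sum>t\<in>T. x (pos t (w t)))"
  unfolding selected_def using w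
  by (intro sum.reindex[unfolded o_def]) (auto simp: inj_on_def pos_eq_iff PiE_iff)

lemma card_selected: "card (selected pos T w) = card T"
  unfolding selected_def using w
  by (intro card_image) (auto simp: inj_on_def pos_eq_iff PiE_iff)

lemma pos_in_selected_iff: "t \<in> T \<Longrightarrow> j \<in> J \<Longrightarrow> pos t j \<in> selected pos T w \<longleftrightarrow> j = w t"
  unfolding selected_def using w by (auto simp: pos_eq_iff PiE_iff)

text \<open>
  Moving the active coordinate within a block is a transposition of coordinates, as required by
  \<open>labelled_law_swap\<close>.
\<close>

lemma selected_update_transpose:
  assumes t: "t \<in> T" and j: "j \<in> J"
  shows "selected pos T (w(t := j)) = Transposition.transpose (pos t (w t)) (pos t j) ` selected pos T w"
  unfolding selected_def image_image
proof (rule image_cong[OF refl])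
  fix t' assume t': "t' \<in> T"
  have "pos t' (w t') \<noteq> pos t (w t)" "pos t' (w t') \<noteq> pos t j" if "t' \<noteq> t"
    using that t t' j w by (auto simp: pos_eq_iff PiE_iff)
  then show "pos t' ((w(t := j)) t') = Transposition.transpose (pos t (w t)) (pos t j) (pos t' (w t'))"
    by (cases "t' = t") (auto simp: transpose_apply_other)
qed

end

lemma sum_selected_update:
  fixes x :: "nat \<Rightarrow> real"
  assumes "finite T" "inj_on (\<lambda>(t, j). pos t j) (T \<times> J)" "w \<in> T \<rightarrow>\<^sub>E J" "t \<in> T" "j \<in> J"
  shows "(\<Sum>i\<in>selected pos T (w(t := j)). x i) - (\<Sum>i\<in>selected pos T w. x i) = x (pos t j) - x (pos t (w t))"
proof -
  have w': "w(t := j) \<in> T \<rightarrow>\<^sub>E J" using assms by (auto simp: PiE_def extensional_def)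
  have "(\<Sum>i\<in>selected pos T (w(t := j)). x i) = (\<Sum>t'\<in>T. x (pos t' ((w(t := j)) t')))"
    by (rule sum_selected[OF assms(1,2) w'])
  also have "\<dots> = x (pos t j) + (\<Sum>t'\<in>T - {t}. x (pos t' (w t')))"
    using assms by (subst sum.remove[of _ t]) auto
  finally show ?thesis
    using assms by (simp add: sum_selected[OF assms(1-3)] sum.remove[of T t])
qed

text \<open>
  A sample that contains \<open>H\<close> has divergence at most \<open>4 \<alpha>\<^sup>2 \<Phi> / R\<^sup>2\<close>, because two hypotheses in one
  block have regression functions that differ by at most \<open>2 \<alpha> sqrt \<Phi>\<close>. All other labelled samples
  are equally distributed by the exchange of two unobserved signs, and so are the
  unlabelled samples, whose law does not involve the regression vector.
\<close>

lemma isotropic_lower_bound: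
  fixes \<alpha> :: real
  assumes pos: "0 < R" "0 < R\<^sub>X" "0 < \<Phi>" "0 < B" "1 \<le> s" and \<Phi>: "\<Phi> \<le> 3 * R\<^sub>X\<^sup>2 / 16"
    and Obs: "\<And>k. k < K \<Longrightarrow> Obs k \<subseteq> {..<p}" and H: "H \<subseteq> {..<p}"
    and split: "\<And>k. k < K \<Longrightarrow> H \<subseteq> Obs k \<or> H \<inter> Obs k = {}"
    and sm: "s * m \<le> card H" and amp: "real s * \<alpha>\<^sup>2 \<le> B\<^sup>2"
    and many: "4 * exp (real (mod_count K n Obs H) * (4 * \<alpha>\<^sup>2 * \<Phi> / R\<^sup>2)) \<le> real m"
  shows "ennreal (real s * \<alpha>\<^sup>2 / 4) \<le> minimax_risk p K n N Obs R\<^sub>X R B s \<Phi>"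
proof -
  have "finite H" using H finite_subset by blast
  then obtain loc where inj: "inj_on (\<lambda>(t, j). loc t j) ({..<s} \<times> {..<m})"
    and locH: "\<And>t j. t < s \<Longrightarrow> j < m \<Longrightarrow> loc t j \<in> H"
    using injective_blocks_in_set[OF _ sm] by blast
  let ?T = "{..<s}" and ?J = "{..<m}"
  let ?S = "selected loc ?T"
  define \<beta> where "\<beta> w = (\<lambda>i\<in>{..<p}. if i \<in> ?S w then \<alpha> else 0)" for w
  define P where "P w = mech p (sqrt \<Phi>) 0 p {} (\<beta> w) R" for w
  have SH: "?S w \<subseteq> H" if "w \<in> ?T \<rightarrow>\<^sub>E ?J" for w
    using that locH by (auto simp: selected_def PiE_iff)
  have upd: "w(t := j) \<in> ?T \<rightarrow>\<^sub>E ?J" if "w \<in> ?T \<rightarrow>\<^sub>E ?J" "t \<in> ?T" "j \<in> ?J" for w t j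
    using that by (auto simp: PiE_def extensional_def)
  have cardS: "card (?S w) = s" if "w \<in> ?T \<rightarrow>\<^sub>E ?J" for w
    using card_selected[OF finite_lessThan inj that] by simp
  have P_HD: "P w \<in> P_HD p R\<^sub>X R B s \<Phi>" if w: "w \<in> ?T \<rightarrow>\<^sub>E ?J" for w
    unfolding P_def
  proof (rule isotropic_mech_in_P_HD)
    have "{i. i < p \<and> \<beta> w i \<noteq> 0} \<subseteq> ?S w" by (auto simp: \<beta>_def split: if_splits)
    then have "card {i. i < p \<and> \<beta> w i \<noteq> 0} \<le> card (?S w)"
      by (intro card_mono) (auto simp: selected_def)
    then show "card {i. i < p \<and> \<beta> w i \<noteq> 0} \<le> s" using cardS[OF w] by simp
    have "(\<Sum>i<p. (\<beta> w i)\<^sup>2) = (\<Sum>i<p. if i \<in> ?S w then \<alpha>\<^sup>2 else 0)"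
      by (intro sum.cong) (auto simp: \<beta>_def)
    also have "\<dots> = (\<Sum>i\<in>{..<p} \<inter> ?S w. \<alpha>\<^sup>2)" by (rule sum.inter_restrict[symmetric]) simp
    also have "\<dots> = real s * \<alpha>\<^sup>2"
      using SH[OF w] H cardS[OF w] by (simp add: Int_absorb1)
    finally show "L2_set (\<beta> w) {..<p} \<le> B"
      unfolding L2_set_def using amp pos by (simp add: real_le_lsqrt)
  qed (use pos \<Phi> in \<open>auto simp: \<beta>_def space_PiM\<close>)
  have proper: "proper_law p (P w)" if "w \<in> ?T \<rightarrow>\<^sub>E ?J" for w
    by (rule proper_law_P_HD[OF P_HD[OF that]])

  have y: "inner_prod p (design p (sqrt \<Phi>) 0 p {} x) (\<beta> w) = sqrt \<Phi> * \<alpha> * (\<Sum>i\<in>?S w. x i)"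
    if w: "w \<in> ?T \<rightarrow>\<^sub>E ?J" for w x
  proof -
    have "inner_prod p (design p (sqrt \<Phi>) 0 p {} x) (\<beta> w) = (\<Sum>i<p. if i \<in> ?S w then sqrt \<Phi> * \<alpha> * x i else 0)"
      by (intro sum.cong) (auto simp: design_def \<beta>_def)
    also have "\<dots> = (\<Sum>i\<in>{..<p} \<inter> ?S w. sqrt \<Phi> * \<alpha> * x i)" by (rule sum.inter_restrict[symmetric]) simp
    finally show ?thesis using SH[OF w] H by (simp add: Int_absorb1 sum_distrib_left)
  qed
  let ?c = "4 * \<alpha>\<^sup>2 * \<Phi> / R\<^sup>2"
  have close: "renyi2_le (data_law p K n N Obs (P (w(t := j)))) (data_law p K n N Obs (P w))
      (real (mod_count K n Obs H) * ?c)"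
    if w: "w \<in> ?T \<rightarrow>\<^sub>E ?J" and t: "t \<in> ?T" and j: "j \<in> ?J" for w t j
  proof -
    note w' = upd[OF w t j]
    have wt: "w t \<in> ?J" using w t by auto
    have full: "renyi2_le (labelled_law p {..<p} (P (w(t := j)))) (labelled_law p {..<p} (P w)) ((2 * sqrt \<Phi> * \<bar>\<alpha>\<bar>)\<^sup>2 / R\<^sup>2)"
      unfolding P_def
    proof (rule renyi2_le_regression)
      fix x :: "nat \<Rightarrow> real" assume x: "\<forall>i\<in>{..<p} - {p}. \<bar>x i\<bar> \<le> 1"
      have "loc t j < p" "loc t (w t) < p" using locH H t j wt by auto
      then have "\<bar>x (loc t j)\<bar> \<le> 1" "\<bar>x (loc t (w t))\<bar> \<le> 1" using x by auto
      then have "\<bar>x (loc t j) - x (loc t (w t))\<bar> \<le> 2" by linarith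
      then have "\<bar>sqrt \<Phi> * \<alpha>\<bar> * \<bar>x (loc t j) - x (loc t (w t))\<bar> \<le> \<bar>sqrt \<Phi> * \<alpha>\<bar> * 2"
        by (intro mult_left_mono) auto
      then show "\<bar>inner_prod p (design p (sqrt \<Phi>) 0 p {} x) (\<beta> (w(t := j))) - inner_prod p (design p (sqrt \<Phi>) 0 p {} x) (\<beta> w)\<bar>
          \<le> 2 * sqrt \<Phi> * \<bar>\<alpha>\<bar>"
        unfolding y[OF w'] y[OF w] right_diff_distrib[symmetric]
          sum_selected_update[OF finite_lessThan inj w t j] abs_mult
        using pos by (simp add: mult_ac)
    qed (use pos in auto)
    have c: "(2 * sqrt \<Phi> * \<bar>\<alpha>\<bar>)\<^sup>2 / R\<^sup>2 = ?c"
      using pos by (simp add: power_mult_distrib)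
    have "renyi2_le (data_law p K n N Obs (P (w(t := j)))) (data_law p K n N Obs (P w))
        ((\<Sum>k<K. real (n k) * (?c * of_bool (H \<subseteq> Obs k))) + real N * 0)"
    proof (rule renyi2_le_data_law[OF proper[OF w'] proper[OF w] Obs])
      fix k assume k: "k < K"
      show "renyi2_le (labelled_law p (Obs k) (P (w(t := j)))) (labelled_law p (Obs k) (P w)) (?c * of_bool (H \<subseteq> Obs k))"
      proof (cases "H \<subseteq> Obs k")
        case True
        then show ?thesis
          using renyi2_le_partial_observation(1)[OF proper[OF w'] proper[OF w] full Obs[OF k]] by (simp add: c)
      next
        case False
        then have disj: "H \<inter> Obs k = {}" using split[OF k] by auto
        have "labelled_law p (Obs k) (P w) = labelled_law p (Obs k) (P (w(t := j)))"
          unfolding P_def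
        proof (rule labelled_law_swap[where i = "loc t (w t)" and j = "loc t j"])
          show "\<beta> (w(t := j)) i = \<beta> w (Transposition.transpose (loc t (w t)) (loc t j) i)" if "i < p \<or> i = p" for i
          proof -
            have lt: "loc t j < p" "loc t (w t) < p" using locH H t j wt by auto
            have "i \<in> ?S (w(t := j)) \<longleftrightarrow> Transposition.transpose (loc t (w t)) (loc t j) i \<in> ?S w"
              unfolding selected_update_transpose[OF finite_lessThan inj w t j]
              by (rule mem_transpose_image_iff)
            moreover have "Transposition.transpose (loc t (w t)) (loc t j) i < p \<longleftrightarrow> i < p"
              using lt by (auto simp: Transposition.transpose_def)
            ultimately show ?thesis by (simp add: \<beta>_def restrict_def)
          qed
          show "loc t (w t) < p" "loc t j < p" "loc t (w t) \<noteq> p" "loc t j \<noteq> p" "loc t (w t) \<notin> Obs k" "loc t j \<notin> Obs k"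
            using locH[of t "w t"] locH[of t j] H t j wt disj by auto
        qed (use Obs[OF k] pos in auto)
        then show ?thesis
          using renyi2_le_refl[OF prob_space_labelled_law[OF proper[OF w] Obs[OF k]]] False by simp
      qed
    next
      have "joint_law (P (w(t := j))) = joint_law (P w)" by (simp add: P_def mech_def)
      then show "renyi2_le (distr (joint_law (P (w(t := j)))) (vec_space {..<p}) fst) (distr (joint_law (P w)) (vec_space {..<p}) fst) 0"
        using renyi2_le_refl[OF prob_space_unlabelled_law[OF proper[OF w]]] by simp
    qed
    also have "(\<Sum>k<K. real (n k) * (?c * of_bool (H \<subseteq> Obs k))) + real N * 0 = real (mod_count K n Obs H) * ?c"
      unfolding mod_count_def of_nat_sum sum_distrib_right mult_zero_right add_0_right
      by (intro sum.cong) auto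
    finally show ?thesis .
  qed
  have "ennreal (real (card ?T) * \<alpha>\<^sup>2 / 4) \<le> minimax_risk p K n N Obs R\<^sub>X R B s \<Phi>"
  proof (rule minimax_risk_blocks[OF finite_lessThan finite_lessThan inj _ Obs P_HD _ close])
    show "loc t j < p" if "t \<in> ?T" "j \<in> ?J" for t j using locH[of t j] H that by auto
    then show "coef (P w) (loc t j) = (if j = w t then \<alpha> else 0)"
      if "w \<in> ?T \<rightarrow>\<^sub>E ?J" "t \<in> ?T" "j \<in> ?J" for w t j
      using that by (simp add: P_def mech_def \<beta>_def pos_in_selected_iff[OF finite_lessThan inj])
    show "(\<lambda>x. bhat x i) \<in> borel_measurable (data_space p K n N Obs)"
      if "bhat \<in> Theta_HD p K n N Obs R\<^sub>X R B s \<Phi>" "i < p" for bhat i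
      using pos \<Phi> that by (intro estimator_coordinate_measurable)
  qed (use many in auto)
  then show ?thesis by simp
qed

text \<open>
  The scale \<open>w = R\<^sub>X / 2\<close> is dictated by the extreme case \<open>\<Phi> = 3 R\<^sub>X\<^sup>2 / 16\<close>: the
  coupling distorts the identity by factors between \<open>3 / 4\<close> and \<open>3 / 2\<close>, so the smallest eigenvalue is at least
  \<open>(3 / 4) w\<^sup>2 = 3 R\<^sub>X\<^sup>2 / 16\<close> and the variance proxy at most
  \<open>(3 / 2) w\<^sup>2 = 3 R\<^sub>X\<^sup>2 / 8\<close>. The regression vector has \<open>s\<close> active coordinates in \<open>H\<close> and
  one at \<open>g\<close>, whence \<open>Suc s\<close>.
\<close>

lemma coupled_lower_bound:
  fixes b r :: real
  assumes pos: "0 < R" "0 < R\<^sub>X" "0 < \<Phi>" "0 < B" and \<Phi>: "\<Phi> \<le> 3 * R\<^sub>X\<^sup>2 / 16"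
    and Obs: "\<And>k. k < K \<Longrightarrow> Obs k \<subseteq> {..<p}" and H: "H \<subseteq> {..<p}" and g: "g < p" "g \<notin> H"
    and split: "\<And>k. k < K \<Longrightarrow> H \<subseteq> Obs k \<or> H \<inter> Obs k = {}"
    and sm: "s * m \<le> card H" and coupling: "real s * r\<^sup>2 \<le> 1 / 12" and amp: "b\<^sup>2 * (1 + real s * r\<^sup>2) \<le> B\<^sup>2"
    and many: "4 * exp (real ((\<Sum>k<K. n k * of_bool (g \<in> Obs k \<and> H \<subseteq> Obs k)) + N)
        * (4 * r\<^sup>2 * (1 + (R\<^sub>X\<^sup>2 / 4) * b\<^sup>2 / R\<^sup>2))) \<le> real m"
  shows "ennreal (real s * (b * r)\<^sup>2 / 4) \<le> minimax_risk p K n N Obs R\<^sub>X R B (Suc s) \<Phi>"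
proof -
  have "finite H" using H finite_subset by blast
  then obtain loc where inj: "inj_on (\<lambda>(t, j). loc t j) ({..<s} \<times> {..<m})"
    and locH: "\<And>t j. t < s \<Longrightarrow> j < m \<Longrightarrow> loc t j \<in> H"
    using injective_blocks_in_set[OF _ sm] by blast
  let ?T = "{..<s}" and ?J = "{..<m}" and ?w = "R\<^sub>X / 2"
  let ?S = "selected loc ?T"
  define \<beta> where "\<beta> w = (\<lambda>i\<in>{..<p}. if i = g then b else if i \<in> ?S w then - (b * r) else 0)" for w
  define P where "P w = mech p ?w r g (?S w) (\<beta> w) R" for w
  have SH: "?S w \<subseteq> H" if "w \<in> ?T \<rightarrow>\<^sub>E ?J" for w
    using that locH by (auto simp: selected_def PiE_iff)
  then have Sp: "?S w \<subseteq> {..<p}" and Sg: "g \<notin> ?S w" if "w \<in> ?T \<rightarrow>\<^sub>E ?J" for w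
    using that H g by blast+
  have upd: "w(t := j) \<in> ?T \<rightarrow>\<^sub>E ?J" if "w \<in> ?T \<rightarrow>\<^sub>E ?J" "t \<in> ?T" "j \<in> ?J" for w t j
    using that by (auto simp: PiE_def extensional_def)
  have cardS: "card (?S w) = s" if "w \<in> ?T \<rightarrow>\<^sub>E ?J" for w
    using card_selected[OF finite_lessThan inj that] by simp
  have finS: "finite (?S w)" for w by (simp add: selected_def)
  have sumS: "(\<Sum>i<p. if i \<in> ?S w then c else 0) = real s * c" if w: "w \<in> ?T \<rightarrow>\<^sub>E ?J" for w and c :: real
  proof -
    have "(\<Sum>i<p. if i \<in> ?S w then c else 0) = (\<Sum>i\<in>{..<p} \<inter> ?S w. c)"
      by (rule sum.inter_restrict[symmetric]) simp
    then show ?thesis using Sp[OF w] cardS[OF w] by (simp add: Int_absorb1)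
  qed
  have sumg: "(\<Sum>i<p. if i = g then c else 0) = c" for c :: real
    using g by simp
  have P_HD: "P w \<in> P_HD p R\<^sub>X R B (Suc s) \<Phi>" if w: "w \<in> ?T \<rightarrow>\<^sub>E ?J" for w
    unfolding P_def
  proof (rule mech_in_P_HD[where V = "3 * R\<^sub>X\<^sup>2 / 8"])
    fix u :: "nat \<Rightarrow> real"
    let ?Q = "\<Sum>i<p. (u i + (if i \<in> ?S w then r * u g else 0))\<^sup>2" and ?U = "\<Sum>i<p. (u i)\<^sup>2"
    have ug: "(u g)\<^sup>2 \<le> ?U" using g by (intro member_le_sum) auto
    have small: "real s * r\<^sup>2 * (u g)\<^sup>2 \<le> (u g)\<^sup>2 / 12"
      using mult_right_mono[OF coupling, of "(u g)\<^sup>2"] by simp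
    have "(\<Sum>i<p. 3 / 4 * (u i)\<^sup>2 + (if i = g then (u g)\<^sup>2 / 4 else 0) - (if i \<in> ?S w then 3 * (r * u g)\<^sup>2 else 0)) \<le> ?Q"
    proof (rule sum_mono)
      fix i
      \<comment> \<open>The cross term takes a quarter of \<open>(u i)\<^sup>2\<close>, which coordinate \<open>g \<notin> S\<close> keeps to pay for the remainder.\<close>
      have "0 \<le> (u i / 2 + 2 * (r * u g))\<^sup>2" by simp
      then have "3 / 4 * (u i)\<^sup>2 - 3 * (r * u g)\<^sup>2 \<le> (u i + r * u g)\<^sup>2"
        by (simp add: power2_eq_square algebra_simps)
      then show "3 / 4 * (u i)\<^sup>2 + (if i = g then (u g)\<^sup>2 / 4 else 0) - (if i \<in> ?S w then 3 * (r * u g)\<^sup>2 else 0)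
          \<le> (u i + (if i \<in> ?S w then r * u g else 0))\<^sup>2"
        using Sg[OF w] by auto
    qed
    then have "3 / 4 * ?U + (u g)\<^sup>2 / 4 - real s * (3 * (r * u g)\<^sup>2) \<le> ?Q"
      by (simp only: sum_subtractf sum.distrib sumg sumS[OF w] sum_distrib_left)
    then have "3 / 4 * ?U \<le> ?Q"
      using small by (simp add: power_mult_distrib mult_ac)
    then have "(R\<^sub>X / 2)\<^sup>2 * (3 / 4 * ?U) \<le> (R\<^sub>X / 2)\<^sup>2 * ?Q"
      by (intro mult_left_mono) auto
    moreover have "\<Phi> * ?U \<le> (3 * R\<^sub>X\<^sup>2 / 16) * ?U"
      using \<Phi> by (intro mult_right_mono sum_nonneg) auto
    ultimately show "\<Phi> * ?U \<le> (R\<^sub>X / 2)\<^sup>2 * ?Q"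
      by (simp add: power_divide mult_ac)
    have "?Q \<le> (\<Sum>i<p. 5 / 4 * (u i)\<^sup>2 - (if i = g then (u g)\<^sup>2 / 4 else 0) + (if i \<in> ?S w then 5 * (r * u g)\<^sup>2 else 0))"
    proof (rule sum_mono)
      fix i
      have "0 \<le> (u i / 2 - 2 * (r * u g))\<^sup>2" by simp
      then have "(u i + r * u g)\<^sup>2 \<le> 5 / 4 * (u i)\<^sup>2 + 5 * (r * u g)\<^sup>2"
        by (simp add: power2_eq_square algebra_simps)
      then show "(u i + (if i \<in> ?S w then r * u g else 0))\<^sup>2
          \<le> 5 / 4 * (u i)\<^sup>2 - (if i = g then (u g)\<^sup>2 / 4 else 0) + (if i \<in> ?S w then 5 * (r * u g)\<^sup>2 else 0)"
        using Sg[OF w] by auto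
    qed
    then have "?Q \<le> 5 / 4 * ?U - (u g)\<^sup>2 / 4 + real s * (5 * (r * u g)\<^sup>2)"
      by (simp only: sum_subtractf sum.distrib sumg sumS[OF w] sum_distrib_left)
    moreover have "real s * (5 * (r * u g)\<^sup>2) = 5 * (real s * r\<^sup>2 * (u g)\<^sup>2)"
      by (simp add: power_mult_distrib)
    ultimately have "?Q \<le> 3 / 2 * ?U"
      using small ug zero_le_power2[of "u g"] by linarith
    then have "(R\<^sub>X / 2)\<^sup>2 * ?Q \<le> (R\<^sub>X / 2)\<^sup>2 * (3 / 2 * ?U)"
      by (intro mult_left_mono) auto
    then show "(R\<^sub>X / 2)\<^sup>2 * ?Q \<le> 3 * R\<^sub>X\<^sup>2 / 8 * ?U"
      by (simp add: power_divide mult_ac)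
  next
    have "{i. i < p \<and> \<beta> w i \<noteq> 0} \<subseteq> insert g (?S w)" by (auto simp: \<beta>_def split: if_splits)
    then have "card {i. i < p \<and> \<beta> w i \<noteq> 0} \<le> card (insert g (?S w))"
      using finS by (intro card_mono) auto
    then show "card {i. i < p \<and> \<beta> w i \<noteq> 0} \<le> Suc s"
      using cardS[OF w] finS Sg[OF w] by simp
    have "(\<Sum>i<p. (\<beta> w i)\<^sup>2) = (\<Sum>i<p. (if i = g then b\<^sup>2 else 0) + (if i \<in> ?S w then (b * r)\<^sup>2 else 0))"
      using Sg[OF w] by (intro sum.cong) (auto simp: \<beta>_def)
    also have "\<dots> = b\<^sup>2 * (1 + real s * r\<^sup>2)"
      by (simp only: sum.distrib sumg sumS[OF w]) (simp add: algebra_simps power_mult_distrib)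
    finally show "L2_set (\<beta> w) {..<p} \<le> B"
      unfolding L2_set_def using amp pos by (simp add: real_le_lsqrt)
  qed (use pos Sp[OF w] g in \<open>auto simp: \<beta>_def space_PiM\<close>)
  have proper: "proper_law p (P w)" if "w \<in> ?T \<rightarrow>\<^sub>E ?J" for w
    by (rule proper_law_P_HD[OF P_HD[OF that]])
  have y: "inner_prod p (design p ?w r g (?S w) x) (\<beta> w) = ?w * b * x g"
    if w: "w \<in> ?T \<rightarrow>\<^sub>E ?J" for w x
  proof -
    have "inner_prod p (design p ?w r g (?S w) x) (\<beta> w)
        = inner_prod p (\<beta> w) (design p ?w r g (?S w) x)"
      by (simp only: mult.commute)
    also have "\<dots> = (\<Sum>i<p. ?w * (\<beta> w i + (if i \<in> ?S w then r * \<beta> w g else 0)) * x i)"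
      using Sp[OF w] g by (intro inner_prod_design) auto
    also have "\<dots> = (\<Sum>i<p. if i = g then ?w * b * x g else 0)"
      using Sg[OF w] g by (intro sum.cong) (auto simp: \<beta>_def)
    finally show ?thesis by (simp only: sumg)
  qed
  let ?c = "4 * r\<^sup>2 * (1 + (R\<^sub>X\<^sup>2 / 4) * b\<^sup>2 / R\<^sup>2)"
  let ?n = "\<Sum>k<K. n k * of_bool (g \<in> Obs k \<and> H \<subseteq> Obs k)"
  have close: "renyi2_le (data_law p K n N Obs (P (w(t := j)))) (data_law p K n N Obs (P w)) (real (?n + N) * ?c)"
    if w: "w \<in> ?T \<rightarrow>\<^sub>E ?J" and t: "t \<in> ?T" and j: "j \<in> ?J" for w t j
  proof -
    note w' = upd[OF w t j]
    have wt: "w t \<in> ?J" using w t by auto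
    have lt: "loc t j < p" "loc t (w t) < p" "loc t j \<noteq> g" "loc t (w t) \<noteq> g"
      using locH[of t j] locH[of t "w t"] H g t j wt by auto
    have "renyi2_le (labelled_law p {..<p} (P (w(t := j)))) (labelled_law p {..<p} (P w))
        ((2 * \<bar>r\<bar>)\<^sup>2 * (1 + (?w * b)\<^sup>2 / R\<^sup>2))"
      unfolding P_def
    proof (rule renyi2_le_coupled_coordinate[OF Sp[OF w'] Sg[OF w'] Sp[OF w] Sg[OF w] g(1) pos(1) y[OF w'] y[OF w]])
      fix x :: "nat \<Rightarrow> real" assume x: "\<forall>i\<in>{..<p} - {g}. \<bar>x i\<bar> \<le> 1"
      then have "\<bar>x (loc t j)\<bar> \<le> 1" "\<bar>x (loc t (w t))\<bar> \<le> 1" using lt by auto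
      then have "\<bar>x (loc t j) - x (loc t (w t))\<bar> \<le> 2" by linarith
      then have "\<bar>r\<bar> * \<bar>x (loc t j) - x (loc t (w t))\<bar> \<le> \<bar>r\<bar> * 2"
        by (intro mult_left_mono) auto
      then show "\<bar>r * ((\<Sum>i\<in>?S (w(t := j)). x i) - (\<Sum>i\<in>?S w. x i))\<bar> \<le> 2 * \<bar>r\<bar>"
        unfolding sum_selected_update[OF finite_lessThan inj w t j] abs_mult by simp
    qed
    moreover have "(2 * \<bar>r\<bar>)\<^sup>2 * (1 + (?w * b)\<^sup>2 / R\<^sup>2) = ?c"
      by (simp add: power_mult_distrib power_divide)
    ultimately have full: "renyi2_le (labelled_law p {..<p} (P (w(t := j)))) (labelled_law p {..<p} (P w)) ?c"
      by (simp only:)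
    have "renyi2_le (data_law p K n N Obs (P (w(t := j)))) (data_law p K n N Obs (P w))
        ((\<Sum>k<K. real (n k) * (?c * of_bool (g \<in> Obs k \<and> H \<subseteq> Obs k))) + real N * ?c)"
    proof (rule renyi2_le_data_law[OF proper[OF w'] proper[OF w] Obs _ renyi2_le_partial_observation(2)[OF proper[OF w'] proper[OF w] full]])
      fix k assume k: "k < K"
      \<comment> \<open>Only the first kind of pattern carries information about the active set.\<close>
      consider "g \<in> Obs k" "H \<subseteq> Obs k" | "g \<notin> Obs k" | "H \<inter> Obs k = {}" "\<not> H \<subseteq> Obs k"
        using split[OF k] by blast
      then show "renyi2_le (labelled_law p (Obs k) (P (w(t := j)))) (labelled_law p (Obs k) (P w)) (?c * of_bool (g \<in> Obs k \<and> H \<subseteq> Obs k))"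
      proof cases
        case 1
        then show ?thesis
          using renyi2_le_partial_observation(1)[OF proper[OF w'] proper[OF w] full Obs[OF k]] by simp
      next
        case 2
        have "labelled_law p (Obs k) (P w) = labelled_law p (Obs k) (P (w(t := j)))"
          unfolding P_def
          by (rule labelled_law_unobserved_coupling[OF Sp[OF w] Sp[OF w'] Obs[OF k] 2 pos(1)])
            (simp only: y[OF w] y[OF w'])
        then show ?thesis
          using renyi2_le_refl[OF prob_space_labelled_law[OF proper[OF w] Obs[OF k]]] 2 by simp
      next
        case 3
        have "labelled_law p (Obs k) (P w) = labelled_law p (Obs k) (P (w(t := j)))"
          unfolding P_def
        proof (rule labelled_law_swap[where i = "loc t (w t)" and j = "loc t j"])
          show "\<beta> (w(t := j)) i = \<beta> w (Transposition.transpose (loc t (w t)) (loc t j) i)" if "i < p \<or> i = g" for i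
          proof -
            have "i \<in> ?S (w(t := j)) \<longleftrightarrow> Transposition.transpose (loc t (w t)) (loc t j) i \<in> ?S w"
              unfolding selected_update_transpose[OF finite_lessThan inj w t j]
              by (rule mem_transpose_image_iff)
            moreover have "Transposition.transpose (loc t (w t)) (loc t j) i < p \<longleftrightarrow> i < p"
              "Transposition.transpose (loc t (w t)) (loc t j) i = g \<longleftrightarrow> i = g"
              using lt by (auto simp: Transposition.transpose_def)
            ultimately show ?thesis by (simp add: \<beta>_def restrict_def)
          qed
          show "?S (w(t := j)) = Transposition.transpose (loc t (w t)) (loc t j) ` ?S w"
            by (rule selected_update_transpose[OF finite_lessThan inj w t j])
          show "loc t (w t) \<notin> Obs k" "loc t j \<notin> Obs k"
            using locH[of t "w t"] locH[of t j] t j wt 3 by auto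
        qed (use Obs[OF k] pos lt g Sp[OF w] Sp[OF w'] in auto)
        then show ?thesis
          using renyi2_le_refl[OF prob_space_labelled_law[OF proper[OF w] Obs[OF k]]] 3 by simp
      qed
    qed
    also have "(\<Sum>k<K. real (n k) * (?c * of_bool (g \<in> Obs k \<and> H \<subseteq> Obs k))) + real N * ?c = real (?n + N) * ?c"
    proof -
      have "(\<Sum>k<K. real (n k) * (?c * of_bool (g \<in> Obs k \<and> H \<subseteq> Obs k))) = real ?n * ?c"
        unfolding of_nat_sum sum_distrib_right by (intro sum.cong) (auto simp: of_bool_def)
      then show ?thesis by (simp only: of_nat_add distrib_right)
    qed
    finally show ?thesis .
  qed
  have "ennreal (real (card ?T) * (- (b * r))\<^sup>2 / 4) \<le> minimax_risk p K n N Obs R\<^sub>X R B (Suc s) \<Phi>"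
  proof (rule minimax_risk_blocks[OF finite_lessThan finite_lessThan inj _ Obs P_HD _ close])
    show lt: "loc t j < p" if "t \<in> ?T" "j \<in> ?J" for t j using locH[of t j] H that by auto
    have ne: "loc t j \<noteq> g" if "t \<in> ?T" "j \<in> ?J" for t j using locH[of t j] g that by auto
    show "coef (P w) (loc t j) = (if j = w t then - (b * r) else 0)"
      if "w \<in> ?T \<rightarrow>\<^sub>E ?J" "t \<in> ?T" "j \<in> ?J" for w t j
      using that lt ne by (simp add: P_def mech_def \<beta>_def pos_in_selected_iff[OF finite_lessThan inj])
    show "(\<lambda>x. bhat x i) \<in> borel_measurable (data_space p K n N Obs)"
      if "bhat \<in> Theta_HD p K n N Obs R\<^sub>X R B (Suc s) \<Phi>" "i < p" for bhat i
      using pos \<Phi> that by (intro estimator_coordinate_measurable) auto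
  qed (use many in auto)
  then show ?thesis by simp
qed

section \<open>The rates\<close>

text \<open>
  For \<open>y = d / s \<ge> 16\<close> one has \<open>4 sqrt (1 + y / 2) \<le> y - 1\<close>, and \<open>y - 1\<close> is a lower bound for the
  integer block length. Thus a total divergence of half the logarithmic factor is affordable.
\<close>

lemma block_size_sufficient:
  fixes c :: real
  assumes s: "1 \<le> s" "16 * s \<le> d" and c: "c \<le> ln (1 + real d / (2 * real s)) / 2"
  shows "4 * exp c \<le> real (d div s)"
proof -
  define y where "y = real d / real s"
  have y: "16 \<le> y"
  proof -
    have "16 * real s \<le> real d" using s(2) by (metis of_nat_le_iff of_nat_mult of_nat_numeral)
    then show ?thesis using s(1) by (simp add: y_def pos_le_divide_eq)
  qed
  define \<kappa> where "\<kappa> = ln (1 + real d / (2 * real s))"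
  have lam: "exp \<kappa> = 1 + y / 2"
    using y s by (simp add: \<kappa>_def y_def add_pos_nonneg)
  have "(4 * exp (\<kappa> / 2))\<^sup>2 = 16 * (1 + y / 2)"
    by (simp add: power_mult_distrib exp_double[symmetric] lam)
  also have "\<dots> \<le> (y - 1)\<^sup>2"
  proof -
    have "16 * y \<le> y * y" using y by (intro mult_right_mono) auto
    then have "16 + 8 * y \<le> y * y - 2 * y + 1" using y by linarith
    then show ?thesis by (simp add: power2_eq_square algebra_simps)
  qed
  finally have "4 * exp (\<kappa> / 2) \<le> y - 1"
    by (rule power2_le_imp_le) (use y in simp)
  moreover have "exp c \<le> exp (\<kappa> / 2)" using c by (simp add: \<kappa>_def)
  moreover have "y - 1 \<le> real (d div s)"
  proof -
    have "real d = real s * real (d div s) + real (d mod s)"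
      by (metis mult_div_mod_eq of_nat_add of_nat_mult)
    moreover have "d mod s < s" using s by simp
    then have "real (d mod s) \<le> real s" by simp
    ultimately have "real d \<le> real s * (real (d div s) + 1)" by (simp add: algebra_simps)
    then show ?thesis using s by (simp add: y_def pos_divide_le_eq algebra_simps)
  qed
  ultimately show ?thesis by linarith
qed

text \<open>
  With \<open>x = R\<^sub>X\<^sup>2\<close> and \<open>y = 8 / 3\<close>, the minimum is the factor by which \<open>R\<^sub>X\<close> enters the first rate, and its
  product with the variance scale \<open>R\<^sub>X\<^sup>2\<close> is bounded.
\<close>

lemma min_one_square_mult_le:
  fixes x y :: real
  assumes "0 < x" "0 < y"
  shows "min 1 (y\<^sup>2 / x\<^sup>2) * x \<le> y"
proof (cases "x \<le> y")
  case True
  have "min 1 (y\<^sup>2 / x\<^sup>2) * x \<le> 1 * x" using assms(1) by (intro mult_right_mono) simp_all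
  with True show ?thesis by linarith
next
  case False
  have "min 1 (y\<^sup>2 / x\<^sup>2) * x \<le> y\<^sup>2 / x\<^sup>2 * x" using assms(1) by (intro mult_right_mono) simp_all
  also have "\<dots> = y * (y / x)" using assms(1) by (simp add: power2_eq_square)
  also have "\<dots> \<le> y * 1" using assms False by (intro mult_left_mono) simp_all
  finally show ?thesis by simp
qed

lemma isotropic_rate:
  assumes pos: "0 < R" "0 < R\<^sub>X" "0 < \<Phi>" "0 < B" "1 \<le> s" and \<Phi>: "\<Phi> \<le> 3 * R\<^sub>X\<^sup>2 / 16"
    and Obs: "\<And>k. k < K \<Longrightarrow> Obs k \<subseteq> {..<p}" and H: "H \<subseteq> {..<p}"
    and split: "\<And>k. k < K \<Longrightarrow> H \<subseteq> Obs k \<or> H \<inter> Obs k = {}"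
    and large: "16 * s \<le> card H" and h: "0 < mod_count K n Obs H"
    and cond: "R\<^sup>2 * real s * ln (1 + real (card H) / (2 * real s)) / (16 * B\<^sup>2 * \<Phi> * real (mod_count K n Obs H)) \<le> 1"
  shows "ennreal (R\<^sup>2 * real s / (2 ^ 10 * real (mod_count K n Obs H) * \<Phi>) * ln (1 + real (card H) / (2 * real s)))
    \<le> minimax_risk p K n N Obs R\<^sub>X R B s \<Phi>"
proof -
  define \<kappa> where "\<kappa> = ln (1 + real (card H) / (2 * real s))"
  define h where "h = real (mod_count K n Obs H)"
  have lam: "0 \<le> \<kappa>" by (simp add: \<kappa>_def)
  have hpos: "0 < h" using h by (simp add: h_def)
  \<comment> \<open>With this amplitude the total divergence is \<open>\<kappa> / 64\<close> and \<open>s \<alpha>\<^sup>2 / 4\<close> is the claimed rate.\<close>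
  define \<alpha> where "\<alpha> = sqrt (R\<^sup>2 * \<kappa> / (256 * \<Phi> * h))"
  have \<alpha>2: "\<alpha>\<^sup>2 = R\<^sup>2 * \<kappa> / (256 * \<Phi> * h)"
    using lam hpos pos by (simp add: \<alpha>_def)
  have "ennreal (real s * \<alpha>\<^sup>2 / 4) \<le> minimax_risk p K n N Obs R\<^sub>X R B s \<Phi>"
  proof (rule isotropic_lower_bound[OF pos \<Phi> Obs H split, where m = "card H div s"])
    show "s * (card H div s) \<le> card H" by simp
    have "R\<^sup>2 * real s * \<kappa> \<le> 16 * B\<^sup>2 * \<Phi> * h"
      using cond pos hpos by (simp add: \<kappa>_def[symmetric] h_def[symmetric] pos_divide_le_eq)
    also have "\<dots> \<le> 256 * B\<^sup>2 * \<Phi> * h" using pos hpos by simp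
    finally have "R\<^sup>2 * real s * \<kappa> \<le> 256 * B\<^sup>2 * \<Phi> * h" .
    then show "real s * \<alpha>\<^sup>2 \<le> B\<^sup>2"
      using pos hpos by (simp add: \<alpha>2 pos_divide_le_eq mult_ac)
    have info: "real (mod_count K n Obs H) * (4 * \<alpha>\<^sup>2 * \<Phi> / R\<^sup>2) = \<kappa> / 64"
      using pos hpos by (simp add: \<alpha>2 h_def[symmetric] field_simps)
    have "\<kappa> / 64 \<le> \<kappa> / 2" using lam by simp
    then show "4 * exp (real (mod_count K n Obs H) * (4 * \<alpha>\<^sup>2 * \<Phi> / R\<^sup>2)) \<le> real (card H div s)"
      unfolding info by (intro block_size_sufficient pos(5) large) (simp only: \<kappa>_def)
  qed
  also have "real s * \<alpha>\<^sup>2 / 4 = R\<^sup>2 * real s / (2 ^ 10 * h * \<Phi>) * \<kappa>"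
    by (simp add: \<alpha>2 mult_ac)
  finally show ?thesis by (simp only: \<kappa>_def h_def)
qed

lemma coupled_rate:
  assumes pos: "0 < R" "0 < R\<^sub>X" "0 < \<Phi>" "0 < B" "2 \<le> s" and \<Phi>: "\<Phi> \<le> 3 * R\<^sub>X\<^sup>2 / 16"
    and Obs: "\<And>k. k < K \<Longrightarrow> Obs k \<subseteq> {..<p}" and H: "H \<subseteq> {..<p}" and g: "g < p" "g \<notin> H"
    and split: "\<And>k. k < K \<Longrightarrow> H \<subseteq> Obs k \<or> H \<inter> Obs k = {}"
    and large: "16 * s \<le> card H"
    and M: "M = real (\<Sum>k<K. n k * of_bool (g \<in> Obs k \<and> H \<subseteq> Obs k)) + real N" "0 < M"
    and cond: "16 * real s * ln (1 + real (card H) / (2 * (real s - 1))) * min 1 (R\<^sup>2 / B\<^sup>2) * min 1 (1 / R\<^sub>X ^ 4) / (9 * M) \<le> 1"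
  shows "ennreal (min 1 (2 ^ 6 / (3 ^ 2 * R\<^sub>X ^ 4)) * min (B\<^sup>2) (R\<^sup>2) * real s
      * ln (1 + real (card H) / (2 * (real s - 1))) / (2 ^ 17 * M)) \<le> minimax_risk p K n N Obs R\<^sub>X R B s \<Phi>"
proof -
  define t where "t = s - 1"
  have t: "s = Suc t" "1 \<le> t" "real s - 1 = real t" using pos(5) by (auto simp: t_def)
  define \<kappa> where "\<kappa> = ln (1 + real (card H) / (2 * real t))"
  have lam: "0 \<le> \<kappa>" by (simp add: \<kappa>_def)
  define a where "a = min 1 (2 ^ 6 / (3 ^ 2 * R\<^sub>X ^ 4))"
  define q where "q = min 1 (R\<^sup>2 / B\<^sup>2)"
  have a: "0 \<le> a" "a \<le> 1" and q: "0 \<le> q" "q \<le> 1" using pos by (auto simp: a_def q_def)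
  have a4: "a \<le> 64 / 9 * min 1 (1 / R\<^sub>X ^ 4)"
  proof -
    have "a \<le> 64 / 9 * (1 / R\<^sub>X ^ 4)" by (simp add: a_def)
    then show ?thesis using a(2) by (auto simp: min_def)
  qed
  have aX: "a * R\<^sub>X\<^sup>2 \<le> 8 / 3"
    using min_one_square_mult_le[of "R\<^sub>X\<^sup>2" "8 / 3"] pos by (simp add: a_def power_divide)
  have qB: "q * (B\<^sup>2 / R\<^sup>2) \<le> 1"
  proof -
    have "q * (B\<^sup>2 / R\<^sup>2) \<le> R\<^sup>2 / B\<^sup>2 * (B\<^sup>2 / R\<^sup>2)" by (intro mult_right_mono) (auto simp: q_def)
    then show ?thesis using pos by simp
  qed
  \<comment> \<open>The risk is at least \<open>B\<^sup>2 r\<^sup>2 / 8\<close> per block, and there are \<open>s - 1 \<ge> s / 2\<close> blocks; hence the factor \<open>2 ^ 13\<close>.\<close>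
  define r where "r = sqrt (a * q * \<kappa> / (2 ^ 13 * M))"
  have r2: "r\<^sup>2 = a * q * \<kappa> / (2 ^ 13 * M)"
    using a q lam M(2) by (simp add: r_def)
  \<comment> \<open>Half of the budget \<open>B\<^sup>2\<close> goes to coordinate \<open>g\<close>, which leaves room for the entries in \<open>H\<close>.\<close>
  define b where "b = B / sqrt 2"
  have b2: "b\<^sup>2 = B\<^sup>2 / 2" by (simp add: b_def power_divide)
  have coupling: "real t * r\<^sup>2 \<le> 1 / 12"
  proof -
    define m where "m = min 1 (1 / R\<^sub>X ^ 4)"
    have am: "a \<le> 64 / 9 * m" using a4 by (simp only: m_def)
    have ts: "real t \<le> real s" using t(1) by simp
    have nn: "0 \<le> real s * \<kappa> * q" "0 \<le> \<kappa> * q * a" using lam q(1) a(1) by simp_all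
    have "16 * real s * \<kappa> * q * m / (9 * M) \<le> 1"
      using cond by (simp only: t(3) \<kappa>_def q_def m_def)
    then have "16 * real s * \<kappa> * q * m \<le> 9 * M"
      using M(2) by (subst (asm) pos_divide_le_eq) auto
    then have "16 * (real s * \<kappa> * q * m) \<le> 9 * M" by (simp only: mult.assoc)
    moreover have "real s * \<kappa> * q * a \<le> 64 / 9 * (real s * \<kappa> * q * m)"
      using mult_left_mono[OF am nn(1)] by (simp only: mult_ac)
    moreover have "real t * \<kappa> * q * a \<le> real s * \<kappa> * q * a"
      using mult_right_mono[OF ts nn(2)] by (simp only: mult.assoc)
    ultimately have "real t * \<kappa> * q * a \<le> 4 * M" by linarith
    then have "real t * \<kappa> * q * a / (2 ^ 13 * M) \<le> 4 * M / (2 ^ 13 * M)"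
      by (rule divide_right_mono) (use M(2) in simp)
    moreover have "4 * M / (2 ^ 13 * M) = 1 / 2048" using M(2) by simp
    moreover have "real t * r\<^sup>2 = real t * \<kappa> * q * a / (2 ^ 13 * M)"
      by (simp add: r2 mult_ac)
    ultimately show ?thesis by linarith
  qed
  have "ennreal (real t * (b * r)\<^sup>2 / 4) \<le> minimax_risk p K n N Obs R\<^sub>X R B (Suc t) \<Phi>"
  proof (rule coupled_lower_bound[OF pos(1-4) \<Phi> Obs H g split _ coupling, where m = "card H div t"])
    show "t * (card H div t) \<le> card H" by simp
    have "B\<^sup>2 / 2 * (1 + real t * r\<^sup>2) \<le> B\<^sup>2 / 2 * 2"
      using coupling by (intro mult_left_mono) auto
    then show "b\<^sup>2 * (1 + real t * r\<^sup>2) \<le> B\<^sup>2" by (simp add: b2)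
    define e where "e = 1 + R\<^sub>X\<^sup>2 / 4 * b\<^sup>2 / R\<^sup>2"
    have "a * q * e = a * q + (a * R\<^sub>X\<^sup>2) * (q * (B\<^sup>2 / R\<^sup>2)) / 8"
      by (simp add: e_def b2 algebra_simps)
    also have "\<dots> \<le> 1 * 1 + (8 / 3) * 1 / 8"
      using a q aX qB pos by (intro add_mono mult_mono divide_right_mono) auto
    finally have info: "a * q * e \<le> 2" by simp
    have "M * (4 * r\<^sup>2 * e) = \<kappa> * (a * q * e) / 2 ^ 11"
      using M(2) by (simp add: r2)
    also have "\<dots> \<le> \<kappa> * 2 / 2 ^ 11"
      by (intro divide_right_mono mult_left_mono info lam) simp
    also have "\<dots> \<le> \<kappa> / 2" using lam by simp
    finally have "4 * exp (M * (4 * r\<^sup>2 * e)) \<le> real (card H div t)"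
      using large t(1,2) unfolding \<kappa>_def by (intro block_size_sufficient) auto
    then show "4 * exp (real ((\<Sum>k<K. n k * of_bool (g \<in> Obs k \<and> H \<subseteq> Obs k)) + N)
        * (4 * r\<^sup>2 * (1 + R\<^sub>X\<^sup>2 / 4 * b\<^sup>2 / R\<^sup>2))) \<le> real (card H div t)"
      by (simp only: M(1) of_nat_add e_def)
  qed
  moreover have "a * min (B\<^sup>2) (R\<^sup>2) * real s * \<kappa> / (2 ^ 17 * M) \<le> real t * (b * r)\<^sup>2 / 4"
  proof -
    have min: "min (B\<^sup>2) (R\<^sup>2) = B\<^sup>2 * q"
      using pos(1,4) by (auto simp: q_def min_def pos_le_divide_eq)
    have "a * (B\<^sup>2 * q) * real s * \<kappa> / (2 ^ 17 * M) = real s * (a * q * \<kappa> * B\<^sup>2 / (2 ^ 17 * M))"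
      by (simp only: times_divide_eq_right mult_ac)
    also have "\<dots> \<le> (2 * real t) * (a * q * \<kappa> * B\<^sup>2 / (2 ^ 17 * M))"
    proof (rule mult_right_mono)
      show "real s \<le> 2 * real t" using t(1,2) by simp
      show "0 \<le> a * q * \<kappa> * B\<^sup>2 / (2 ^ 17 * M)" using a(1) q(1) lam M(2) by simp
    qed
    also have "\<dots> = real t * (b * r)\<^sup>2 / 4"
      using M(2) by (simp add: power_mult_distrib b2 r2)
    finally show ?thesis by (simp only: min)
  qed
  ultimately have "ennreal (a * min (B\<^sup>2) (R\<^sup>2) * real s * \<kappa> / (2 ^ 17 * M)) \<le> minimax_risk p K n N Obs R\<^sub>X R B (Suc t) \<Phi>"
    by (meson ennreal_leI order.trans)
  then show ?thesis by (simp only: a_def \<kappa>_def t(1) t(3)[unfolded t(1)])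
qed

lemma log_ratio_pred_le:
  assumes "2 \<le> s"
  shows "ln (1 + real d / (2 * (real s - 1))) \<le> 2 * ln (1 + real d / (2 * real s))"
proof -
  define x where "x = real d / (2 * real s)"
  have x: "0 \<le> x" by (simp add: x_def)
  have s: "real s \<le> 2 * (real s - 1)" "0 < real s" using assms by auto
  have "real d / (2 * (real s - 1)) \<le> real d / real s"
    using s by (intro frac_le) auto
  also have "\<dots> = 2 * x" using s by (simp add: x_def)
  also have "\<dots> \<le> 2 * x + x\<^sup>2" by simp
  finally have "1 + real d / (2 * (real s - 1)) \<le> (1 + x)\<^sup>2"
    by (simp add: power2_sum)
  moreover have "0 < 1 + real d / (2 * (real s - 1))"
    using s by (intro add_pos_nonneg divide_nonneg_nonneg) auto
  ultimately have "ln (1 + real d / (2 * (real s - 1))) \<le> ln ((1 + x)\<^sup>2)"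
    by (intro ln_mono) auto
  also have "\<dots> = 2 * ln (1 + x)"
    using x by (subst ln_realpow) auto
  finally show ?thesis by (simp only: x_def)
qed

text \<open>
  This covers the pairs of a modality with itself: since \<open>\<Phi>\<close> is at most a multiple of \<open>R\<^sub>X\<^sup>2\<close>, the factor
  \<open>1 / \<Phi>\<close> in the isotropic rate beats the truncated \<open>R\<^sub>X\<close> factor of the coupled one.
\<close>

lemma coupled_rate_le_isotropic_rate:
  assumes pos: "0 < R" "0 < R\<^sub>X" "0 < \<Phi>" "0 < B" "2 \<le> s" and \<Phi>: "\<Phi> \<le> 3 * R\<^sub>X\<^sup>2 / 16"
    and h: "0 < h" "h \<le> M"
  shows "min 1 (2 ^ 6 / (3 ^ 2 * R\<^sub>X ^ 4)) * min (B\<^sup>2) (R\<^sup>2) * real s * ln (1 + real d / (2 * (real s - 1))) / (2 ^ 17 * M)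
    \<le> R\<^sup>2 * real s / (2 ^ 10 * h * \<Phi>) * ln (1 + real d / (2 * real s))"
proof -
  define a where "a = min 1 (2 ^ 6 / (3 ^ 2 * R\<^sub>X ^ 4))"
  define \<kappa> where "\<kappa> = ln (1 + real d / (2 * real s))"
  define \<kappa>' where "\<kappa>' = ln (1 + real d / (2 * (real s - 1)))"
  have lam: "0 \<le> \<kappa>" by (simp add: \<kappa>_def)
  have lam': "0 \<le> \<kappa>'" "\<kappa>' \<le> 2 * \<kappa>"
    using log_ratio_pred_le[OF pos(5), of d] pos(5) by (simp_all add: \<kappa>_def \<kappa>'_def)
  have a0: "0 \<le> a" using pos(2) by (simp add: a_def)
  have "a * R\<^sub>X\<^sup>2 \<le> 8 / 3"
    using min_one_square_mult_le[of "R\<^sub>X\<^sup>2" "8 / 3"] pos(2) by (simp add: a_def power_divide)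
  moreover have "a * \<Phi> \<le> a * (3 * R\<^sub>X\<^sup>2 / 16)" by (intro mult_left_mono \<Phi> a0)
  ultimately have "a * \<Phi> \<le> 1" by simp
  then have aP: "a \<le> 1 / \<Phi>" using pos(3) by (simp add: pos_le_divide_eq)
  have "a * min (B\<^sup>2) (R\<^sup>2) \<le> 1 / \<Phi> * R\<^sup>2"
    using aP pos(3) by (intro mult_mono) auto
  then have "a * min (B\<^sup>2) (R\<^sup>2) * real s \<le> 1 / \<Phi> * R\<^sup>2 * real s"
    by (rule mult_right_mono) simp
  then have num: "a * min (B\<^sup>2) (R\<^sup>2) * real s * \<kappa>' \<le> 1 / \<Phi> * R\<^sup>2 * real s * (2 * \<kappa>)"
    by (rule mult_mono[OF _ lam'(2)]) (use lam' pos(3) in simp_all)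
  define u where "u = R\<^sup>2 * real s * \<kappa> / (h * \<Phi>)"
  have u: "0 \<le> u" using lam h pos(3) by (simp add: u_def)
  have "a * min (B\<^sup>2) (R\<^sup>2) * real s * \<kappa>' / (2 ^ 17 * M) \<le> 1 / \<Phi> * R\<^sup>2 * real s * (2 * \<kappa>) / (2 ^ 17 * h)"
    using h lam pos(3) by (intro frac_le num) auto
  also have "\<dots> = u / 2 ^ 16"
    by (simp add: u_def mult_ac)
  also have "\<dots> \<le> u / 2 ^ 10" using u by simp
  also have "\<dots> = R\<^sup>2 * real s / (2 ^ 10 * h * \<Phi>) * \<kappa>"
    by (simp add: u_def mult_ac)
  finally show ?thesis by (simp only: a_def \<kappa>_def \<kappa>'_def)
qed

lemma pattern_splits_modality:
  assumes "resolves_patterns p K Obs \<L>" "l \<in> \<L>" "k < K"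
  shows "l \<subseteq> Obs k \<or> l \<inter> Obs k = {}"
proof -
  obtain \<C> where \<C>: "\<C> \<subseteq> \<L>" "Obs k = \<Union>\<C>"
    using assms by (auto simp: resolves_patterns_def)
  have "disjoint \<L>" using assms by (auto simp: resolves_patterns_def partition_on_def)
  then have "l \<inter> C = {}" if "C \<in> \<C>" "l \<notin> \<C>" for C
    using that \<C>(1) assms(2) by (auto dest: disjointD)
  then show ?thesis using \<C>(2) by (cases "l \<in> \<C>") auto
qed

theorem theorem9:
  shows "\<exists>c\<^sub>1::real. c\<^sub>1 > 0 \<and>
    (\<forall>(p::nat) (K::nat) (n::nat \<Rightarrow> nat) (N::nat) (Obs::nat \<Rightarrow> nat set) (\<L>::nat set set)
       (R\<^sub>X::real) (R::real) (B::real) (s::nat) (\<Phi>::real).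
      (\<forall>k<K. Obs k \<subseteq> {..<p}) \<longrightarrow>
      (\<Union>k<K. Obs k) = {..<p} \<longrightarrow>
      modalities p K Obs \<L> \<longrightarrow>
      R > 0 \<longrightarrow> B > 0 \<longrightarrow> R\<^sub>X > 0 \<longrightarrow> \<Phi> > 0 \<longrightarrow> s \<le> p \<longrightarrow>
      \<Phi> \<le> 3 * R\<^sub>X\<^sup>2 / 16 \<longrightarrow>
      2 \<le> s \<longrightarrow>
      real s \<le> c\<^sub>1 * (MIN l\<in>\<L>. real (card l)) \<longrightarrow>
      (\<forall>g\<in>\<L>. \<forall>h\<in>\<L>. mod_pair_count K n Obs g h + N > 0) \<longrightarrow>
      (\<forall>i\<in>\<L>. mod_count K n Obs i > 0) \<longrightarrow>
      (MAX (g, h)\<in>\<L> \<times> \<L>.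
         16 * real s * ln (1 + real (card h) / (2 * (real s - 1)))
           * min 1 (R\<^sup>2 / B\<^sup>2) * min 1 (1 / R\<^sub>X ^ 4)
         / (9 * (real (mod_pair_count K n Obs g h) + real N))) \<le> 1 \<longrightarrow>
      (MAX i\<in>\<L>.
         R\<^sup>2 * real s * ln (1 + real (card i) / (2 * real s))
         / (16 * B\<^sup>2 * \<Phi> * real (mod_count K n Obs i))) \<le> 1 \<longrightarrow>
      minimax_risk p K n N Obs R\<^sub>X R B s \<Phi> \<ge>
        ennreal (max
          (MAX h\<in>\<L>.
             min 1 (2 ^ 6 / (3 ^ 2 * R\<^sub>X ^ 4)) * min (B\<^sup>2) (R\<^sup>2) * real s
               * ln (1 + real (card h) / (2 * (real s - 1)))
             / (2 ^ 17 * (MIN g\<in>\<L>. real (mod_pair_count K n Obs g h) + real N)))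
          (MAX l\<in>\<L>.
             R\<^sup>2 * real s / (2 ^ 10 * real (mod_count K n Obs l) * \<Phi>)
               * ln (1 + real (card l) / (2 * real s)))))"
proof (intro exI[of _ "1 / 16"] conjI allI impI)
  fix p K :: nat and n :: "nat \<Rightarrow> nat" and N :: nat and Obs :: "nat \<Rightarrow> nat set" and \<L> :: "nat set set"
    and R\<^sub>X R B :: real and s :: nat and \<Phi> :: real
  assume Obs: "\<forall>k<K. Obs k \<subseteq> {..<p}" and mods: "modalities p K Obs \<L>"
    and pos: "R > 0" "B > 0" "R\<^sub>X > 0" "\<Phi> > 0" and sp: "s \<le> p" and \<Phi>: "\<Phi> \<le> 3 * R\<^sub>X\<^sup>2 / 16"
    and s: "2 \<le> s" and small: "real s \<le> 1 / 16 * (MIN l\<in>\<L>. real (card l))"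
    and pair_pos: "\<forall>g\<in>\<L>. \<forall>h\<in>\<L>. mod_pair_count K n Obs g h + N > 0"
    and count_pos: "\<forall>i\<in>\<L>. mod_count K n Obs i > 0"
    and cond1: "(MAX (g, h)\<in>\<L> \<times> \<L>. 16 * real s * ln (1 + real (card h) / (2 * (real s - 1)))
           * min 1 (R\<^sup>2 / B\<^sup>2) * min 1 (1 / R\<^sub>X ^ 4) / (9 * (real (mod_pair_count K n Obs g h) + real N))) \<le> 1"
    and cond2: "(MAX i\<in>\<L>. R\<^sup>2 * real s * ln (1 + real (card i) / (2 * real s))
         / (16 * B\<^sup>2 * \<Phi> * real (mod_count K n Obs i))) \<le> 1"
  let ?risk = "minimax_risk p K n N Obs R\<^sub>X R B s \<Phi>"
  have res: "resolves_patterns p K Obs \<L>"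
    using mods by (simp add: modalities_def is_arg_min_def)
  then have part: "partition_on {..<p} \<L>" by (simp add: resolves_patterns_def)
  have fin: "finite \<L>" by (rule finite_elements[OF _ part]) simp
  have ne: "\<L> \<noteq> {}"
  proof
    assume "\<L> = {}"
    then have "{..<p} = {}" using part by (simp add: partition_on_def)
    then show False using s sp by (simp add: lessThan_empty_iff)
  qed
  have sub: "l \<subseteq> {..<p}" if "l \<in> \<L>" for l using part that by (auto simp: partition_on_def)
  have large: "16 * s \<le> card l" if "l \<in> \<L>" for l
  proof -
    have "(MIN l\<in>\<L>. real (card l)) \<le> real (card l)" using fin that by (intro Min_le) auto
    then have "16 * real s \<le> real (card l)" using small by simp
    then show ?thesis by (metis of_nat_le_iff of_nat_mult of_nat_numeral)
  qed
  have iso: "ennreal (R\<^sup>2 * real s / (2 ^ 10 * real (mod_count K n Obs l) * \<Phi>) * ln (1 + real (card l) / (2 * real s))) \<le> ?risk"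
    if l: "l \<in> \<L>" for l
  proof (rule isotropic_rate[OF pos(1,3,4,2) _ \<Phi> _ sub[OF l] pattern_splits_modality[OF res l] large[OF l]])
    have "R\<^sup>2 * real s * ln (1 + real (card l) / (2 * real s)) / (16 * B\<^sup>2 * \<Phi> * real (mod_count K n Obs l))
        \<le> (MAX i\<in>\<L>. R\<^sup>2 * real s * ln (1 + real (card i) / (2 * real s)) / (16 * B\<^sup>2 * \<Phi> * real (mod_count K n Obs i)))"
      using fin l by (intro Max_ge) auto
    with cond2 show "R\<^sup>2 * real s * ln (1 + real (card l) / (2 * real s)) / (16 * B\<^sup>2 * \<Phi> * real (mod_count K n Obs l)) \<le> 1"
      by linarith
  qed (use s Obs count_pos l in auto)
  have pair: "ennreal (min 1 (2 ^ 6 / (3 ^ 2 * R\<^sub>X ^ 4)) * min (B\<^sup>2) (R\<^sup>2) * real s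
      * ln (1 + real (card h) / (2 * (real s - 1))) / (2 ^ 17 * (real (mod_pair_count K n Obs g h) + real N))) \<le> ?risk"
    if g: "g \<in> \<L>" and h: "h \<in> \<L>" for g h
  proof (cases "g = h")
    case True
    have same: "mod_pair_count K n Obs g h = mod_count K n Obs h"
      by (simp add: True mod_pair_count_def mod_count_def)
    show ?thesis
      using count_pos h s unfolding same
      by (intro order.trans[OF ennreal_leI iso[OF h]] coupled_rate_le_isotropic_rate pos \<Phi>) auto
  next
    case False
    have "g \<inter> h = {}" using part g h False by (auto simp: partition_on_def dest: disjointD)
    moreover have "g \<noteq> {}" using part g by (auto simp: partition_on_def)
    ultimately obtain i where i: "i \<in> g" "i \<notin> h" by blast
    have ik: "i \<in> Obs k \<longleftrightarrow> g \<subseteq> Obs k" if "k < K" for k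
      using pattern_splits_modality[OF res g that] i by auto
    have "mod_pair_count K n Obs g h = (\<Sum>k<K. n k * of_bool (i \<in> Obs k \<and> h \<subseteq> Obs k))"
      unfolding mod_pair_count_def by (intro sum.cong) (auto simp: ik)
    then have M: "real (mod_pair_count K n Obs g h) + real N
        = real (\<Sum>k<K. n k * of_bool (i \<in> Obs k \<and> h \<subseteq> Obs k)) + real N" by simp
    show ?thesis
    proof (rule coupled_rate[OF pos(1,3,4,2) s \<Phi> _ sub[OF h] _ i(2) pattern_splits_modality[OF res h] large[OF h] M])
      show "i < p" using sub[OF g] i by auto
      show "0 < real (mod_pair_count K n Obs g h) + real N"
        using pair_pos g h by (metis of_nat_0_less_iff of_nat_add)
      have "(\<lambda>(g, h). 16 * real s * ln (1 + real (card h) / (2 * (real s - 1)))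
           * min 1 (R\<^sup>2 / B\<^sup>2) * min 1 (1 / R\<^sub>X ^ 4) / (9 * (real (mod_pair_count K n Obs g h) + real N))) (g, h) \<le> 1"
        using fin g h by (intro order.trans[OF Max_ge cond1]) auto
      then show "16 * real s * ln (1 + real (card h) / (2 * (real s - 1)))
           * min 1 (R\<^sup>2 / B\<^sup>2) * min 1 (1 / R\<^sub>X ^ 4) / (9 * (real (mod_pair_count K n Obs g h) + real N)) \<le> 1"
        by simp
    qed (use Obs in auto)
  qed
  define F where "F h = min 1 (2 ^ 6 / (3 ^ 2 * R\<^sub>X ^ 4)) * min (B\<^sup>2) (R\<^sup>2) * real s
      * ln (1 + real (card h) / (2 * (real s - 1)))
      / (2 ^ 17 * (MIN g\<in>\<L>. real (mod_pair_count K n Obs g h) + real N))" for h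
  define G where "G l = R\<^sup>2 * real s / (2 ^ 10 * real (mod_count K n Obs l) * \<Phi>) * ln (1 + real (card l) / (2 * real s))" for l
  have "ennreal (F h) \<le> ?risk" if h: "h \<in> \<L>" for h
  proof -
    have "(MIN g\<in>\<L>. real (mod_pair_count K n Obs g h) + real N) \<in> (\<lambda>g. real (mod_pair_count K n Obs g h) + real N) ` \<L>"
      using fin ne by (intro Min_in) auto
    then obtain g where "g \<in> \<L>" "(MIN g\<in>\<L>. real (mod_pair_count K n Obs g h) + real N) = real (mod_pair_count K n Obs g h) + real N"
      by auto
    then show ?thesis unfolding F_def using pair[OF _ h, of g] by simp
  qed
  moreover have "ennreal (G l) \<le> ?risk" if "l \<in> \<L>" for l
    using iso[OF that] by (simp only: G_def)
  moreover have "(MAX h\<in>\<L>. F h) \<in> F ` \<L>" "(MAX l\<in>\<L>. G l) \<in> G ` \<L>"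
    using fin ne by (auto intro!: Max_in)
  ultimately have "ennreal (max (MAX h\<in>\<L>. F h) (MAX l\<in>\<L>. G l)) \<le> ?risk"
    by (auto simp: max_def)
  then show "ennreal (max
      (MAX h\<in>\<L>. min 1 (2 ^ 6 / (3 ^ 2 * R\<^sub>X ^ 4)) * min (B\<^sup>2) (R\<^sup>2) * real s
         * ln (1 + real (card h) / (2 * (real s - 1)))
         / (2 ^ 17 * (MIN g\<in>\<L>. real (mod_pair_count K n Obs g h) + real N)))
      (MAX l\<in>\<L>. R\<^sup>2 * real s / (2 ^ 10 * real (mod_count K n Obs l) * \<Phi>)
         * ln (1 + real (card l) / (2 * real s)))) \<le> ?risk"
    by (simp only: F_def G_def)
qed simp

end
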